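(* Let $r>1$ and $n\ge 1$ be integers and let $R$ be a commutative ring with one. For all signed compositions $\mu,\nu$ of $n$, the following identity holds in the group algebra $RG_{r,n}$: $$E_\mu E_\nu=\sum_{d\in\mathscr D_{\mu^+\nu^+}}|T_{-\mu\cap d(-\nu)}|\,E_{\mu\cap d\nu}.$$
   Context: $G_{r,n}$ is the group with generators $s_0,s_1,\dots,s_{n-1}$ and relations $s_0^r=1$, $s_i^2=1$ ($1\le i\le n-1$), $s_0s_1s_0s_1=s_1s_0s_1s_0$, $s_is_j=s_js_i$ for $|i-j|>1$ ($0\le i,j\le n-1$), and $s_is_{i+1}s_i=s_{i+1}s_is_{i+1}$ ($1\le i\le n-2$); it is the complex reflection group $G(r,1,n)\cong(\mathbb Z/r\mathbb Z)\wr\mathfrak S_n$. The subgroup $\langle s_1,\dots,s_{n-1}\rangle$ is identified with the symmetric group $\mathfrak S_n$ via $s_i\mapsto(i,i+1)$; $\mathfrak S_n$ acts on $\{1,\dots,n\}$ on the right, $i\mapsto i^w$. Put $t_1=s_0$, $t_{i+1}=s_it_is_i$; then $T=\langle t_1,\dots,t_n\rangle\cong(\mathbb Z/r\mathbb Z)^n$ is normal, $t_iw=wt_{i^w}$ for $w\in\mathfrak S_n$, and $G_{r,n}=T\rtimes\mathfrak S_n$. Let $\Pi=\{t_1,\dots,t_n,s_1,\dots,s_{n-1}\}$ and let $\ell(g)$ be the minimal $k$ such that $g$ is a product of $k$ elements of $\Pi$. A signed composition of $n$ is a sequence $\mu=(\mu_1,\dots,\mu_k)$ of nonzero integers with $\sum|\mu_i|=n$;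 put $\mu^+=(|\mu_1|,\dots,|\mu_k|)$ (a composition), $-\mu=(-\mu_1,\dots,-\mu_k)$, $\bar\mu_0=0$, $\bar\mu_i=|\mu_1|+\dots+|\mu_i|$. Let $\Pi_\mu$ consist of all $s_j$ with $\bar\mu_{i-1}<j<\bar\mu_i$ for some $i$, together with all $t_j$ with $\bar\mu_{i-1}<j\le\bar\mu_i$ for some $i$ with $\mu_i>0$. Let $G_\mu=\langle\Pi_\mu\rangle$ and $T_\mu=G_\mu\cap T$. Let $\mathscr E_\mu=\{e\in G_{r,n}:\ell(e)\le\ell(g)\text{ for all }g\in G_\mu e\}$ and $E_\mu=\sum_{e\in\mathscr E_\mu}e\in RG_{r,n}$. For a composition $\lambda$ of $n$, $\mathfrak S_\lambda$ is the corresponding Young subgroup of $\mathfrak S_n$ and $\mathscr D_\lambda$ is the set of minimal-length (Coxeter length) elements of the right cosets $\mathfrak S_\lambda w$; for compositions $\lambda,\nu$ put $\mathscr D_{\lambda\nu}=\mathscr D_\lambda\cap\mathscr D_\nu^{-1}$ (minimal length $(\mathfrak S_\lambda,\mathfrak S_\nu)$-double coset representatives). For signed compositions $\mu,\nu$ and $d\in\mathscr D_{\mu^+\nu^+}$, the subgroup $G_\mu\cap dG_\nu d^{-1}$ equals $G_\sigma$ for a unique signed composition $\sigma$, denoted $\mu\cap d\nu$ (note $\mathscr D_{\mu^+\nu^+}=\mathscr D_{(-\mu)^+(-\nu)^+}$, so $-\mu\cap d(-\nu)$ is defined similarly). *)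

theory Defs
  imports "HOL-Algebra.Generated_Groups" "HOL-Algebra.Ring"
begin

section \<open>Groups given by generators and relations\<close>

text \<open>A letter \<open>(x, True)\<close> stands for the generator \<open>x\<close>, and \<open>(x, False)\<close> for its formal inverse.\<close>

type_synonym 'x word = "('x \<times> bool) list"

definition words :: "'x set \<Rightarrow> 'x word set" where
  "words X = lists (X \<times> UNIV)"

inductive pres_cong :: "'x set \<Rightarrow> ('x word \<times> 'x word) set \<Rightarrow> 'x word \<Rightarrow> 'x word \<Rightarrow> bool"
  for X :: "'x set" and Q :: "('x word \<times> 'x word) set" where
  refl: "u \<in> words X \<Longrightarrow> pres_cong X Q u u"
| sym: "pres_cong X Q u v \<Longrightarrow> pres_cong X Q v u"
| trans: "pres_cong X Q u v \<Longrightarrow> pres_cong X Q v w \<Longrightarrow> pres_cong X Q u w"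
| append: "pres_cong X Q u u' \<Longrightarrow> pres_cong X Q v v' \<Longrightarrow> pres_cong X Q (u @ v) (u' @ v')"
| cancel: "x \<in> X \<Longrightarrow> pres_cong X Q [(x, b), (x, \<not> b)] []"
| rel: "(u, v) \<in> Q \<Longrightarrow> u \<in> words X \<Longrightarrow> v \<in> words X \<Longrightarrow> pres_cong X Q u v"

definition pres_class :: "'x set \<Rightarrow> ('x word \<times> 'x word) set \<Rightarrow> 'x word \<Rightarrow> 'x word set" where
  "pres_class X Q u = {v. pres_cong X Q u v}"

text \<open>The product of two classes is the union of the classes of all concatenations of
  representatives; these classes all coincide (lemma \<open>presented_mult\<close> below).\<close>

definition presented_group :: "'x set \<Rightarrow> ('x word \<times> 'x word) set \<Rightarrow> 'x word set monoid" where
  "presented_group X Q =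
     \<lparr>carrier = pres_class X Q ` words X,
      mult = (\<lambda>A B. \<Union>u\<in>A. \<Union>v\<in>B. pres_class X Q (u @ v)),
      one = pres_class X Q []\<rparr>"

lemma pres_cong_words: "pres_cong X Q u v \<Longrightarrow> u \<in> words X \<and> v \<in> words X"
  by (induction rule: pres_cong.induct) (auto simp: words_def)

lemma pres_class_eq: "pres_cong X Q u v \<Longrightarrow> pres_class X Q u = pres_class X Q v"
  unfolding pres_class_def by (blast intro: pres_cong.sym pres_cong.trans)

lemma presented_mult:
  assumes "u \<in> words X" "v \<in> words X"
  shows "pres_class X Q u \<otimes>\<^bsub>presented_group X Q\<^esub> pres_class X Q v = pres_class X Q (u @ v)"
proof -
  have eq: "pres_class X Q (u' @ v') = pres_class X Q (u @ v)"
    if "u' \<in> pres_class X Q u" "v' \<in> pres_class X Q v" for u' v'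
    using that unfolding pres_class_def[of X Q u] pres_class_def[of X Q v]
    by (metis mem_Collect_eq pres_class_eq pres_cong.append)
  have mem: "u \<in> pres_class X Q u" "v \<in> pres_class X Q v"
    using assms by (simp_all add: pres_class_def pres_cong.refl)
  have "(\<Union>u'\<in>pres_class X Q u. \<Union>v'\<in>pres_class X Q v. pres_class X Q (u' @ v'))
      = (\<Union>u'\<in>pres_class X Q u. \<Union>v'\<in>pres_class X Q v. pres_class X Q (u @ v))"
    by (intro SUP_cong HOL.refl eq)
  also have "\<dots> = pres_class X Q (u @ v)"
    using mem by (simp only: UN_constant) (simp split: if_splits, blast)
  finally show ?thesis
    by (simp add: presented_group_def)
qed

lemma pres_left_inverse:
  "u \<in> words X \<Longrightarrow> \<exists>v\<in>words X. pres_cong X Q (v @ u) []"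
proof (induction u)
  case Nil
  then show ?case by (auto simp: words_def intro!: bexI[of _ "[]"] pres_cong.refl)
next
  case (Cons a u)
  obtain x b where a: "a = (x, b)" by (cases a)
  from Cons have x: "x \<in> X" and u: "u \<in> words X" by (auto simp: words_def a)
  with Cons obtain v where v: "v \<in> words X" "pres_cong X Q (v @ u) []" by blast
  have "pres_cong X Q ([(x, \<not> b), (x, b)] @ u) ([] @ u)"
    using pres_cong.append[OF pres_cong.cancel[OF x, of Q "\<not> b"] pres_cong.refl[OF u]] by simp
  then have "pres_cong X Q (v @ ([(x, \<not> b), (x, b)] @ u)) (v @ ([] @ u))"
    by (rule pres_cong.append[OF pres_cong.refl[OF v(1)]])
  then have "pres_cong X Q (v @ [(x, \<not> b), (x, b)] @ u) []"
    using pres_cong.trans[OF _ v(2)] by simp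
  then have "pres_cong X Q ((v @ [(x, \<not> b)]) @ a # u) []"
    by (simp add: a)
  moreover have "v @ [(x, \<not> b)] \<in> words X" using v x by (auto simp: words_def)
  ultimately show ?case by blast
qed

lemma group_presented_group: "group (presented_group X Q)"
proof (rule groupI)
  note mult = presented_mult[of _ X _ Q]
  have car: "carrier (presented_group X Q) = pres_class X Q ` words X"
    and one: "\<one>\<^bsub>presented_group X Q\<^esub> = pres_class X Q []"
    by (simp_all add: presented_group_def)
  have app: "u @ v \<in> words X" if "u \<in> words X" "v \<in> words X" for u v
    using that by (auto simp: words_def)
  have nil: "[] \<in> words X" by (simp add: words_def)
  show "x \<otimes>\<^bsub>presented_group X Q\<^esub> y \<in> carrier (presented_group X Q)"
    if "x \<in> carrier (presented_group X Q)" "y \<in> carrier (presented_group X Q)" for x y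
    using that by (auto simp: car mult app)
  show "\<one>\<^bsub>presented_group X Q\<^esub> \<in> carrier (presented_group X Q)"
    by (auto simp: car one nil)
  show "x \<otimes>\<^bsub>presented_group X Q\<^esub> y \<otimes>\<^bsub>presented_group X Q\<^esub> z
      = x \<otimes>\<^bsub>presented_group X Q\<^esub> (y \<otimes>\<^bsub>presented_group X Q\<^esub> z)"
    if "x \<in> carrier (presented_group X Q)" "y \<in> carrier (presented_group X Q)"
      "z \<in> carrier (presented_group X Q)" for x y z
    using that by (auto simp: car mult app)
  show "\<one>\<^bsub>presented_group X Q\<^esub> \<otimes>\<^bsub>presented_group X Q\<^esub> x = x"
    if "x \<in> carrier (presented_group X Q)" for x
    using that by (auto simp: car one mult nil)
  show "\<exists>y\<in>carrier (presented_group X Q). y \<otimes>\<^bsub>presented_group X Q\<^esub> x = \<one>\<^bsub>presented_group X Q\<^esub>"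
    if "x \<in> carrier (presented_group X Q)" for x
  proof -
    from that obtain u where u: "u \<in> words X" "x = pres_class X Q u" by (auto simp: car)
    from pres_left_inverse[OF u(1), of Q] obtain v
      where "v \<in> words X" "pres_cong X Q (v @ u) []" by blast
    then have "pres_class X Q v \<in> carrier (presented_group X Q)"
      and "pres_class X Q v \<otimes>\<^bsub>presented_group X Q\<^esub> x = \<one>\<^bsub>presented_group X Q\<^esub>"
      using u by (simp_all add: car one mult pres_class_eq[of X Q "v @ u" "[]"])
    then show ?thesis by blast
  qed
qed


section \<open>Word length\<close>

definition list_product :: "('g, 'm) monoid_scheme \<Rightarrow> 'g list \<Rightarrow> 'g" where
  "list_product G gs = foldr (\<lambda>x y. x \<otimes>\<^bsub>G\<^esub> y) gs \<one>\<^bsub>G\<^esub>"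

text \<open>No inverses are allowed in the products; below, all elements of \<open>S\<close> have finite order.\<close>

definition word_length :: "('g, 'm) monoid_scheme \<Rightarrow> 'g set \<Rightarrow> 'g \<Rightarrow> nat" where
  "word_length G S g = (LEAST k. \<exists>gs. length gs = k \<and> set gs \<subseteq> S \<and> list_product G gs = g)"


section \<open>Group algebras\<close>

text \<open>Finitely supported functions \<open>G \<rightarrow> R\<close> under convolution.\<close>

definition group_algebra ::
    "('r, 'k) ring_scheme \<Rightarrow> ('g, 'm) monoid_scheme \<Rightarrow> ('g \<Rightarrow> 'r) ring" where
  "group_algebra R G =
     \<lparr>carrier = {f \<in> carrier G \<rightarrow>\<^sub>E carrier R. finite {x \<in> carrier G. f x \<noteq> \<zero>\<^bsub>R\<^esub>}},
      mult = (\<lambda>f h. \<lambda>x\<in>carrier G.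
        \<Oplus>\<^bsub>R\<^esub>y\<in>{y \<in> carrier G. f y \<noteq> \<zero>\<^bsub>R\<^esub>}. f y \<otimes>\<^bsub>R\<^esub> h (inv\<^bsub>G\<^esub> y \<otimes>\<^bsub>G\<^esub> x)),
      one = (\<lambda>x\<in>carrier G. if x = \<one>\<^bsub>G\<^esub> then \<one>\<^bsub>R\<^esub> else \<zero>\<^bsub>R\<^esub>),
      zero = (\<lambda>x\<in>carrier G. \<zero>\<^bsub>R\<^esub>),
      add = (\<lambda>f h. \<lambda>x\<in>carrier G. f x \<oplus>\<^bsub>R\<^esub> h x)\<rparr>"

definition ga_basis :: "('r, 'k) ring_scheme \<Rightarrow> ('g, 'm) monoid_scheme \<Rightarrow> 'g \<Rightarrow> 'g \<Rightarrow> 'r" where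
  "ga_basis R G g = (\<lambda>x\<in>carrier G. if x = g then \<one>\<^bsub>R\<^esub> else \<zero>\<^bsub>R\<^esub>)"


section \<open>The group \<open>G\<^bsub>r,n\<^esub>\<close>\<close>

text \<open>The word \<open>s\<^bsub>i1\<^esub> \<dots> s\<^bsub>ik\<^esub>\<close> in the generators \<open>s\<^bsub>0\<^esub>, \<dots>, s\<^bsub>n-1\<^esub>\<close>, which are labelled by
  their indices.\<close>

definition gen_word :: "nat list \<Rightarrow> nat word" where
  "gen_word is = map (\<lambda>i. (i, True)) is"

definition Grn_rels :: "nat \<Rightarrow> nat \<Rightarrow> (nat word \<times> nat word) set" where
  "Grn_rels r n =
     {(gen_word (replicate r 0), [])}
   \<union> {(gen_word [i, i], []) | i. 1 \<le> i \<and> i < n}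
   \<union> (if 1 < n then {(gen_word [0, 1, 0, 1], gen_word [1, 0, 1, 0])} else {})
   \<union> {(gen_word [i, j], gen_word [j, i]) | i j. i < n \<and> j < n \<and> (i + 1 < j \<or> j + 1 < i)}
   \<union> {(gen_word [i, i + 1, i], gen_word [i + 1, i, i + 1]) | i. 1 \<le> i \<and> i + 1 < n}"

definition Grn :: "nat \<Rightarrow> nat \<Rightarrow> nat word set monoid" where
  "Grn r n = presented_group {..<n} (Grn_rels r n)"

definition s_gen :: "nat \<Rightarrow> nat \<Rightarrow> nat \<Rightarrow> nat word set" where
  "s_gen r n i = pres_class {..<n} (Grn_rels r n) (gen_word [i])"

text \<open>The elements \<open>t\<^bsub>1\<^esub>, \<dots>, t\<^bsub>n\<^esub>\<close>; the value at index 0 is a dummy.\<close>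

fun t_gen :: "nat \<Rightarrow> nat \<Rightarrow> nat \<Rightarrow> nat word set" where
  "t_gen r n 0 = \<one>\<^bsub>Grn r n\<^esub>"
| "t_gen r n (Suc 0) = s_gen r n 0"
| "t_gen r n (Suc (Suc i)) =
     s_gen r n (Suc i) \<otimes>\<^bsub>Grn r n\<^esub> t_gen r n (Suc i) \<otimes>\<^bsub>Grn r n\<^esub> s_gen r n (Suc i)"

definition simple_refls :: "nat \<Rightarrow> nat \<Rightarrow> nat word set set" where
  "simple_refls r n = s_gen r n ` {1..<n}"

definition T_sub :: "nat \<Rightarrow> nat \<Rightarrow> nat word set set" where
  "T_sub r n = generate (Grn r n) (t_gen r n ` {1..n})"

definition Sym_sub :: "nat \<Rightarrow> nat \<Rightarrow> nat word set set" where
  "Sym_sub r n = generate (Grn r n) (simple_refls r n)"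

definition ell :: "nat \<Rightarrow> nat \<Rightarrow> nat word set \<Rightarrow> nat" where
  "ell r n = word_length (Grn r n) (t_gen r n ` {1..n} \<union> simple_refls r n)"

definition coxeter_length :: "nat \<Rightarrow> nat \<Rightarrow> nat word set \<Rightarrow> nat" where
  "coxeter_length r n = word_length (Grn r n) (simple_refls r n)"


section \<open>Signed compositions\<close>

definition signed_composition :: "nat \<Rightarrow> int list \<Rightarrow> bool" where
  "signed_composition n \<mu> \<longleftrightarrow> 0 \<notin> set \<mu> \<and> (\<Sum>m\<leftarrow>\<mu>. \<bar>m\<bar>) = int n"

definition sc_plus :: "int list \<Rightarrow> nat list" where
  "sc_plus \<mu> = map (\<lambda>m. nat \<bar>m\<bar>) \<mu>"

definition sc_neg :: "int list \<Rightarrow> int list" where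
  "sc_neg \<mu> = map uminus \<mu>"

definition psum :: "nat list \<Rightarrow> nat \<Rightarrow> nat" where
  "psum c i = sum_list (take i c)"

text \<open>List positions start at 0, so the block of \<open>\<mu> ! i\<close> is
  \<open>{psum (sc_plus \<mu>) i <.. psum (sc_plus \<mu>) (i + 1)}\<close>.\<close>

definition Pi_sc :: "nat \<Rightarrow> nat \<Rightarrow> int list \<Rightarrow> nat word set set" where
  "Pi_sc r n \<mu> =
     {s_gen r n j | i j. i < length \<mu> \<and>
        psum (sc_plus \<mu>) i < j \<and> j < psum (sc_plus \<mu>) (i + 1)}
   \<union> {t_gen r n j | i j. i < length \<mu> \<and> \<mu> ! i > 0 \<and>
        psum (sc_plus \<mu>) i < j \<and> j \<le> psum (sc_plus \<mu>) (i + 1)}"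

definition G_sc :: "nat \<Rightarrow> nat \<Rightarrow> int list \<Rightarrow> nat word set set" where
  "G_sc r n \<mu> = generate (Grn r n) (Pi_sc r n \<mu>)"

definition T_sc :: "nat \<Rightarrow> nat \<Rightarrow> int list \<Rightarrow> nat word set set" where
  "T_sc r n \<mu> = G_sc r n \<mu> \<inter> T_sub r n"

definition E_set :: "nat \<Rightarrow> nat \<Rightarrow> int list \<Rightarrow> nat word set set" where
  "E_set r n \<mu> = {e \<in> carrier (Grn r n). \<forall>g \<in> G_sc r n \<mu> #>\<^bsub>Grn r n\<^esub> e. ell r n e \<le> ell r n g}"

definition E_sc ::
    "('a, 'k) ring_scheme \<Rightarrow> nat \<Rightarrow> nat \<Rightarrow> int list \<Rightarrow> nat word set \<Rightarrow> 'a" where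
  "E_sc R r n \<mu> =
     (\<Oplus>\<^bsub>group_algebra R (Grn r n)\<^esub>e\<in>E_set r n \<mu>. ga_basis R (Grn r n) e)"

text \<open>Under \<open>s\<^bsub>j\<^esub> \<mapsto> (j, j + 1)\<close> the Young subgroup, i.e. the stabiliser of the blocks of the
  composition \<open>c\<close>, is generated by the \<open>s\<^bsub>j\<^esub>\<close> with \<open>j\<close> and \<open>j + 1\<close> in the same block.\<close>

definition Young_sub :: "nat \<Rightarrow> nat \<Rightarrow> nat list \<Rightarrow> nat word set set" where
  "Young_sub r n c = generate (Grn r n)
     {s_gen r n j | i j. i < length c \<and> psum c i < j \<and> j < psum c (i + 1)}"

definition D_set :: "nat \<Rightarrow> nat \<Rightarrow> nat list \<Rightarrow> nat word set set" where
  "D_set r n c = {d \<in> Sym_sub r n.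
     \<forall>w \<in> Young_sub r n c #>\<^bsub>Grn r n\<^esub> d. coxeter_length r n d \<le> coxeter_length r n w}"

definition D_double :: "nat \<Rightarrow> nat \<Rightarrow> nat list \<Rightarrow> nat list \<Rightarrow> nat word set set" where
  "D_double r n c c' = D_set r n c \<inter> (\<lambda>d. inv\<^bsub>Grn r n\<^esub> d) ` D_set r n c'"

text \<open>\<open>sc_meet r n \<mu> d \<nu>\<close> is the signed composition \<open>\<mu> \<inter> d\<nu>\<close>.\<close>

definition sc_meet :: "nat \<Rightarrow> nat \<Rightarrow> int list \<Rightarrow> nat word set \<Rightarrow> int list \<Rightarrow> int list" where
  "sc_meet r n \<mu> d \<nu> = (THE \<sigma>. signed_composition n \<sigma> \<and>
     G_sc r n \<mu> \<inter> (d <#\<^bsub>Grn r n\<^esub> G_sc r n \<nu> #>\<^bsub>Grn r n\<^esub> inv\<^bsub>Grn r n\<^esub> d) = G_sc r n \<sigma>)"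

end

theory Submission
  imports Defs "HOL-Combinatorics.Permutations" "HOL-Number_Theory.Cong"
begin

text \<open>
  Letting words act on coloured points assigns to every element of \<open>G\<^bsub>r,n\<^esub>\<close> a permutation
  of \<open>{1..n}\<close> and exponents modulo \<open>r\<close>, and the presentation is strong enough for these data
  to determine the element. The length of an element is the sum of its exponents plus the number of
  inversions. Hence \<open>\<E>\<^sub>\<mu>\<close> consists of the elements whose permutation increases on the blocks of
  \<open>\<mu>\<close> and whose exponents vanish on the positive blocks.

  The coefficient of \<open>x\<close> in \<open>E\<^sub>\<mu> E\<^sub>\<nu>\<close> is the number of factorisations \<open>x = y z\<close> with
  \<open>y \<in> \<E>\<^sub>\<mu>\<close> and \<open>z \<in> \<E>\<^sub>\<nu>\<close>. Sorting the permutation of \<open>y\<close> along the blocks of \<open>\<nu>\<close>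
  yields a double coset representative \<open>d\<close>. The factorisations with a given \<open>d\<close> exist if and only
  if \<open>x \<in> \<E>\<^sub>\<sigma>\<close> for \<open>\<sigma> = \<mu> \<inter> d\<nu>\<close>; in that case the permutation of \<open>y\<close> is determined by
  \<open>d\<close>, and the possible \<open>y\<close> form a coset of \<open>T\<close> intersected with the group of
  \<open>-\<mu> \<inter> d(-\<nu>)\<close>.
\<close>

section \<open>The action of words on coloured points\<close>

text \<open>The obstacle is to show that nothing in the presented group is invisible to the action.
  A normal form settles this: the t_i commute, have trivial r-th powers and are permuted by
  conjugation with the s_i, and the cosets along the chain of symmetric groups are represented by
  descending words. So every element is a monomial in the t_i times such words, and the action reads
  off each ingredient.

  A partition into blocks is encoded by the function b giving block numbers, and signs by a
  predicate Q. The groups of signed compositions, Young subgroups, T and the symmetric group are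
  then instances of one construction, and one minimality criterion describes both \<E> and \<D>.

  The negated compositions have this origin: for x = y z, the exponent of x at i is that of y at i
  plus that of z at the image of i under y. If \<mu> is positive at i, y contributes 0; if \<nu> is
  positive at the image, z contributes 0 and y must contribute everything. Only where both are
  negative is the exponent of y free, with r choices, and there the meet of the negated compositions
  is positive.\<close>

definition adj :: "nat \<Rightarrow> nat \<Rightarrow> nat" where
  "adj k = (if k = 0 then id else Transposition.transpose k (Suc k))"

text \<open>Composition is reversed because the action is on the right: the first letter moves a
  point first. Letter 0 acts as the identity since s_0 changes colours only, and a letter and its
  formal inverse move points alike.\<close>

fun wperm :: "nat word \<Rightarrow> nat \<Rightarrow> nat" where
  "wperm [] = id"
| "wperm (l # w) = wperm w \<circ> adj (fst l)"

text \<open>The colour collected by the point that starts at i: it gains or loses one whenever s_0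
  is read while the point stands at position 1. The relation s_0^r = 1 respects this integer only
  modulo r.\<close>

fun wexpo :: "nat word \<Rightarrow> nat \<Rightarrow> int" where
  "wexpo [] i = 0"
| "wexpo (l # w) i =
     (if fst l = 0 \<and> i = 1 then if snd l then 1 else -1 else 0) + wexpo w (adj (fst l) i)"

lemma adj_adj [simp]: "adj k (adj k i) = i"
  by (simp add: adj_def)

lemma adj_0 [simp]: "adj 0 = id"
  by (simp add: adj_def)

lemma wperm_append: "wperm (u @ v) = wperm v \<circ> wperm u"
  by (induction u) auto

lemma wexpo_append: "wexpo (u @ v) i = wexpo u i + wexpo v (wperm u i)"
  by (induction u arbitrary: i) auto

lemma wexpo_replicate_0:
  "wperm (gen_word (replicate k 0)) = id \<and>
   wexpo (gen_word (replicate k 0)) i = (if i = 1 then int k else 0)"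
  by (induction k) (auto simp: gen_word_def)

lemma Grn_rels_act:
  assumes "(u, v) \<in> Grn_rels r n"
  shows "wperm u = wperm v \<and> [wexpo u i = wexpo v i] (mod int r)"
  using assms unfolding Grn_rels_def
  apply (auto simp: wexpo_replicate_0 split: if_splits)
  apply (auto simp: gen_word_def cong_def adj_def transpose_def fun_eq_iff split: if_splits)
  done

lemma pres_cong_act:
  assumes "pres_cong X (Grn_rels r n) u v"
  shows "wperm u = wperm v \<and> (\<forall>i. [wexpo u i = wexpo v i] (mod int r))"
  using assms
proof (induction rule: pres_cong.induct)
  case (append u u' v v')
  then show ?case by (auto simp: wperm_append wexpo_append intro: cong_add)
next
  case (cancel y b)
  then show ?case by (auto simp: adj_def fun_eq_iff)
next
  case (rel u v)
  then show ?case using Grn_rels_act by blast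
qed (auto simp: cong_def)

lemma wperm_permutes: "w \<in> words {..<n} \<Longrightarrow> wperm w permutes {1..n}"
proof (induction w)
  case Nil
  show ?case using permutes_id by (simp add: id_def)
next
  case (Cons l w)
  then have w: "wperm w permutes {1..n}" and k: "fst l < n" by (auto simp: words_def)
  have "adj (fst l) permutes {1..n}"
    using k by (auto simp: adj_def permutes_id intro!: permutes_swap_id)
  then show ?case unfolding wperm.simps by (rule permutes_compose[OF _ w])
qed

lemma wexpo_outside: "w \<in> words {..<n} \<Longrightarrow> i \<notin> {1..n} \<Longrightarrow> wexpo w i = 0"
proof (induction w arbitrary: i)
  case (Cons l w)
  then have k: "fst l < n" by (auto simp: words_def)
  have "adj (fst l) i = i" using k Cons.prems by (auto simp: adj_def transpose_def)
  then show ?case using Cons k by (auto simp: words_def)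
qed simp

text \<open>The induction rule of \<open>generate\<close> multiplies two arbitrary elements, while X
  is only known to be closed under appending generators. Hence the induction shows that right
  multiplication by h maps X into itself.\<close>

lemma (in group) generate_right_induct:
  assumes h: "h \<in> generate G A" and A: "A \<subseteq> carrier G" and X: "X \<subseteq> carrier G"
    and one: "\<one> \<in> X"
    and step: "\<And>g a. g \<in> X \<Longrightarrow> a \<in> A \<Longrightarrow> g \<otimes> a \<in> X"
    and step_inv: "\<And>g a. g \<in> X \<Longrightarrow> a \<in> A \<Longrightarrow> g \<otimes> inv a \<in> X"
  shows "h \<in> X"
proof -
  have "\<forall>g\<in>X. g \<otimes> h \<in> X"
    using h
  proof (induction rule: generate.induct)
    case (eng h1 h2)
    have "h1 \<in> carrier G" "h2 \<in> carrier G"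
      using eng.hyps generate_in_carrier[OF A] by auto
    then have "g \<otimes> (h1 \<otimes> h2) = (g \<otimes> h1) \<otimes> h2" if "g \<in> X" for g
      using that X by (auto simp: m_assoc)
    then show ?case using eng.IH by auto
  qed (use X step step_inv in auto)
  moreover have "h \<in> carrier G" using h generate_in_carrier[OF A] by auto
  ultimately show ?thesis using one by force
qed

section \<open>The permutation and the exponents of a group element\<close>

locale cyclotomic =
  fixes r n :: nat
  assumes r_gt_1: "r > 1"

sublocale cyclotomic \<subseteq> group "Grn r n"
  unfolding Grn_def by (rule group_presented_group)

context cyclotomic
begin

abbreviation G where "G \<equiv> Grn r n"
abbreviation gmult (infixl \<open>\<odot>\<close> 70) where "x \<odot> y \<equiv> x \<otimes>\<^bsub>Grn r n\<^esub> y"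
abbreviation ginv where "ginv g \<equiv> m_inv (Grn r n) g"
abbreviation s where "s \<equiv> s_gen r n"
abbreviation t where "t \<equiv> t_gen r n"
abbreviation cls where "cls \<equiv> pres_class {..<n} (Grn_rels r n)"

lemma carrier_eq: "carrier G = cls ` words {..<n}"
  by (simp add: Grn_def presented_group_def)

lemma one_eq: "\<one>\<^bsub>G\<^esub> = cls []"
  by (simp add: Grn_def presented_group_def)

lemma mult_cls: "u \<in> words {..<n} \<Longrightarrow> v \<in> words {..<n} \<Longrightarrow> cls u \<odot> cls v = cls (u @ v)"
  unfolding Grn_def by (rule presented_mult)

text \<open>An element \<open>g\<close> of the group is \<open>t\<^sub>1\<^bsup>a\<^sub>1\<^esup> \<dots> t\<^sub>n\<^bsup>a\<^sub>n\<^esup> w\<close> with \<open>a\<^sub>i = expo g i\<close> and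
  \<open>i\<^sup>w = perm g i\<close>.\<close>

definition perm :: "nat word set \<Rightarrow> nat \<Rightarrow> nat" where
  "perm g = wperm (SOME w. w \<in> g)"

definition expo :: "nat word set \<Rightarrow> nat \<Rightarrow> nat" where
  "expo g i = nat (wexpo (SOME w. w \<in> g) i mod int r)"

text \<open>The choice made in \<open>perm\<close> and \<open>expo\<close> is harmless, since the
  permutation, and the exponents modulo r, are constant on classes.\<close>

lemma some_cls:
  assumes "w \<in> words {..<n}"
  shows "pres_cong {..<n} (Grn_rels r n) w (SOME v. v \<in> cls w)"
proof -
  have "w \<in> cls w" using assms by (simp add: pres_class_def pres_cong.refl)
  then have "(SOME v. v \<in> cls w) \<in> cls w" by (rule someI)
  then show ?thesis by (simp add: pres_class_def)
qed

lemma perm_cls: "w \<in> words {..<n} \<Longrightarrow> perm (cls w) = wperm w"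
  using pres_cong_act[OF some_cls] by (simp add: perm_def)

lemma expo_cls: "w \<in> words {..<n} \<Longrightarrow> expo (cls w) i = nat (wexpo w i mod int r)"
  using pres_cong_act[OF some_cls] by (simp add: expo_def cong_def)

lemma perm_permutes: "g \<in> carrier G \<Longrightarrow> perm g permutes {1..n}"
  by (metis carrier_eq imageE perm_cls wperm_permutes)

lemma expo_outside: "g \<in> carrier G \<Longrightarrow> i \<notin> {1..n} \<Longrightarrow> expo g i = 0"
  by (auto simp: carrier_eq expo_cls wexpo_outside)

lemma expo_less: "expo g i < r"
proof -
  have "wexpo w i mod int r < int r" for w using r_gt_1 by (intro pos_mod_bound) auto
  then show ?thesis using r_gt_1 by (simp add: expo_def nat_less_iff)
qed

lemma perm_one [simp]: "perm \<one>\<^bsub>G\<^esub> = id"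
  by (simp add: one_eq perm_cls words_def)

lemma expo_one [simp]: "expo \<one>\<^bsub>G\<^esub> i = 0"
  by (simp add: one_eq expo_cls words_def)

lemma words_append: "u \<in> words X \<Longrightarrow> v \<in> words X \<Longrightarrow> u @ v \<in> words X"
  by (auto simp: words_def)

lemma perm_mult: "g \<in> carrier G \<Longrightarrow> h \<in> carrier G \<Longrightarrow> perm (g \<odot> h) = perm h \<circ> perm g"
  by (auto simp: carrier_eq mult_cls perm_cls wperm_append words_append)

text \<open>After g the point i stands at \<open>perm g i\<close>, and that is where h colours
  it.\<close>

lemma expo_mult:
  assumes "g \<in> carrier G" "h \<in> carrier G"
  shows "expo (g \<odot> h) i = (expo g i + expo h (perm g i)) mod r"
proof -
  have *: "nat ((a + b) mod int r) = (nat (a mod int r) + nat (b mod int r)) mod r" for a b :: int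
  proof -
    have "int (nat ((a + b) mod int r)) = int ((nat (a mod int r) + nat (b mod int r)) mod r)"
      using r_gt_1 by (simp add: zmod_int mod_add_eq)
    then show ?thesis by (simp only: of_nat_eq_iff)
  qed
  show ?thesis
    using assms by (auto simp: carrier_eq mult_cls perm_cls expo_cls wexpo_append words_append *)
qed

lemma s_closed [simp]: "i < n \<Longrightarrow> s i \<in> carrier G"
  by (auto simp: s_gen_def carrier_eq gen_word_def words_def)

lemma perm_s: "i < n \<Longrightarrow> perm (s i) = adj i"
  unfolding s_gen_def by (subst perm_cls) (auto simp: gen_word_def words_def)

lemma expo_s: "i < n \<Longrightarrow> expo (s i) j = (if i = 0 \<and> j = 1 then 1 else 0)"
  unfolding s_gen_def using r_gt_1 by (subst expo_cls) (auto simp: gen_word_def words_def)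

lemma t_closed [simp]: "i \<le> n \<Longrightarrow> t i \<in> carrier G"
proof (induction i)
  case (Suc i)
  then show ?case by (cases i) auto
qed simp

lemma perm_t: "i \<le> n \<Longrightarrow> perm (t i) = id"
proof (induction i)
  case (Suc i)
  then show ?case by (cases i) (auto simp: perm_s perm_mult fun_eq_iff)
qed simp

lemma expo_t: "1 \<le> i \<Longrightarrow> i \<le> n \<Longrightarrow> expo (t i) j = (if j = i then 1 else 0)"
proof (induction i arbitrary: j)
  case (Suc i)
  then show ?case
    using r_gt_1
    by (cases i) (auto simp: expo_s perm_s expo_mult perm_mult perm_t adj_def transpose_def
        split: if_splits)
qed simp

lemma list_product_Cons: "list_product G (g # gs) = g \<odot> list_product G gs"
  by (simp add: list_product_def)

lemma list_product_Nil: "list_product G [] = \<one>\<^bsub>G\<^esub>"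
  by (simp add: list_product_def)

lemma list_product_closed: "set gs \<subseteq> carrier G \<Longrightarrow> list_product G gs \<in> carrier G"
  by (induction gs) (auto simp: list_product_Cons list_product_Nil)

lemma cls_gen_word:
  "set is \<subseteq> {..<n} \<Longrightarrow> cls (gen_word is) = list_product G (map s is)"
proof (induction "is")
  case Nil
  then show ?case by (simp add: gen_word_def list_product_Nil one_eq)
next
  case (Cons i "is")
  have "cls (gen_word (i # is)) = cls (gen_word [i]) \<odot> cls (gen_word is)"
    using Cons.prems by (subst mult_cls) (auto simp: gen_word_def words_def)
  then show ?case using Cons by (simp add: list_product_Cons s_gen_def)
qed

lemma relation:
  assumes "(gen_word is, gen_word js) \<in> Grn_rels r n" "set is \<subseteq> {..<n}" "set js \<subseteq> {..<n}"
  shows "list_product G (map s is) = list_product G (map s js)"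
proof -
  have "cls (gen_word is) = cls (gen_word js)"
    using assms by (intro pres_class_eq pres_cong.rel) (auto simp: gen_word_def words_def)
  then show ?thesis using assms by (simp add: cls_gen_word)
qed

lemma s_sq: "1 \<le> i \<Longrightarrow> i < n \<Longrightarrow> s i \<odot> s i = \<one>\<^bsub>G\<^esub>"
  using relation[of "[i, i]" "[]"]
  by (auto simp: Grn_rels_def gen_word_def list_product_def)

lemma s_comm: "i < n \<Longrightarrow> j < n \<Longrightarrow> i + 1 < j \<or> j + 1 < i \<Longrightarrow> s i \<odot> s j = s j \<odot> s i"
  using relation[of "[i, j]" "[j, i]"]
  by (auto simp: Grn_rels_def gen_word_def list_product_def)

lemma s_braid: "1 \<le> i \<Longrightarrow> i + 1 < n \<Longrightarrow>
    s i \<odot> (s (i + 1) \<odot> s i) = s (i + 1) \<odot> (s i \<odot> s (i + 1))"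
  using relation[of "[i, i + 1, i]" "[i + 1, i, i + 1]"]
  by (auto simp: Grn_rels_def gen_word_def list_product_def)

lemma s_01: "1 < n \<Longrightarrow> s 0 \<odot> (s 1 \<odot> (s 0 \<odot> s 1)) = s 1 \<odot> (s 0 \<odot> (s 1 \<odot> s 0))"
  using relation[of "[0, 1, 0, 1]" "[1, 0, 1, 0]"]
  by (auto simp: Grn_rels_def gen_word_def list_product_def)

lemma s_0_pow:
  assumes "0 < n"
  shows "s 0 [^]\<^bsub>G\<^esub> r = \<one>\<^bsub>G\<^esub>"
proof -
  have "list_product G (map s (replicate k 0)) = s 0 [^]\<^bsub>G\<^esub> k" for k
  proof (induction k)
    case (Suc k)
    then show ?case
      using nat_pow_Suc2[OF s_closed[OF assms], of k] by (simp add: list_product_Cons)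
  qed (simp add: list_product_Nil)
  moreover have "set (replicate r 0) \<subseteq> {..<n}"
    using assms by auto
  ultimately show ?thesis
    using relation[of "replicate r 0" "[]"]
    by (simp add: Grn_rels_def gen_word_def list_product_Nil)
qed

end

section \<open>Faithfulness of the action\<close>

lemma (in monoid) commute_mult:
  assumes "a \<otimes> b = b \<otimes> a" "a \<otimes> c = c \<otimes> a" "a \<in> carrier G" "b \<in> carrier G" "c \<in> carrier G"
  shows "a \<otimes> (b \<otimes> c) = (b \<otimes> c) \<otimes> a"
  using assms by (metis m_assoc)

text \<open>With a = s_i, b = s_{i+1} and x = t_i the conjugate is t_{i+2}. This is the one case
  where moving s_i past a later t needs the braid relation.\<close>

lemma (in monoid) braid_commute:
  assumes "b \<otimes> x = x \<otimes> b" "a \<otimes> (b \<otimes> a) = b \<otimes> (a \<otimes> b)"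
    and [simp]: "a \<in> carrier G" "b \<in> carrier G" "x \<in> carrier G"
  shows "a \<otimes> (b \<otimes> (a \<otimes> x \<otimes> a) \<otimes> b) = (b \<otimes> (a \<otimes> x \<otimes> a) \<otimes> b) \<otimes> a"
proof -
  have "a \<otimes> (b \<otimes> (a \<otimes> x \<otimes> a) \<otimes> b) = (a \<otimes> (b \<otimes> a)) \<otimes> (x \<otimes> (a \<otimes> b))"
    by (simp add: m_assoc)
  also have "\<dots> = b \<otimes> (a \<otimes> ((b \<otimes> x) \<otimes> (a \<otimes> b)))"
    unfolding assms(2) by (simp add: m_assoc)
  also have "\<dots> = b \<otimes> (a \<otimes> (x \<otimes> (b \<otimes> (a \<otimes> b))))"
    unfolding assms(1) by (simp add: m_assoc)
  also have "\<dots> = (b \<otimes> (a \<otimes> x \<otimes> a) \<otimes> b) \<otimes> a"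
    unfolding assms(2)[symmetric] by (simp add: m_assoc)
  finally show ?thesis .
qed

context cyclotomic
begin

section \<open>Commutation and conjugation of the t_i\<close>

lemma s_inv: "1 \<le> i \<Longrightarrow> i < n \<Longrightarrow> ginv (s i) = s i"
  using s_sq by (intro inv_equality) auto

lemma s_cancel: "1 \<le> i \<Longrightarrow> i < n \<Longrightarrow> x \<in> carrier G \<Longrightarrow> s i \<odot> (s i \<odot> x) = x"
  by (simp add: m_assoc[symmetric] s_sq)

lemma t_Suc: "1 \<le> i \<Longrightarrow> t (Suc i) = s i \<odot> t i \<odot> s i"
  by (cases i) auto

lemma s_t_below: "1 \<le> j \<Longrightarrow> j < i \<Longrightarrow> i < n \<Longrightarrow> s i \<odot> t j = t j \<odot> s i"
proof (induction j)
  case (Suc j)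
  show ?case
  proof (cases "j = 0")
    case True
    then show ?thesis using Suc.prems s_comm[of i 0] by simp
  next
    case False
    then have "s i \<odot> s j = s j \<odot> s i" "s i \<odot> t j = t j \<odot> s i"
      using Suc s_comm[of i j] by simp_all
    then show ?thesis
      using Suc.prems False by (simp add: t_Suc commute_mult)
  qed
qed simp

lemma s_t_above: "1 \<le> i \<Longrightarrow> Suc i < j \<Longrightarrow> j \<le> n \<Longrightarrow> s i \<odot> t j = t j \<odot> s i"
proof (induction j)
  case (Suc j)
  show ?case
  proof (cases "j = Suc i")
    case True
    then show ?thesis
      using Suc.prems braid_commute[of "s (Suc i)" "t i" "s i"] s_t_below[of i "Suc i"]
        s_braid[of i] by (simp add: t_Suc)
  next
    case False
    then have "s i \<odot> s j = s j \<odot> s i" "s i \<odot> t j = t j \<odot> s i"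
      using Suc s_comm[of i j] by simp_all
    then show ?thesis
      using Suc.prems False by (simp add: t_Suc commute_mult)
  qed
qed simp

lemma s_t_conj:
  assumes "1 \<le> i" "i < n" "1 \<le> j" "j \<le> n"
  shows "s i \<odot> t j \<odot> s i = t (adj i j)"
proof -
  consider "j = i" | "j = Suc i" | "j < i" | "Suc i < j" by linarith
  then show ?thesis
  proof cases
    case 1
    then show ?thesis using assms by (simp add: adj_def t_Suc)
  next
    case 2
    then show ?thesis using assms by (simp add: adj_def t_Suc m_assoc s_cancel s_sq)
  next
    case 3
    then have "adj i j = j" by (simp add: adj_def)
    then show ?thesis using assms 3 by (simp add: s_t_below m_assoc s_sq)
  next
    case 4
    then have "adj i j = j" by (simp add: adj_def)
    then show ?thesis using assms 4 by (simp add: s_t_above m_assoc s_sq)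
  qed
qed

lemma t_comm_less: "1 \<le> i \<Longrightarrow> i < j \<Longrightarrow> j \<le> n \<Longrightarrow> t j \<odot> t i = t i \<odot> t j"
proof (induction i)
  case (Suc i)
  show ?case
  proof (cases "i = 0")
    case True
    \<comment> \<open>Only t_2 needs the relation of length four between s_0 and s_1; for later
      ones, t_1 commutes with both constituents of t_{j+1} = s_j t_j s_j.\<close>
    have "Suc 0 < j \<Longrightarrow> j \<le> n \<Longrightarrow> s 0 \<odot> t j = t j \<odot> s 0"
    proof (induction j)
      case (Suc j)
      show ?case
      proof (cases "j = Suc 0")
        case True
        then show ?thesis
          using Suc.prems s_01 by (simp add: t_Suc m_assoc)
      next
        case False
        then have "s 0 \<odot> s j = s j \<odot> s 0" "s 0 \<odot> t j = t j \<odot> s 0"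
          using Suc s_comm[of 0 j] by simp_all
        then show ?thesis
          using Suc.prems False by (simp add: t_Suc commute_mult)
      qed
    qed simp
    then show ?thesis using Suc.prems True by simp
  next
    case False
    then have "t j \<odot> s i = s i \<odot> t j" "t j \<odot> t i = t i \<odot> t j"
      using Suc s_t_above[of i j] by simp_all
    then show ?thesis
      using Suc.prems False by (simp add: t_Suc commute_mult)
  qed
qed simp

lemma t_comm:
  "1 \<le> i \<Longrightarrow> i \<le> n \<Longrightarrow> 1 \<le> j \<Longrightarrow> j \<le> n \<Longrightarrow> t i \<odot> t j = t j \<odot> t i"
  using t_comm_less[of i j] t_comm_less[of j i] by (cases i j rule: linorder_cases) auto

lemma t_pow: "1 \<le> i \<Longrightarrow> i \<le> n \<Longrightarrow> t i [^]\<^bsub>G\<^esub> r = \<one>\<^bsub>G\<^esub>"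
proof (induction i)
  case (Suc i)
  show ?case
  proof (cases "i = 0")
    case True
    then show ?thesis using s_0_pow Suc.prems by simp
  next
    case False
    have "t (Suc i) [^]\<^bsub>G\<^esub> (k::nat) = s i \<odot> t i [^]\<^bsub>G\<^esub> k \<odot> s i" for k
    proof (induction k)
      case 0
      then show ?case using False Suc.prems by (simp add: s_sq)
    next
      case (Suc k)
      then show ?case
        using False \<open>Suc i \<le> n\<close> by (simp add: t_Suc m_assoc s_cancel)
    qed
    then show ?thesis using Suc False by (simp add: s_sq)
  qed
qed simp

text \<open>Inverses become positive powers, so inverse steps in inductions over generated subgroups
  repeat the positive ones.\<close>

lemma t_inv: "1 \<le> i \<Longrightarrow> i \<le> n \<Longrightarrow> ginv (t i) = t i [^]\<^bsub>G\<^esub> (r - 1)"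
proof -
  assume i: "1 \<le> i" "i \<le> n"
  have "t i [^]\<^bsub>G\<^esub> (r - 1) \<odot> t i = t i [^]\<^bsub>G\<^esub> Suc (r - 1)" by simp
  also have "\<dots> = \<one>\<^bsub>G\<^esub>" using t_pow[OF i] r_gt_1 by simp
  finally show ?thesis using i by (intro inv_equality) auto
qed

section \<open>Every element is a product of an element of T and one of the symmetric group\<close>

lemma T_gens: "t ` {1..n} \<subseteq> carrier G"
  by auto

lemma Sym_gens: "simple_refls r n \<subseteq> carrier G"
  by (auto simp: simple_refls_def)

lemma T_sub_subgroup: "subgroup (T_sub r n) G"
  unfolding T_sub_def using T_gens by (rule generate_is_subgroup)

lemma Sym_sub_subgroup: "subgroup (Sym_sub r n) G"
  unfolding Sym_sub_def using Sym_gens by (rule generate_is_subgroup)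

lemmas T_sub_carrier = subgroup.mem_carrier[OF T_sub_subgroup]
lemmas Sym_sub_carrier = subgroup.mem_carrier[OF Sym_sub_subgroup]

lemma s_T_conj:
  assumes i: "1 \<le> i" "i < n" and "\<tau> \<in> T_sub r n"
  shows "s i \<odot> \<tau> \<odot> s i \<in> T_sub r n"
proof -
  have tin: "s i \<odot> t j \<odot> s i \<in> T_sub r n" if "j \<in> {1..n}" for j
  proof -
    have "adj i j \<in> {1..n}" using i that by (auto simp: adj_def transpose_def)
    then show ?thesis using s_t_conj[OF i] that by (auto simp: T_sub_def intro: generate.incl)
  qed
  have hom: "s i \<odot> (g \<odot> a) \<odot> s i = (s i \<odot> g \<odot> s i) \<odot> (s i \<odot> a \<odot> s i)"
    if "g \<in> carrier G" "a \<in> carrier G" for g a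
    using i that by (simp add: m_assoc s_cancel)
  have "\<tau> \<in> {\<tau> \<in> carrier G. s i \<odot> \<tau> \<odot> s i \<in> T_sub r n}"
    using assms(3) unfolding T_sub_def
  proof (rule generate_right_induct[OF _ T_gens], fold T_sub_def)
    fix g a assume *: "g \<in> {\<tau> \<in> carrier G. s i \<odot> \<tau> \<odot> s i \<in> T_sub r n}" "a \<in> t ` {1..n}"
    then have a: "s i \<odot> a \<odot> s i \<in> T_sub r n" "a \<in> carrier G" using tin by auto
    have "ginv (s i \<odot> a \<odot> s i) = s i \<odot> ginv a \<odot> s i"
      using a i by (simp add: inv_mult_group s_inv m_assoc)
    then have "s i \<odot> ginv a \<odot> s i \<in> T_sub r n"
      using subgroup.m_inv_closed[OF T_sub_subgroup a(1)] by simp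
    then show "g \<odot> a \<in> {\<tau> \<in> carrier G. s i \<odot> \<tau> \<odot> s i \<in> T_sub r n}"
      "g \<odot> ginv a \<in> {\<tau> \<in> carrier G. s i \<odot> \<tau> \<odot> s i \<in> T_sub r n}"
      using * a subgroup.m_closed[OF T_sub_subgroup] by (simp_all add: hom)
  qed (use i in \<open>auto simp: s_sq intro: subgroup.one_closed[OF T_sub_subgroup]\<close>)
  then show ?thesis by simp
qed

text \<open>This one-sided form of normality survives appending s_i to w, because s_i \<tau> = (s_i
  \<tau> s_i) s_i and the bracket is again in T.\<close>

lemma Sym_T_swap:
  assumes "w \<in> Sym_sub r n"
  shows "\<forall>\<tau>\<in>T_sub r n. \<exists>\<tau>'\<in>T_sub r n. w \<odot> \<tau> = \<tau>' \<odot> w"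
proof -
  have "w \<in> {w \<in> carrier G. \<forall>\<tau>\<in>T_sub r n. \<exists>\<tau>'\<in>T_sub r n. w \<odot> \<tau> = \<tau>' \<odot> w}" (is "_ \<in> ?X")
    using assms unfolding Sym_sub_def
  proof (rule generate_right_induct[OF _ Sym_gens])
    fix g a assume g: "g \<in> ?X" and "a \<in> simple_refls r n"
    then obtain i where i: "1 \<le> i" "i < n" and a: "a = s i" by (auto simp: simple_refls_def)
    have "\<exists>\<tau>'\<in>T_sub r n. (g \<odot> s i) \<odot> \<tau> = \<tau>' \<odot> (g \<odot> s i)" if \<tau>: "\<tau> \<in> T_sub r n" for \<tau>
    proof -
      obtain \<tau>' where \<tau>': "\<tau>' \<in> T_sub r n" "g \<odot> (s i \<odot> \<tau> \<odot> s i) = \<tau>' \<odot> g"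
        using g s_T_conj[OF i \<tau>] by auto
      have "(g \<odot> s i) \<odot> \<tau> = g \<odot> (s i \<odot> \<tau> \<odot> s i) \<odot> s i"
        using g i T_sub_carrier[OF \<tau>] by (simp add: m_assoc s_sq)
      also have "\<dots> = \<tau>' \<odot> (g \<odot> s i)"
        using g i T_sub_carrier[OF \<tau>'(1)] by (simp add: \<tau>'(2) m_assoc)
      finally show ?thesis using \<tau>'(1) by blast
    qed
    then show "g \<odot> a \<in> ?X" using g i by (simp add: a)
    then show "g \<odot> ginv a \<in> ?X" using i by (simp add: a s_inv)
  qed (use T_sub_carrier in auto)
  then show ?thesis by simp
qed

lemma carrier_generated: "carrier G = generate G (s ` {..<n})"
proof
  have "cls w \<in> generate G (s ` {..<n})" if "w \<in> words {..<n}" for w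
    using that
  proof (induction w)
    case Nil
    then show ?case using generate.one[of G] by (simp add: one_eq)
  next
    case (Cons l w)
    obtain k b where l: "l = (k, b)" by (cases l)
    have k: "k < n" "[(k, b)] \<in> words {..<n}" "w \<in> words {..<n}"
      using Cons.prems by (auto simp: l words_def)
    have "cls [(k, False)] = ginv (s k)"
    proof (rule inv_equality[symmetric])
      show "cls [(k, False)] \<odot> s k = \<one>\<^bsub>G\<^esub>"
        unfolding s_gen_def gen_word_def one_eq
        using k pres_class_eq[OF pres_cong.cancel[of k "{..<n}" "Grn_rels r n" False]]
        by (subst mult_cls) (simp_all add: words_def)
      show "cls [(k, False)] \<in> carrier G" using k by (auto simp: carrier_eq words_def)
    qed (use k in simp)
    moreover have "cls [(k, True)] = s k" by (simp add: s_gen_def gen_word_def)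
    ultimately have "cls [(k, b)] \<in> generate G (s ` {..<n})"
      using k by (cases b) (auto intro: generate.incl generate.inv)
    moreover have "cls (l # w) = cls [(k, b)] \<odot> cls w"
      using k by (simp add: mult_cls l)
    ultimately show ?case using Cons.IH k by (auto intro: generate.eng)
  qed
  then show "carrier G \<subseteq> generate G (s ` {..<n})" by (auto simp: carrier_eq)
  show "generate G (s ` {..<n}) \<subseteq> carrier G" by (rule generate_incl) auto
qed

text \<open>Each generator lies in T (s_0 = t_1) or in the symmetric group, and the set of products
  is closed under appending either kind: a factor from T is carried to the left by
  \<open>Sym_T_swap\<close>.\<close>

lemma T_Sym_decomposition:
  assumes "g \<in> carrier G"
  shows "\<exists>\<tau>\<in>T_sub r n. \<exists>w\<in>Sym_sub r n. g = \<tau> \<odot> w"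
proof -
  let ?X = "{\<tau> \<odot> w | \<tau> w. \<tau> \<in> T_sub r n \<and> w \<in> Sym_sub r n}"
  have T: "\<tau> \<odot> w \<odot> a \<in> ?X" if a: "a \<in> T_sub r n" and "\<tau> \<in> T_sub r n" and w: "w \<in> Sym_sub r n" for a \<tau> w
  proof -
    obtain \<tau>' where "\<tau>' \<in> T_sub r n" "w \<odot> a = \<tau>' \<odot> w" using Sym_T_swap[OF w] a by blast
    moreover from this have "\<tau> \<odot> w \<odot> a = (\<tau> \<odot> \<tau>') \<odot> w"
      using that by (simp add: m_assoc T_sub_carrier Sym_sub_carrier)
    ultimately show ?thesis using that subgroup.m_closed[OF T_sub_subgroup] by blast
  qed
  have W: "\<tau> \<odot> w \<odot> a \<in> ?X" if "a \<in> Sym_sub r n" "\<tau> \<in> T_sub r n" "w \<in> Sym_sub r n" for a \<tau> w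
  proof -
    have "\<tau> \<odot> w \<odot> a = \<tau> \<odot> (w \<odot> a)"
      using that by (simp add: m_assoc T_sub_carrier Sym_sub_carrier)
    then show ?thesis using that subgroup.m_closed[OF Sym_sub_subgroup] by blast
  qed
  have *: "a \<in> T_sub r n \<or> a \<in> Sym_sub r n" if a: "a \<in> s ` {..<n}" for a
  proof -
    obtain i where i: "i < n" "a = s i" using a by auto
    show ?thesis
    proof (cases "i = 0")
      case True
      have "t 1 \<in> T_sub r n"
        unfolding T_sub_def using i by (intro generate.incl imageI) simp
      moreover have "a = t 1" using i True by simp
      ultimately show ?thesis by blast
    next
      case False
      then show ?thesis
        using i unfolding Sym_sub_def simple_refls_def by (intro disjI2 generate.incl) auto
    qed
  qed
  have "g \<in> ?X"
  proof (rule generate_right_induct[of g "s ` {..<n}"])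
    show "?X \<subseteq> carrier G" using T_sub_carrier Sym_sub_carrier by auto
    have "\<one>\<^bsub>G\<^esub> = \<one>\<^bsub>G\<^esub> \<odot> \<one>\<^bsub>G\<^esub>" by simp
    then show "\<one>\<^bsub>G\<^esub> \<in> ?X"
      using subgroup.one_closed[OF T_sub_subgroup] subgroup.one_closed[OF Sym_sub_subgroup]
      by blast
    fix x a assume x: "x \<in> ?X" and a: "a \<in> s ` {..<n}"
    from x obtain \<tau> w where \<tau>w: "x = \<tau> \<odot> w" "\<tau> \<in> T_sub r n" "w \<in> Sym_sub r n" by blast
    have X: "x \<odot> b \<in> ?X" if "b \<in> T_sub r n \<or> b \<in> Sym_sub r n" for b
      using that unfolding \<tau>w(1) by (elim disjE) (rule T W, assumption, rule \<tau>w, rule \<tau>w)+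
    show "x \<odot> a \<in> ?X" by (rule X[OF *[OF a]])
    show "x \<odot> ginv a \<in> ?X"
      using *[OF a] subgroup.m_inv_closed[OF T_sub_subgroup]
        subgroup.m_inv_closed[OF Sym_sub_subgroup] by (intro X) auto
  qed (use assms in \<open>auto simp flip: carrier_generated\<close>)
  then show ?thesis by blast
qed

text \<open>The symmetric group on the first k points. The chain of these groups carries the
  induction behind faithfulness.\<close>

definition W where "W k = generate G (s ` {1..<k})"

lemma W_gens: "k \<le> n \<Longrightarrow> s ` {1..<k} \<subseteq> carrier G"
  by auto

lemma W_carrier: "k \<le> n \<Longrightarrow> g \<in> W k \<Longrightarrow> g \<in> carrier G"
  unfolding W_def using generate_in_carrier[OF W_gens] by blast

lemma Sym_sub_W: "Sym_sub r n = W n"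
  by (simp add: Sym_sub_def simple_refls_def W_def)

lemma W_act:
  assumes "k \<le> n" "g \<in> W k"
  shows "(\<forall>i>k. perm g i = i) \<and> (\<forall>i. expo g i = 0)"
proof -
  have "g \<in> {g \<in> carrier G. (\<forall>i>k. perm g i = i) \<and> (\<forall>i. expo g i = 0)}" (is "_ \<in> ?X")
    using assms(2) unfolding W_def
  proof (rule generate_right_induct[OF _ W_gens[OF assms(1)]])
    fix g a assume g: "g \<in> ?X" and "a \<in> s ` {1..<k}"
    then obtain i where i: "1 \<le> i" "i < k" and a: "a = s i" by auto
    show "g \<odot> a \<in> ?X"
      using g i assms(1)
      by (auto simp: a perm_mult expo_mult perm_s expo_s adj_def transpose_def)
    then show "g \<odot> ginv a \<in> ?X" using i assms(1) by (simp add: a s_inv)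
  qed auto
  then show ?thesis by simp
qed

text \<open>The elements \<open>s\<^sub>k s\<^sub>k\<^sub>-\<^sub>1 \<dots> s\<^sub>k\<^sub>-\<^sub>m\<^sub>+\<^sub>1\<close> for \<open>m \<le> k\<close> represent
  the right cosets of \<open>W k\<close> in \<open>W (k + 1)\<close>.\<close>

fun descending where
  "descending k 0 = \<one>\<^bsub>G\<^esub>"
| "descending k (Suc m) = descending k m \<odot> s (k - m)"

lemma descending_closed [simp]: "k < n \<Longrightarrow> descending k m \<in> carrier G"
  by (induction m) auto

lemma perm_descending: "k < n \<Longrightarrow> m \<le> k \<Longrightarrow> perm (descending k m) (Suc k) = Suc k - m"
  by (induction m) (auto simp: perm_mult perm_s adj_def transpose_def)

lemma descending_s_low:
  assumes "k < n" "1 \<le> i"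
  shows "i < k - m \<Longrightarrow> descending k m \<odot> s i = s i \<odot> descending k m"
proof (induction m)
  case (Suc m)
  then have "i < n" "k - m < n" "Suc i < k - m" using assms by linarith+
  then have "s (k - m) \<odot> s i = s i \<odot> s (k - m)" "descending k m \<odot> s i = s i \<odot> descending k m"
    using s_comm[of "k - m" i] Suc.IH by simp_all
  then show ?case
    using assms Suc.prems by (simp add: commute_mult)
qed (use assms in simp)

text \<open>The letter s_i commutes with the factors of index below i - 1. At the adjacent factors
  s_i s_{i-1} the braid relation turns it into s_{i-1}, which commutes with the remaining
  factors.\<close>

lemma descending_s_high:
  assumes "k < n" "i \<le> k"
  shows "m \<le> k \<Longrightarrow> Suc k < i + m \<Longrightarrow> descending k m \<odot> s i = s (i - 1) \<odot> descending k m"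
proof (induction m)
  case (Suc m)
  show ?case
  proof (cases "i = Suc (k - m)")
    case True
    then obtain l where m: "m = Suc l" using assms Suc.prems by (cases m) auto
    let ?a = "s (k - m)" and ?b = "s i" and ?c = "descending k l"
    have i: "k - l = i" "i < n" "1 \<le> k - m" "k - m < n" using True m Suc.prems assms by auto
    have br: "?b \<odot> (?a \<odot> ?b) = ?a \<odot> (?b \<odot> ?a)"
      using s_braid[of "k - m"] i True assms by simp
    have low: "?c \<odot> ?a = ?a \<odot> ?c"
      using descending_s_low[of k "k - m" l] i assms m Suc.prems by simp
    have c: "?c \<in> carrier G" using assms by simp
    have "descending k (Suc m) \<odot> s i = ?c \<odot> (?b \<odot> (?a \<odot> ?b))"
      using c i by (simp add: m m_assoc)
    also have "\<dots> = (?c \<odot> ?a) \<odot> (?b \<odot> ?a)"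
      using c i unfolding br by (simp add: m_assoc)
    also have "\<dots> = ?a \<odot> descending k (Suc m)"
      using c i unfolding low by (simp add: m m_assoc)
    finally show ?thesis using True by simp
  next
    case False
    then have *: "s (k - m) \<odot> s i = s i \<odot> s (k - m)"
      using Suc.prems assms by (intro s_comm) auto
    have IH: "descending k m \<odot> s i = s (i - 1) \<odot> descending k m"
      using Suc False by simp
    have "descending k (Suc m) \<odot> s i = descending k m \<odot> s i \<odot> s (k - m)"
      using assms by (simp add: m_assoc *)
    also have "\<dots> = s (i - 1) \<odot> descending k (Suc m)"
      using assms unfolding IH by (simp add: m_assoc)
    finally show ?thesis .
  qed
qed (use assms in simp)

lemma W_Suc_decomposition:
  assumes "k < n" "g \<in> W (Suc k)"
  shows "\<exists>w\<in>W k. \<exists>m\<le>k. g = w \<odot> descending k m"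
proof -
  let ?X = "{w \<odot> descending k m | w m. w \<in> W k \<and> m \<le> k}"
  have k: "k \<le> n" "Suc k \<le> n" using assms by auto
  have sin: "s i \<in> W k" if "1 \<le> i" "i < k" for i
    unfolding W_def using that by (intro generate.incl) auto
  have mW: "w \<odot> s i \<in> W k" if "w \<in> W k" "1 \<le> i" "i < k" for w i
    using that sin unfolding W_def by (intro generate.eng) auto
  have "g \<in> ?X"
    using assms(2) unfolding W_def[of "Suc k"]
  proof (rule generate_right_induct[OF _ W_gens[OF k(2)]])
    show "?X \<subseteq> carrier G" using W_carrier[OF k(1)] assms by auto
    have "\<one>\<^bsub>G\<^esub> = \<one>\<^bsub>G\<^esub> \<odot> descending k 0" "\<one>\<^bsub>G\<^esub> \<in> W k"
      by (simp_all add: W_def generate.one)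
    then show "\<one>\<^bsub>G\<^esub> \<in> ?X" by blast
    fix x a assume "x \<in> ?X" and "a \<in> s ` {1..<Suc k}"
    then obtain w m i where x: "x = w \<odot> descending k m" "w \<in> W k" "m \<le> k"
      and i: "1 \<le> i" "i \<le> k" "a = s i" by auto
    have w: "w \<in> carrier G" "descending k m \<in> carrier G" "s i \<in> carrier G"
      using x i assms W_carrier[OF k(1)] by auto
    have xa: "x \<odot> a = w \<odot> (descending k m \<odot> s i)"
      using w by (simp add: x i m_assoc)
    \<comment> \<open>For m > 0 the descending word ends in s_{k-m+1}. So s_i passes through
      unchanged, prolongs the word, cancels its last factor, or passes through with its index
      lowered; whatever comes out on the left is absorbed by \<open>W k\<close>.\<close>
    consider "i < k - m" | "i = k - m" | "m \<noteq> 0" "i = Suc (k - m)" | "Suc k < i + m"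
      using i x by linarith
    then show "x \<odot> a \<in> ?X"
    proof cases
      case 1
      then have "x \<odot> a = (w \<odot> s i) \<odot> descending k m"
        using w i assms unfolding xa by (simp add: descending_s_low m_assoc)
      moreover have "w \<odot> s i \<in> W k" using mW x i 1 by simp
      ultimately show ?thesis using x(3) by blast
    next
      case 2
      then have "x \<odot> a = w \<odot> descending k (Suc m)" unfolding xa by simp
      moreover have "Suc m \<le> k" using 2 i x by simp
      ultimately show ?thesis using x(2) by blast
    next
      case 3
      then obtain l where m: "m = Suc l" by (cases m) auto
      then have "k - l = i" using 3 x by simp
      then have "descending k m \<odot> s i = descending k l"
        using i assms by (simp add: m m_assoc s_sq)
      then have "x \<odot> a = w \<odot> descending k l" "l \<le> k" using xa x m by simp_all
      then show ?thesis using x(2) by blast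
    next
      case 4
      then have "x \<odot> a = (w \<odot> s (i - 1)) \<odot> descending k m"
        using w i x assms unfolding xa by (simp add: descending_s_high m_assoc)
      moreover have "w \<odot> s (i - 1) \<in> W k" using mW x i 4 by simp
      ultimately show ?thesis using x(3) by blast
    qed
    then show "x \<odot> ginv a \<in> ?X" using i assms by (simp add: s_inv)
  qed
  then show ?thesis by blast
qed

text \<open>The factor w fixes k + 1 and the descending word sends it to k + 1 - m. So a trivial
  permutation forces m = 0 and leaves an element of \<open>W k\<close>.\<close>

lemma W_faithful: "k \<le> n \<Longrightarrow> g \<in> W k \<Longrightarrow> perm g = id \<Longrightarrow> g = \<one>\<^bsub>G\<^esub>"
proof (induction k arbitrary: g)
  case 0
  then show ?case by (simp add: W_def generate_empty)
next
  case (Suc k)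
  then obtain w m where g: "g = w \<odot> descending k m" "w \<in> W k" "m \<le> k"
    using W_Suc_decomposition[of k g] by auto
  have w: "w \<in> carrier G" using g Suc.prems W_carrier[of k] by simp
  have "perm g (Suc k) = Suc k - m"
    using w g Suc.prems W_act[of k w] by (simp add: perm_mult perm_descending)
  then have "m = 0" using Suc.prems g by simp
  then show ?case using Suc g w by simp
qed

section \<open>Monomials in the t_i, and faithfulness\<close>

fun t_monomial where
  "t_monomial 0 a = \<one>\<^bsub>G\<^esub>"
| "t_monomial (Suc k) a = t_monomial k a \<odot> t (Suc k) [^]\<^bsub>G\<^esub> (a (Suc k) :: nat)"

lemma t_monomial_closed [simp]: "k \<le> n \<Longrightarrow> t_monomial k a \<in> carrier G"
  by (induction k) auto

lemma t_monomial_cong: "(\<And>i. 1 \<le> i \<Longrightarrow> i \<le> k \<Longrightarrow> a i = b i) \<Longrightarrow> t_monomial k a = t_monomial k b"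
  by (induction k) auto

lemma t_monomial_mult_t:
  "1 \<le> i \<Longrightarrow> i \<le> k \<Longrightarrow> k \<le> n \<Longrightarrow> t_monomial k a \<odot> t i = t_monomial k (a(i := Suc (a i)))"
proof (induction k)
  case (Suc k)
  show ?case
  proof (cases "i = Suc k")
    case True
    have "t_monomial k a = t_monomial k (a(i := Suc (a i)))"
      using True by (intro t_monomial_cong) auto
    then show ?thesis using True Suc.prems by (simp add: m_assoc fun_upd_def)
  next
    case False
    let ?p = "t (Suc k) [^]\<^bsub>G\<^esub> a (Suc k)"
    have c: "?p \<odot> t i = t i \<odot> ?p"
      using Suc.prems False by (intro group_commutes_pow t_comm) auto
    have "t_monomial (Suc k) a \<odot> t i = t_monomial k a \<odot> t i \<odot> ?p"
      using Suc.prems by (simp add: m_assoc c)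
    then show ?thesis using Suc False by simp
  qed
qed simp

lemma T_sub_monomial:
  assumes "\<tau> \<in> T_sub r n"
  shows "\<exists>a. \<tau> = t_monomial n a"
proof -
  have "\<tau> \<in> range (t_monomial n)"
    using assms unfolding T_sub_def
  proof (rule generate_right_induct[OF _ T_gens])
    show "range (t_monomial n) \<subseteq> carrier G" by auto
    have "t_monomial k (\<lambda>_. 0) = \<one>\<^bsub>G\<^esub>" if "k \<le> n" for k using that by (induction k) auto
    then have "\<one>\<^bsub>G\<^esub> = t_monomial n (\<lambda>_. 0)" by simp
    then show "\<one>\<^bsub>G\<^esub> \<in> range (t_monomial n)" by (metis rangeI)
    fix x a assume x: "x \<in> range (t_monomial n)" and a: "a \<in> t ` {1..n}"
    from a obtain i where i: "1 \<le> i" "i \<le> n" "a = t i" by auto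
    have step: "y \<odot> t i \<in> range (t_monomial n)" if "y \<in> range (t_monomial n)" for y
      using that t_monomial_mult_t[OF i(1,2)] by (auto simp del: t_monomial.simps)
    then show "x \<odot> a \<in> range (t_monomial n)" using x i by blast
    have "x \<odot> t i [^]\<^bsub>G\<^esub> (k::nat) \<in> range (t_monomial n)" for k
    proof (induction k)
      case 0
      have "x \<in> carrier G" using x by auto
      then show ?case using x by simp
    next
      case (Suc k)
      have "x \<in> carrier G" using x by auto
      then have "x \<odot> t i [^]\<^bsub>G\<^esub> Suc k = (x \<odot> t i [^]\<^bsub>G\<^esub> k) \<odot> t i"
        using i by (simp add: m_assoc)
      then show ?case using step[OF Suc] by simp
    qed
    then show "x \<odot> ginv a \<in> range (t_monomial n)" using i t_inv by simp
  qed
  then show ?thesis by blast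
qed

lemma perm_t_pow: "i \<le> n \<Longrightarrow> perm (t i [^]\<^bsub>G\<^esub> (k::nat)) = id"
  by (induction k) (auto simp: perm_mult perm_t)

lemma expo_t_pow:
  "1 \<le> i \<Longrightarrow> i \<le> n \<Longrightarrow> expo (t i [^]\<^bsub>G\<^esub> (k::nat)) j = (if j = i then k mod r else 0)"
proof (induction k)
  case (Suc k)
  then show ?case by (simp add: expo_mult perm_t_pow expo_t mod_Suc_eq)
qed simp

lemma perm_t_monomial: "k \<le> n \<Longrightarrow> perm (t_monomial k a) = id"
  by (induction k) (auto simp: perm_mult perm_t_pow)

lemma expo_t_monomial:
  "k \<le> n \<Longrightarrow> expo (t_monomial k a) i = (if 1 \<le> i \<and> i \<le> k then a i mod r else 0)"
  by (induction k) (auto simp: expo_mult perm_t_monomial expo_t_pow)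

lemma t_monomial_faithful:
  assumes "\<And>i. expo (t_monomial n a) i = 0"
  shows "t_monomial n a = \<one>\<^bsub>G\<^esub>"
proof -
  have "t_monomial k a = \<one>\<^bsub>G\<^esub>" if "k \<le> n" for k
    using that
  proof (induction k)
    case (Suc k)
    then have "a (Suc k) mod r = 0" using assms[of "Suc k"] by (simp add: expo_t_monomial)
    then obtain q where q: "a (Suc k) = r * q" by auto
    have "t (Suc k) [^]\<^bsub>G\<^esub> a (Suc k) = (t (Suc k) [^]\<^bsub>G\<^esub> r) [^]\<^bsub>G\<^esub> q"
      using Suc.prems by (simp add: nat_pow_pow q)
    also have "\<dots> = \<one>\<^bsub>G\<^esub>" using Suc.prems by (simp add: t_pow)
    finally show ?case using Suc by simp
  qed simp
  then show ?thesis by simp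
qed

lemma faithful:
  assumes g: "g \<in> carrier G" and "perm g = id" "\<And>i. expo g i = 0"
  shows "g = \<one>\<^bsub>G\<^esub>"
proof -
  obtain \<tau> w where d: "\<tau> \<in> T_sub r n" "w \<in> Sym_sub r n" "g = \<tau> \<odot> w"
    using T_Sym_decomposition[OF g] by blast
  obtain a where a: "\<tau> = t_monomial n a" using T_sub_monomial[OF d(1)] by blast
  have c: "\<tau> \<in> carrier G" "w \<in> carrier G" using d T_sub_carrier Sym_sub_carrier by auto
  have "perm w = id" using assms c by (simp add: d perm_mult a perm_t_monomial)
  then have w: "w = \<one>\<^bsub>G\<^esub>" using W_faithful[of n] d(2) by (simp add: Sym_sub_W)
  then have "g = t_monomial n a" using d a by simp
  then show ?thesis using assms t_monomial_faithful by simp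
qed

text \<open>Divide by h on the right. The quotient u has trivial permutation, so the exponents of u
  and h add up modulo r without relabelling, and those of u must vanish.\<close>

lemma perm_expo_inj:
  assumes [simp]: "g \<in> carrier G" "h \<in> carrier G"
    and p: "perm g = perm h" and e: "\<And>i. expo g i = expo h i"
  shows "g = h"
proof -
  define u where "u = g \<odot> ginv h"
  have u [simp]: "u \<in> carrier G" and g: "g = u \<odot> h" by (auto simp: u_def m_assoc)
  have "perm h (perm u i) = perm h i" for i
    using p perm_mult[of u h] by (simp flip: g) (metis comp_apply)
  then have pu: "perm u = id"
    using permutes_inj[OF perm_permutes[of h]] by (auto simp: fun_eq_iff inj_def)
  have "expo u i = 0" for i
  proof -
    have "(expo u i + expo h i) mod r = expo h i"
      using e[of i] expo_mult[of u h i] by (simp add: pu flip: g)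
    moreover have "expo u i < r" "expo h i < r" by (rule expo_less)+
    ultimately show ?thesis by (cases "expo u i + expo h i < r") (auto simp: mod_if split: if_splits)
  qed
  then have "u = \<one>\<^bsub>G\<^esub>" using pu by (intro faithful) auto
  then show ?thesis by (simp add: g)
qed

end

section \<open>Inversions and lengths\<close>

definition inversions :: "nat \<Rightarrow> (nat \<Rightarrow> nat) \<Rightarrow> (nat \<times> nat) set" where
  "inversions n p = {(i, j). 1 \<le> i \<and> i < j \<and> j \<le> n \<and> p j < p i}"

lemma finite_inversions [simp]: "finite (inversions n p)"
  by (rule finite_subset[of _ "{1..n} \<times> {1..n}"]) (auto simp: inversions_def)

lemma adj_permutes: "k < n \<Longrightarrow> adj k permutes {1..n}"
  using wperm_permutes[of "[(k, True)]" n] by (simp add: words_def)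

text \<open>Exchanging the positions k and k + 1 keeps the order of every pair of positions except
  (k, k + 1) itself, which becomes an inversion because p has an ascent there.\<close>

lemma inversions_comp_adj:
  assumes "1 \<le> k" "k < n" "p k < p (Suc k)"
  shows "inversions n (p \<circ> adj k) = insert (k, Suc k) (map_prod (adj k) (adj k) ` inversions n p)"
    and "(k, Suc k) \<notin> map_prod (adj k) (adj k) ` inversions n p"
proof -
  \<comment> \<open>The map is an involution, so membership in an image can be tested by applying it
    once more.\<close>
  have img: "z \<in> map_prod (adj k) (adj k) ` A \<longleftrightarrow> map_prod (adj k) (adj k) z \<in> A" for z A
  proof
    assume "map_prod (adj k) (adj k) z \<in> A"
    then have "map_prod (adj k) (adj k) (map_prod (adj k) (adj k) z)
        \<in> map_prod (adj k) (adj k) ` A" by (rule imageI)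
    then show "z \<in> map_prod (adj k) (adj k) ` A" by (cases z) simp
  qed auto
  show "inversions n (p \<circ> adj k) = insert (k, Suc k) (map_prod (adj k) (adj k) ` inversions n p)"
    unfolding set_eq_iff insert_iff img using assms
    by (auto simp: inversions_def adj_def transpose_def split: if_splits)
  show "(k, Suc k) \<notin> map_prod (adj k) (adj k) ` inversions n p"
    unfolding img using assms by (auto simp: inversions_def adj_def transpose_def)
qed

lemma card_inversions_ascent:
  assumes "1 \<le> k" "k < n" "p k < p (Suc k)"
  shows "card (inversions n (p \<circ> adj k)) = Suc (card (inversions n p))"
proof -
  have "inj_on (map_prod (adj k) (adj k)) A" for A
    by (rule inj_on_inverseI[of _ "map_prod (adj k) (adj k)"]) auto
  then show ?thesis
    using inversions_comp_adj[OF assms] by (simp add: card_image)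
qed

lemma card_inversions_descent:
  assumes "1 \<le> k" "k < n" "p (Suc k) < p k"
  shows "card (inversions n p) = Suc (card (inversions n (p \<circ> adj k)))"
proof -
  have "(p \<circ> adj k) \<circ> adj k = p" by (simp add: fun_eq_iff)
  then show ?thesis
    using card_inversions_ascent[of k n "p \<circ> adj k"] assms by (simp add: adj_def)
qed

lemma card_inversions_adj_le:
  assumes "p permutes {1..n}" "1 \<le> k" "k < n"
  shows "card (inversions n (p \<circ> adj k)) \<le> Suc (card (inversions n p))"
proof -
  have "p k \<noteq> p (Suc k)" using permutes_inj[OF assms(1)] by (metis inj_eq n_not_Suc_n)
  then show ?thesis
    using card_inversions_ascent[of k n p] card_inversions_descent[of k n p] assms
    by (cases "p k < p (Suc k)") auto
qed

text \<open>Induction upwards from 1 gives i \<le> p i, and induction downwards from n gives p i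
  \<le> i.\<close>

lemma permutes_increasing_id:
  assumes p: "p permutes {1..n}" and inc: "\<And>k. 1 \<le> k \<Longrightarrow> k < n \<Longrightarrow> p k < p (Suc k)"
  shows "p = id"
proof -
  have in_range: "1 \<le> p i \<and> p i \<le> n" if "1 \<le> i" "i \<le> n" for i
    using permutes_in_image[OF p, of i] that by simp
  have "i \<le> p i" if "1 \<le> i" "i \<le> n" for i
    using that
  proof (induction i)
    case (Suc i)
    then show ?case using inc[of i] in_range[of 1] by (cases "i = 0") auto
  qed simp
  moreover have "p i \<le> i" if "i \<le> n" "1 \<le> i" for i
    using that
  proof (induction i rule: inc_induct)
    case base
    then show ?case using in_range[of n] by simp
  next
    case (step m)
    then show ?case using inc[of m] by simp
  qed
  ultimately have "p i = i" for i
    using permutes_not_in[OF p, of i] by (cases "i \<in> {1..n}") (auto intro: antisym)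
  then show ?thesis by auto
qed

section \<open>Blocks, signs and the subgroups they define\<close>

definition preserves :: "nat \<Rightarrow> (nat \<Rightarrow> nat) \<Rightarrow> (nat \<Rightarrow> nat) \<Rightarrow> bool" where
  "preserves n b p \<longleftrightarrow> (\<forall>i\<in>{1..n}. b (p i) = b i)"

text \<open>For monotone b these are the permutations of minimal length in their right coset of the
  Young subgroup with blocks b.\<close>

definition increasing :: "nat \<Rightarrow> (nat \<Rightarrow> nat) \<Rightarrow> (nat \<Rightarrow> nat) \<Rightarrow> bool" where
  "increasing n b p \<longleftrightarrow> (\<forall>i j. 1 \<le> i \<and> i < j \<and> j \<le> n \<and> b i = b j \<longrightarrow> p i < p j)"

definition saturated :: "nat \<Rightarrow> (nat \<Rightarrow> nat) \<Rightarrow> (nat \<Rightarrow> bool) \<Rightarrow> bool" where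
  "saturated n b Q \<longleftrightarrow> (\<forall>i\<in>{1..n}. \<forall>j\<in>{1..n}. b i = b j \<longrightarrow> Q i = Q j)"

context cyclotomic
begin

definition block_gens :: "(nat \<Rightarrow> nat) \<Rightarrow> (nat \<Rightarrow> bool) \<Rightarrow> nat word set set" where
  "block_gens b Q = s ` {j. 1 \<le> j \<and> j < n \<and> b j = b (Suc j)} \<union> t ` {j. 1 \<le> j \<and> j \<le> n \<and> Q j}"

text \<open>The explicit form of the group generated by \<open>block_gens b Q\<close>; see
  \<open>generate_block_gens\<close>.\<close>

definition block_group :: "(nat \<Rightarrow> nat) \<Rightarrow> (nat \<Rightarrow> bool) \<Rightarrow> nat word set set" where
  "block_group b Q =
     {g \<in> carrier G. preserves n b (perm g) \<and> (\<forall>i. expo g i \<noteq> 0 \<longrightarrow> Q i)}"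

lemma block_gens_carrier: "block_gens b Q \<subseteq> carrier G"
  by (auto simp: block_gens_def)

text \<open>A greedy word: peel off some t_i while an exponent is nonzero, then s_k at a descent of
  p. Each letter lowers the size by exactly one, so the same word proves generation and bounds
  lengths. Speaking of data p and a instead of a group element also shows that all admissible data
  occur.\<close>

lemma block_gens_reach:
  assumes "mono b" "saturated n b Q"
    and "p permutes {1..n}" "preserves n b p"
    and "\<And>i. a i < r" "\<And>i. a i \<noteq> 0 \<Longrightarrow> i \<in> {1..n} \<and> Q i"
  shows "\<exists>gs. length gs = (\<Sum>i=1..n. a i) + card (inversions n p) \<and> set gs \<subseteq> block_gens b Q \<and>
    perm (list_product G gs) = p \<and> expo (list_product G gs) = a"
  using assms(3-)
proof (induction "(\<Sum>i=1..n. a i) + card (inversions n p)" arbitrary: a p)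
  case 0
  then have "p k < p (Suc k)" if "1 \<le> k" "k < n" for k
    using that card_inversions_descent[of k n p] permutes_inj[OF 0(2)]
    by (metis add_is_0 inj_eq linorder_neqE_nat n_not_Suc_n nat.distinct(1))
  then have "p = id" using 0 by (intro permutes_increasing_id)
  moreover have sum0: "(\<Sum>i=1..n. a i) = 0" and inv0: "card (inversions n p) = 0"
    using 0(1) by linarith+
  moreover have "a i = 0" for i
  proof (cases "i \<in> {1..n}")
    case True
    then show ?thesis using sum0 by (metis finite_atLeastAtMost sum_eq_0_iff)
  qed (use 0(5) in blast)
  ultimately have "length [] = (\<Sum>i=1..n. a i) + card (inversions n p)"
    "perm (list_product G []) = p" "expo (list_product G []) = a"
    by (simp_all add: list_product_Nil fun_eq_iff)
  then show ?case by (metis empty_subsetI list.set(1))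
next
  case (Suc N)
  show ?case
  proof (cases "\<exists>i. a i \<noteq> 0")
    case True
    then obtain i where i: "a i \<noteq> 0" by blast
    then have iQ: "1 \<le> i" "i \<le> n" "Q i" using Suc.prems(4) by auto
    let ?a = "a(i := a i - 1)"
    have "(\<Sum>j=1..n. a j) = a i + (\<Sum>j\<in>{1..n}-{i}. a j)"
      using iQ by (subst sum.remove[of _ i]) auto
    moreover have "(\<Sum>j=1..n. ?a j) = a i - 1 + (\<Sum>j\<in>{1..n}-{i}. a j)"
      using iQ by (subst sum.remove[of _ i]) auto
    ultimately have sum: "(\<Sum>j=1..n. a j) = Suc (\<Sum>j=1..n. ?a j)" using i by simp
    have "\<exists>gs. length gs = (\<Sum>i=1..n. ?a i) + card (inversions n p) \<and>
        set gs \<subseteq> block_gens b Q \<and>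
        perm (list_product G gs) = p \<and> expo (list_product G gs) = ?a"
    proof (rule Suc.hyps(1))
      show "N = (\<Sum>i=1..n. ?a i) + card (inversions n p)" using Suc.hyps(2) sum by simp
      show "?a j < r" for j using Suc.prems(3)[of j] Suc.prems(3)[of i] by auto
      show "?a j \<noteq> 0 \<Longrightarrow> j \<in> {1..n} \<and> Q j" for j
        using Suc.prems(4)[of j] iQ by (auto split: if_splits)
    qed (use Suc.prems in auto)
    then obtain gs where gs: "length gs = (\<Sum>i=1..n. ?a i) + card (inversions n p)"
      "set gs \<subseteq> block_gens b Q" "perm (list_product G gs) = p" "expo (list_product G gs) = ?a"
      by blast
    have c: "list_product G gs \<in> carrier G"
      using gs(2) block_gens_carrier by (intro list_product_closed) blast
    have "expo (t i \<odot> list_product G gs) j = a j" for j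
      using c iQ i Suc.prems(3)[of j] by (auto simp: expo_mult perm_t expo_t gs(4))
    moreover have "t i \<in> block_gens b Q" using iQ by (auto simp: block_gens_def)
    ultimately show ?thesis
      using gs c iQ sum
      by (intro exI[of _ "t i # gs"]) (simp add: list_product_Cons perm_mult perm_t fun_eq_iff)
  next
    \<comment> \<open>All exponents vanish here, so s_k in front has none to move.\<close>
    case False
    have "p \<noteq> id"
    proof
      assume "p = id"
      then have "inversions n p = {}" by (auto simp: inversions_def)
      then show False using Suc.hyps(2) False by simp
    qed
    then obtain k where k: "1 \<le> k" "k < n" "\<not> p k < p (Suc k)"
      using permutes_increasing_id[OF Suc.prems(1)] by blast
    moreover have "p k \<noteq> p (Suc k)"
      using permutes_inj[OF Suc.prems(1)] by (metis inj_eq n_not_Suc_n)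
    ultimately have desc: "p (Suc k) < p k" by simp
    \<comment> \<open>The descent lies inside a block: p preserves blocks and b is monotone, so the
      block of k + 1 cannot come after that of k.\<close>
    have "b (p (Suc k)) \<le> b (p k)" "b k \<le> b (Suc k)"
      using \<open>mono b\<close> desc by (auto intro: monoD)
    moreover have "b (p (Suc k)) = b (Suc k)" "b (p k) = b k"
      using Suc.prems(2) k by (auto simp: preserves_def)
    ultimately have bk: "b k = b (Suc k)" by simp
    let ?p = "p \<circ> adj k"
    note inv = card_inversions_descent[OF k(1,2) desc]
    have "\<exists>gs. length gs = (\<Sum>i=1..n. a i) + card (inversions n ?p) \<and>
        set gs \<subseteq> block_gens b Q \<and>
        perm (list_product G gs) = ?p \<and> expo (list_product G gs) = a"
    proof (rule Suc.hyps(1))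
      show "N = (\<Sum>i=1..n. a i) + card (inversions n ?p)" using Suc.hyps(2) inv by simp
      show "?p permutes {1..n}"
        using permutes_compose[OF adj_permutes[OF k(2)] Suc.prems(1)] .
      show "preserves n b ?p"
        using Suc.prems(2) bk k by (auto simp: preserves_def adj_def transpose_def)
    qed (use Suc.prems in auto)
    then obtain gs where gs: "length gs = (\<Sum>i=1..n. a i) + card (inversions n ?p)"
      "set gs \<subseteq> block_gens b Q" "perm (list_product G gs) = ?p" "expo (list_product G gs) = a"
      by blast
    have c: "list_product G gs \<in> carrier G"
      using gs(2) block_gens_carrier by (intro list_product_closed) blast
    have "s k \<in> block_gens b Q" using bk k by (auto simp: block_gens_def)
    then show ?thesis
      using gs c k inv False
      by (intro exI[of _ "s k # gs"])
        (simp add: list_product_Cons perm_mult perm_s expo_mult expo_s fun_eq_iff)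
  qed
qed

lemma expo_mult_nonzero:
  "g \<in> carrier G \<Longrightarrow> h \<in> carrier G \<Longrightarrow> expo (g \<odot> h) i \<noteq> 0 \<Longrightarrow>
    expo g i \<noteq> 0 \<or> expo h (perm g i) \<noteq> 0"
  by (cases "expo g i = 0"; cases "expo h (perm g i) = 0") (simp_all add: expo_mult)

lemma block_group_mult:
  assumes "g \<in> block_group b Q" "h \<in> carrier G" "\<And>i. b (perm h i) = b i"
    and "\<And>i. expo h (perm g i) \<noteq> 0 \<Longrightarrow> Q i"
  shows "g \<odot> h \<in> block_group b Q"
  using assms expo_mult_nonzero[of g h]
  unfolding block_group_def preserves_def by (simp add: perm_mult) blast

lemma generate_block_gens:
  assumes "mono b" "saturated n b Q"
  shows "generate G (block_gens b Q) = block_group b Q"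
proof
  show "generate G (block_gens b Q) \<subseteq> block_group b Q"
  proof
    fix h assume "h \<in> generate G (block_gens b Q)"
    then show "h \<in> block_group b Q"
    proof (rule generate_right_induct[OF _ block_gens_carrier])
      fix g x assume g: "g \<in> block_group b Q" and x: "x \<in> block_gens b Q"
      have gc: "g \<in> carrier G" using g by (simp add: block_group_def)
      have S: "g \<odot> s j \<in> block_group b Q" if "1 \<le> j" "j < n" "b j = b (Suc j)" for j
      proof -
        have "b (adj j i) = b i" for i using that by (auto simp: adj_def transpose_def)
        then show ?thesis
          using g that by (intro block_group_mult) (simp_all add: perm_s expo_s)
      qed
      have T: "g \<odot> t j [^]\<^bsub>G\<^esub> (m::nat) \<in> block_group b Q" if "1 \<le> j" "j \<le> n" "Q j" for j m
      proof -
        \<comment> \<open>Appending a power of t_j changes the exponent at the point i that g sends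
          to j. As g preserves blocks, i lies in the block of j, where Q is constant.\<close>
        have "Q i" if "perm g i = j" for i
        proof -
          have "i \<in> {1..n}"
            using that permutes_in_image[OF perm_permutes[OF gc], of i] \<open>1 \<le> j\<close> \<open>j \<le> n\<close> by simp
          moreover from this have "b (perm g i) = b i"
            using g unfolding block_group_def preserves_def by blast
          moreover have "j \<in> {1..n}" using \<open>1 \<le> j\<close> \<open>j \<le> n\<close> by simp
          ultimately show ?thesis
            using assms(2) \<open>Q j\<close> unfolding saturated_def that by metis
        qed
        then show ?thesis
          using g that
          by (intro block_group_mult) (auto simp: perm_t_pow expo_t_pow split: if_splits)
      qed
      have T1: "g \<odot> t j \<in> block_group b Q" if "1 \<le> j" "j \<le> n" "Q j" for j
        using T[OF that, of 1] that by simp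
      show "g \<odot> x \<in> block_group b Q" "g \<odot> ginv x \<in> block_group b Q"
        using x S T T1 by (auto simp: block_gens_def s_inv t_inv)
    qed (auto simp: block_group_def preserves_def)
  qed
next
  have list: "list_product G gs \<in> generate G A" if "set gs \<subseteq> A" for gs A
    using that
    by (induction gs)
      (auto simp: list_product_Nil list_product_Cons intro: generate.one generate.incl generate.eng)
  show "block_group b Q \<subseteq> generate G (block_gens b Q)"
  proof
    fix g assume g: "g \<in> block_group b Q"
    then have gc: "g \<in> carrier G" by (simp add: block_group_def)
    have "\<exists>gs. length gs = (\<Sum>i=1..n. expo g i) + card (inversions n (perm g)) \<and>
        set gs \<subseteq> block_gens b Q \<and>
        perm (list_product G gs) = perm g \<and> expo (list_product G gs) = expo g"
      using g expo_outside[OF gc]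
      by (intro block_gens_reach assms perm_permutes gc expo_less)
        (auto simp: block_group_def, (metis not_less_eq_eq not_gr_zero)+)
    then obtain gs where gs: "set gs \<subseteq> block_gens b Q"
        "perm (list_product G gs) = perm g" "expo (list_product G gs) = expo g"
      by blast
    then have "list_product G gs = g"
      using gc block_gens_carrier by (intro perm_expo_inj list_product_closed) auto
    then show "g \<in> generate G (block_gens b Q)" using list[OF gs(1)] by simp
  qed
qed

end

section \<open>Sorting along blocks\<close>

lemma increasing_if_adjacent:
  assumes "mono b" and adj: "\<And>k. 1 \<le> k \<Longrightarrow> k < n \<Longrightarrow> b k = b (Suc k) \<Longrightarrow> p k < p (Suc k)"
  shows "increasing n b p"
  unfolding increasing_def
proof (intro allI impI)
  fix i j assume ij: "1 \<le> i \<and> i < j \<and> j \<le> n \<and> b i = b j"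
  have "Suc i \<le> l \<Longrightarrow> l \<le> j \<Longrightarrow> p i < p l" for l
  proof (induction l rule: dec_induct)
    case base
    \<comment> \<open>Monotonicity makes blocks intervals, so the points between i and j belong to
      their block.\<close>
    have "b i \<le> b (Suc i)" "b (Suc i) \<le> b j" using base \<open>mono b\<close> by (auto intro: monoD)
    then show ?case using ij base by (intro adj) auto
  next
    case (step l)
    have "b i \<le> b l" "b l \<le> b (Suc l)" "b (Suc l) \<le> b j"
      using step \<open>mono b\<close> by (auto intro: monoD)
    then have "p l < p (Suc l)" using ij step by (intro adj) auto
    then show ?case using step by simp
  qed
  then show "p i < p j" using ij by simp
qed

lemma preserves_id [simp]: "preserves n b id"
  by (simp add: preserves_def)

lemma not_increasing_descent:
  assumes "mono b" "p permutes {1..n}" "\<not> increasing n b p"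
  obtains k where "1 \<le> k" "k < n" "b k = b (Suc k)" "p (Suc k) < p k"
proof -
  obtain k where k: "1 \<le> k" "k < n" "b k = b (Suc k)" "\<not> p k < p (Suc k)"
    using increasing_if_adjacent[OF assms(1)] assms(3) by metis
  moreover have "p k \<noteq> p (Suc k)"
    using permutes_inj[OF assms(2)] by (metis inj_eq n_not_Suc_n)
  ultimately show ?thesis using that by simp
qed

text \<open>Bubble sort: precomposing with \<open>adj k\<close> at a descent inside a block
  preserves blocks and removes one inversion.\<close>

lemma sort_blocks:
  assumes "mono b" "p permutes {1..n}"
  shows "\<exists>u. u permutes {1..n} \<and> preserves n b u \<and> increasing n b (p \<circ> u)"
  using assms(2)
proof (induction "card (inversions n p)" arbitrary: p rule: less_induct)
  case less
  show ?case
  proof (cases "increasing n b p")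
    case True
    then show ?thesis by (intro exI[of _ id]) (simp add: permutes_id)
  next
    case False
    then obtain k where k: "1 \<le> k" "k < n" "b k = b (Suc k)" "p (Suc k) < p k"
      using not_increasing_descent[OF assms(1) less.prems] by blast
    have "p \<circ> adj k permutes {1..n}"
      using permutes_compose[OF adj_permutes[OF k(2)] less.prems] .
    moreover have "card (inversions n (p \<circ> adj k)) < card (inversions n p)"
      using card_inversions_descent[of k n p] k by simp
    ultimately obtain u where u: "u permutes {1..n}" "preserves n b u"
      "increasing n b (p \<circ> adj k \<circ> u)"
      using less.hyps by blast
    have "b (adj k i) = b i" for i using k by (auto simp: adj_def transpose_def)
    then have "preserves n b (adj k \<circ> u)" using u by (simp add: preserves_def)
    moreover have "adj k \<circ> u permutes {1..n}"
      using permutes_compose[OF u(1) adj_permutes[OF k(2)]] .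
    ultimately show ?thesis using u(3) by (auto simp: comp_assoc)
  qed
qed

text \<open>Between blocks u is increasing because it preserves them and they are ordered. Inside a
  block, where p is increasing, a descent of u would be a descent of
  \<open>p \<circ> u\<close>.\<close>

lemma sort_blocks_unique:
  assumes b: "mono b" and u: "u permutes {1..n}" "preserves n b u"
    and p: "increasing n b p" "increasing n b (p \<circ> u)"
  shows "u = id"
proof (rule permutes_increasing_id[OF u(1)])
  fix k assume k: "1 \<le> k" "k < n"
  have bu: "b (u k) = b k" "b (u (Suc k)) = b (Suc k)"
    using u(2) k by (auto simp: preserves_def)
  have r: "u k \<in> {1..n}" "u (Suc k) \<in> {1..n}"
    using k permutes_in_image[OF u(1), of k] permutes_in_image[OF u(1), of "Suc k"] by simp_all
  have neq: "u k \<noteq> u (Suc k)" using permutes_inj[OF u(1)] by (metis inj_eq n_not_Suc_n)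
  show "u k < u (Suc k)"
  proof (rule ccontr)
    assume "\<not> u k < u (Suc k)"
    then have lt: "u (Suc k) < u k" using neq by simp
    then have "b (Suc k) \<le> b k" using b bu by (metis less_imp_le monoD)
    moreover have "b k \<le> b (Suc k)" using b by (simp add: monoD)
    ultimately have eq: "b k = b (Suc k)" by simp
    have "p (u (Suc k)) < p (u k)" using p(1) lt r bu eq unfolding increasing_def by auto
    moreover have "p (u k) < p (u (Suc k))" using p(2) k eq unfolding increasing_def by auto
    ultimately show False by simp
  qed
qed

abbreviation pinv :: "(nat \<Rightarrow> nat) \<Rightarrow> nat \<Rightarrow> nat" where
  "pinv \<equiv> inv_into UNIV"

lemma preserves_inv:
  assumes "u permutes {1..n}" "preserves n b u"
  shows "preserves n b (pinv u)"
  unfolding preserves_def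
proof
  fix i assume "i \<in> {1..n}"
  then have "pinv u i \<in> {1..n}" using permutes_in_image[OF permutes_inv[OF assms(1)]] by blast
  then have "b (u (pinv u i)) = b (pinv u i)" using assms(2) unfolding preserves_def by blast
  then show "b (pinv u i) = b i" using permutes_inverses(1)[OF assms(1)] by simp
qed

text \<open>As p increases on blocks, its inversions join different blocks. The inverse of u moves
  points only within blocks, hence keeps the order of such a pair and makes it an inversion of
  \<open>p \<circ> u\<close>.\<close>

lemma card_inversions_increasing_le:
  assumes b: "mono b" and u: "u permutes {1..n}" "preserves n b u" and p: "increasing n b p"
  shows "card (inversions n p) \<le> card (inversions n (p \<circ> u))"
proof (rule card_inj_on_le[of "map_prod (pinv u) (pinv u)"])
  have "inj (pinv u)" using permutes_inj[OF permutes_inv[OF u(1)]] .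
  then show "inj_on (map_prod (pinv u) (pinv u)) (inversions n p)"
    by (metis (no_types) inj_on_subset prod.inj_map subset_UNIV)
  show "map_prod (pinv u) (pinv u) ` inversions n p \<subseteq> inversions n (p \<circ> u)"
  proof clarsimp
    fix i j assume ij: "(i, j) \<in> inversions n p"
    have "b i < b j"
      using ij p b unfolding inversions_def increasing_def
      by (auto simp: mono_def) (metis le_neq_implies_less less_imp_le_nat not_less_iff_gr_or_eq)
    moreover have "b (pinv u i) = b i" "b (pinv u j) = b j"
      using preserves_inv[OF u] ij by (auto simp: preserves_def inversions_def)
    ultimately have "pinv u i < pinv u j" using b by (metis leD monoD not_le_imp_less)
    moreover have "pinv u i \<in> {1..n}" "pinv u j \<in> {1..n}"
      using permutes_in_image[OF permutes_inv[OF u(1)]] ij by (auto simp: inversions_def)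
    ultimately show "(pinv u i, pinv u j) \<in> inversions n (p \<circ> u)"
      using ij permutes_inverses(1)[OF u(1)] by (auto simp: inversions_def)
  qed
qed simp

context cyclotomic
begin

section \<open>The length function and the minimality criterion\<close>

definition grn_size where
  "grn_size g = (\<Sum>i=1..n. expo g i) + card (inversions n (perm g))"

lemma block_gens_trivial:
  "block_gens (\<lambda>_. 0) (\<lambda>_. True) = t ` {1..n} \<union> simple_refls r n"
  "block_gens (\<lambda>_. 0) (\<lambda>_. False) = simple_refls r n"
  by (auto simp: block_gens_def simple_refls_def)

lemma sum_perm:
  fixes f :: "nat \<Rightarrow> nat"
  assumes "p permutes {1..n}"
  shows "(\<Sum>i=1..n. f (p i)) = (\<Sum>i=1..n. f i)"
  using sum.permute[OF assms, of f] by (simp add: comp_def)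

lemma size_s_mult_le:
  assumes "1 \<le> k" "k < n" "h \<in> carrier G"
  shows "grn_size (s k \<odot> h) \<le> Suc (grn_size h)"
proof -
  have "(\<Sum>i=1..n. expo (s k \<odot> h) i) = (\<Sum>i=1..n. expo h (adj k i))"
    using assms expo_less by (intro sum.cong) (auto simp: expo_mult expo_s perm_s)
  also have "\<dots> = (\<Sum>i=1..n. expo h i)" by (rule sum_perm[OF adj_permutes[OF assms(2)]])
  finally show ?thesis
    using assms card_inversions_adj_le[OF perm_permutes[OF assms(3)] assms(1,2)]
    by (simp add: grn_size_def perm_mult perm_s)
qed

text \<open>The exponent at k grows by one or wraps around from r - 1 to 0.\<close>

lemma size_t_mult_le:
  assumes "1 \<le> k" "k \<le> n" "h \<in> carrier G"
  shows "grn_size (t k \<odot> h) \<le> Suc (grn_size h)"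
proof -
  have "(\<Sum>i=1..n. expo (t k \<odot> h) i) \<le> (\<Sum>i=1..n. (if i = k then 1 else 0) + expo h i)"
    using assms expo_less by (intro sum_mono) (auto simp: expo_mult expo_t perm_t)
  also have "\<dots> = Suc (\<Sum>i=1..n. expo h i)" using assms by (simp add: sum.distrib)
  finally show ?thesis using assms by (simp add: grn_size_def perm_mult perm_t)
qed

lemma size_le_length:
  "set gs \<subseteq> t ` {1..n} \<union> simple_refls r n \<Longrightarrow> grn_size (list_product G gs) \<le> length gs"
proof (induction gs)
  case Nil
  have "inversions n id = {}" by (auto simp: inversions_def)
  then show ?case by (simp add: list_product_Nil grn_size_def)
next
  case (Cons g gs)
  have c: "list_product G gs \<in> carrier G"
    using Cons.prems T_gens Sym_gens by (intro list_product_closed) auto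
  have "grn_size (g \<odot> list_product G gs) \<le> Suc (grn_size (list_product G gs))"
    using Cons.prems c size_s_mult_le size_t_mult_le by (auto simp: simple_refls_def)
  then show ?case using Cons by (simp add: list_product_Cons)
qed

text \<open>The lower bound for words in all generators holds in particular for words in A. This
  lets one argument treat \<open>ell\<close> and \<open>coxeter_length\<close>.\<close>

lemma word_length_eq_size:
  assumes "g \<in> carrier G" "set gs \<subseteq> A" "A \<subseteq> t ` {1..n} \<union> simple_refls r n"
    and "length gs = grn_size g" "list_product G gs = g"
  shows "word_length G A g = grn_size g"
  unfolding word_length_def
proof (rule Least_equality)
  fix k assume "\<exists>gs. length gs = k \<and> set gs \<subseteq> A \<and> list_product G gs = g"
  then show "grn_size g \<le> k" using size_le_length assms(3) by blast
qed (use assms in blast)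

text \<open>The constant block function puts all points into one block, and Q switches the t_i on or
  off: \<open>True\<close> leads to \<open>ell\<close>, \<open>False\<close> to the Coxeter
  length.\<close>

lemma word_length_size:
  assumes g: "g \<in> carrier G" and Q: "\<And>i. expo g i \<noteq> 0 \<Longrightarrow> Q"
  shows "word_length G (block_gens (\<lambda>_. 0) (\<lambda>_. Q)) g = grn_size g"
proof -
  have "\<exists>gs. length gs = (\<Sum>i=1..n. expo g i) + card (inversions n (perm g)) \<and>
      set gs \<subseteq> block_gens (\<lambda>_. 0) (\<lambda>_. Q) \<and>
      perm (list_product G gs) = perm g \<and> expo (list_product G gs) = expo g"
  proof (rule block_gens_reach)
    show "i \<in> {1..n} \<and> Q" if "expo g i \<noteq> 0" for i
      using Q[OF that] expo_outside[OF g] that by metis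
  qed (use g in \<open>simp_all add: monoI saturated_def preserves_def perm_permutes expo_less
        del: One_nat_def\<close>)
  then obtain gs where gs: "length gs = grn_size g" "set gs \<subseteq> block_gens (\<lambda>_. 0) (\<lambda>_. Q)"
    "perm (list_product G gs) = perm g" "expo (list_product G gs) = expo g"
    unfolding grn_size_def by blast
  then have "list_product G gs \<in> carrier G"
    using block_gens_carrier by (intro list_product_closed) blast
  then have "list_product G gs = g" using g gs by (intro perm_expo_inj) simp_all
  moreover have "block_gens (\<lambda>_. 0) (\<lambda>_. Q) \<subseteq> t ` {1..n} \<union> simple_refls r n"
    by (auto simp: block_gens_def simple_refls_def)
  ultimately show ?thesis using g gs by (intro word_length_eq_size)
qed

lemma ell_eq_size: "g \<in> carrier G \<Longrightarrow> ell r n g = grn_size g"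
  using word_length_size[of g True] by (simp add: ell_def block_gens_trivial)

lemma coxeter_length_eq_size:
  "g \<in> carrier G \<Longrightarrow> (\<And>i. expo g i = 0) \<Longrightarrow> coxeter_length r n g = grn_size g"
  using word_length_size[of g False] by (simp add: coxeter_length_def block_gens_trivial)

text \<open>If the right-hand side fails, left multiplication by s_k at a descent inside a block, or
  by the inverse of a t_k with nonzero exponent, shortens e. If it holds, neither the exponent sum
  nor the number of inversions can drop.\<close>

lemma size_minimal_iff:
  assumes b: "mono b" and Q: "saturated n b Q" and e: "e \<in> carrier G"
  shows "(\<forall>h\<in>block_group b Q. grn_size e \<le> grn_size (h \<odot> e)) \<longleftrightarrow>
    increasing n b (perm e) \<and> (\<forall>i. Q i \<longrightarrow> expo e i = 0)"
proof
  assume min: "\<forall>h\<in>block_group b Q. grn_size e \<le> grn_size (h \<odot> e)"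
  have gen: "x \<in> block_group b Q" if "x \<in> generate G (block_gens b Q)" for x
    using that generate_block_gens[OF b Q] by blast
  have "increasing n b (perm e)"
  proof (rule ccontr)
    assume "\<not> increasing n b (perm e)"
    then obtain k where k: "1 \<le> k" "k < n" "b k = b (Suc k)" "perm e (Suc k) < perm e k"
      using not_increasing_descent[OF b perm_permutes[OF e]] by blast
    have "s k \<in> block_group b Q" by (rule gen, rule generate.incl) (use k in \<open>auto simp: block_gens_def\<close>)
    moreover have "(\<Sum>i=1..n. expo (s k \<odot> e) i) = (\<Sum>i=1..n. expo e (adj k i))"
      using k e expo_less by (intro sum.cong) (auto simp: expo_mult expo_s perm_s)
    moreover have "\<dots> = (\<Sum>i=1..n. expo e i)" by (rule sum_perm[OF adj_permutes[OF k(2)]])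
    ultimately show False
      using min k e card_inversions_descent[of k n "perm e"]
      by (auto simp: grn_size_def perm_mult perm_s)
  qed
  moreover have "expo e k = 0" if "Q k" for k
  proof (rule ccontr)
    assume nz: "expo e k \<noteq> 0"
    then have k: "1 \<le> k" "k \<le> n" using expo_outside[OF e, of k] by fastforce+
    have "ginv (t k) \<in> block_group b Q"
      by (rule gen, rule generate.inv) (use k that in \<open>auto simp: block_gens_def\<close>)
    then have le: "grn_size e \<le> grn_size (t k [^]\<^bsub>G\<^esub> (r - 1) \<odot> e)" using min k by (auto simp: t_inv)
    \<comment> \<open>Multiplying by the inverse of t_k lowers a nonzero exponent by one, without
      wrapping around.\<close>
    have "(expo e k + (r - 1)) mod r = expo e k - 1"
    proof -
      have "expo e k + (r - 1) = r + (expo e k - 1)" using nz r_gt_1 by simp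
      moreover have "expo e k - 1 < r" using expo_less[of e k] by simp
      ultimately show ?thesis by (simp only: mod_add_self1 mod_less)
    qed
    then have ex: "expo (t k [^]\<^bsub>G\<^esub> (r - 1) \<odot> e) i = (if i = k then expo e k - 1 else expo e i)" for i
      using k e expo_less[of e i] r_gt_1
      by (simp add: expo_mult expo_t_pow perm_t_pow add.commute)
    have "(\<Sum>i=1..n. expo (t k [^]\<^bsub>G\<^esub> (r - 1) \<odot> e) i) < (\<Sum>i=1..n. expo e i)"
      by (rule sum_strict_mono_ex1) (use k nz ex in auto)
    then show False using le k e by (simp add: grn_size_def perm_mult perm_t_pow)
  qed
  ultimately show "increasing n b (perm e) \<and> (\<forall>i. Q i \<longrightarrow> expo e i = 0)" by blast
next
  assume inc: "increasing n b (perm e) \<and> (\<forall>i. Q i \<longrightarrow> expo e i = 0)"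
  show "\<forall>h\<in>block_group b Q. grn_size e \<le> grn_size (h \<odot> e)"
  proof
    fix h assume h: "h \<in> block_group b Q"
    then have hc: "h \<in> carrier G" and pres: "preserves n b (perm h)"
      and supp: "\<And>i. expo h i \<noteq> 0 \<Longrightarrow> Q i" by (auto simp: block_group_def)
    note ph = perm_permutes[OF hc]
    \<comment> \<open>On points of Q the left-hand side is 0, because h keeps them in Q, where e has
      no exponents. Elsewhere h has exponent 0 and both sides agree.\<close>
    have "expo e (perm h i) \<le> expo (h \<odot> e) i" if i: "i \<in> {1..n}" for i
    proof (cases "Q i")
      case True
      have "perm h i \<in> {1..n}" using permutes_in_image[OF ph] i by blast
      moreover have "b (perm h i) = b i" using pres i unfolding preserves_def by blast
      ultimately have "Q (perm h i)" using Q i True unfolding saturated_def by metis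
      then show ?thesis using inc by simp
    next
      case False
      then have "expo h i = 0" using supp by blast
      then show ?thesis using hc e expo_less by (simp add: expo_mult)
    qed
    then have "(\<Sum>i=1..n. expo e (perm h i)) \<le> (\<Sum>i=1..n. expo (h \<odot> e) i)" by (rule sum_mono)
    then have "(\<Sum>i=1..n. expo e i) \<le> (\<Sum>i=1..n. expo (h \<odot> e) i)"
      by (simp only: sum_perm[OF ph])
    moreover have "card (inversions n (perm e)) \<le> card (inversions n (perm (h \<odot> e)))"
      using card_inversions_increasing_le[OF b ph pres] inc hc e by (simp add: perm_mult)
    ultimately show "grn_size e \<le> grn_size (h \<odot> e)" by (simp add: grn_size_def)
  qed
qed

lemma Sym_sub_eq: "Sym_sub r n = {g \<in> carrier G. \<forall>i. expo g i = 0}"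
proof -
  have "Sym_sub r n = generate G (block_gens (\<lambda>_. 0) (\<lambda>_. False))"
    by (simp add: Sym_sub_def block_gens_trivial)
  also have "\<dots> = block_group (\<lambda>_. 0) (\<lambda>_. False)"
    by (rule generate_block_gens) (auto simp: monoI saturated_def)
  finally show ?thesis by (auto simp: block_group_def preserves_def)
qed

text \<open>With \<open>id\<close> as block function all blocks are single points, so no s_j is a
  generator and exactly the t_j remain.\<close>

lemma T_sub_eq: "T_sub r n = {g \<in> carrier G. perm g = id}"
proof -
  have "block_gens id (\<lambda>_. True) = t ` {1..n}" by (auto simp: block_gens_def)
  then have "T_sub r n = generate G (block_gens id (\<lambda>_. True))" by (simp add: T_sub_def)
  also have "\<dots> = block_group id (\<lambda>_. True)"
    by (rule generate_block_gens) (auto simp: monoI saturated_def)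
  also have "\<dots> = {g \<in> carrier G. perm g = id}"
  proof -
    have "perm g = id" if "g \<in> carrier G" "\<forall>i\<in>{1..n}. perm g i = i" for g
      using permutes_not_in[OF perm_permutes[OF that(1)]] that(2) by (metis eq_id_iff)
    then show ?thesis unfolding block_group_def preserves_def by auto
  qed
  finally show ?thesis .
qed

lemma ex_perm_expo:
  assumes "p permutes {1..n}" "\<And>i. a i < r" "\<And>i. i \<notin> {1..n} \<Longrightarrow> a i = 0"
  shows "\<exists>g\<in>carrier G. perm g = p \<and> expo g = a"
proof -
  have "\<exists>gs. length gs = (\<Sum>i=1..n. a i) + card (inversions n p) \<and>
      set gs \<subseteq> block_gens (\<lambda>_. 0) (\<lambda>_. True) \<and>
      perm (list_product G gs) = p \<and> expo (list_product G gs) = a"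
  proof (rule block_gens_reach)
    show "i \<in> {1..n} \<and> True" if "a i \<noteq> 0" for i using assms(3) that by metis
  qed (use assms in \<open>auto simp: monoI saturated_def preserves_def\<close>)
  then obtain gs where "set gs \<subseteq> block_gens (\<lambda>_. 0) (\<lambda>_. True)"
    "perm (list_product G gs) = p" "expo (list_product G gs) = a"
    by blast
  moreover from this have "list_product G gs \<in> carrier G"
    using block_gens_carrier by (intro list_product_closed) blast
  ultimately show ?thesis by blast
qed

end

section \<open>Signed compositions\<close>

definition width :: "int \<Rightarrow> nat" where
  "width m = nat \<bar>m\<bar>"

lemma width_uminus [simp]: "width (- m) = width m"
  by (simp add: width_def)

lemma width_of_nat [simp]: "width (int k) = k"
  by (simp add: width_def)

lemma width_eq_0_iff [simp]: "width m = 0 \<longleftrightarrow> m = 0"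
  by (simp add: width_def)

lemma width_ge_1_iff: "1 \<le> width m \<longleftrightarrow> m \<noteq> 0"
  by (auto simp: width_def)

text \<open>Blocks are counted from 0. Beyond the last block the value is the number of parts, which
  keeps the function monotone on all naturals, as the lemmas on b require.\<close>

fun blk :: "int list \<Rightarrow> nat \<Rightarrow> nat" where
  "blk [] i = 0"
| "blk (m # \<mu>) i = (if i \<le> width m then 0 else Suc (blk \<mu> (i - width m)))"

text \<open>The default beyond the last block is \<open>False\<close>. Point 0 takes the sign of the
  first block, if there is one; this is harmless since exponents vanish outside {1..n}.\<close>

fun pos :: "int list \<Rightarrow> nat \<Rightarrow> bool" where
  "pos [] i = False"
| "pos (m # \<mu>) i = (if i \<le> width m then 0 < m else pos \<mu> (i - width m))"

lemma signed_composition_Nil [simp]: "signed_composition n [] \<longleftrightarrow> n = 0"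
  by (auto simp: signed_composition_def)

lemma signed_composition_Cons:
  "signed_composition n (m # \<mu>) \<longleftrightarrow>
     m \<noteq> 0 \<and> width m \<le> n \<and> signed_composition (n - width m) \<mu>"
proof -
  have "0 \<le> (\<Sum>m\<leftarrow>\<mu>. \<bar>m\<bar>)" by (rule sum_list_nonneg) auto
  then show ?thesis by (auto simp: signed_composition_def width_def)
qed

lemma mono_blk: "mono (blk \<mu>)"
proof
  show "i \<le> j \<Longrightarrow> blk \<mu> i \<le> blk \<mu> j" for i j
    by (induction \<mu> arbitrary: i j) auto
qed

lemma blk_neg [simp]: "blk (sc_neg \<mu>) = blk \<mu>"
proof
  show "blk (sc_neg \<mu>) i = blk \<mu> i" for i
    by (induction \<mu> arbitrary: i) (auto simp: sc_neg_def)
qed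

text \<open>The bound by n matters: beyond it both signs default to \<open>False\<close>.\<close>

lemma pos_neg:
  "signed_composition n \<mu> \<Longrightarrow> 1 \<le> i \<Longrightarrow> i \<le> n \<Longrightarrow> pos (sc_neg \<mu>) i \<longleftrightarrow> \<not> pos \<mu> i"
  by (induction \<mu> arbitrary: i n) (auto simp: sc_neg_def signed_composition_Cons)

lemma signed_composition_neg: "signed_composition n \<mu> \<Longrightarrow> signed_composition n (sc_neg \<mu>)"
  by (induction \<mu> arbitrary: n) (auto simp: sc_neg_def signed_composition_Cons)

lemma blk_eq_imp_pos_eq:
  "signed_composition n \<mu> \<Longrightarrow> i \<le> n \<Longrightarrow> j \<le> n \<Longrightarrow> blk \<mu> i = blk \<mu> j \<Longrightarrow> pos \<mu> i = pos \<mu> j"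
proof (induction \<mu> arbitrary: i j n)
  case (Cons m \<mu>)
  then have IH: "blk \<mu> (i - width m) = blk \<mu> (j - width m) \<Longrightarrow>
      pos \<mu> (i - width m) = pos \<mu> (j - width m)"
    by (intro Cons.IH[of "n - width m"]) (simp_all add: signed_composition_Cons diff_le_mono)
  show ?case
    using IH Cons.prems(4) unfolding blk.simps pos.simps by (simp split: if_splits)
qed simp

lemma psum_sc_plus_Cons [simp]:
  "psum (sc_plus (m # \<mu>)) (Suc i) = width m + psum (sc_plus \<mu>) i"
  "psum (sc_plus \<mu>) 0 = 0"
  by (simp_all add: psum_def sc_plus_def width_def)

lemma ex_less_Suc: "(\<exists>i<Suc n. P i) \<longleftrightarrow> P 0 \<or> (\<exists>i<n. P (Suc i))"
  using less_Suc_eq_0_disj by auto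

lemma shifted_interval:
  "a + x < j \<and> j < a + y \<longleftrightarrow> x < j - a \<and> j - a < (y :: nat)"
  "a + x < j \<and> j \<le> a + y \<longleftrightarrow> x < j - a \<and> j - a \<le> (y :: nat)"
  by arith+

text \<open>Translates partial sums into block numbers. The induction removes the first part and
  shifts positions by its width; at the boundary j = \<open>width m\<close> both sides are
  false.\<close>

lemma ex_adjacent_in_block_iff:
  "signed_composition n \<mu> \<Longrightarrow>
   (\<exists>i<length \<mu>. psum (sc_plus \<mu>) i < j \<and> j < psum (sc_plus \<mu>) (i + 1)) \<longleftrightarrow>
   1 \<le> j \<and> j < n \<and> blk \<mu> j = blk \<mu> (Suc j)"
proof (induction \<mu> arbitrary: n j)
  case (Cons m \<mu>)
  let ?m = "width m"
  have m: "?m \<ge> 1" "?m \<le> n" "signed_composition (n - ?m) \<mu>"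
    using Cons.prems by (simp_all add: signed_composition_Cons width_ge_1_iff del: One_nat_def)
  have eq: "(\<exists>i<length (m # \<mu>). psum (sc_plus (m # \<mu>)) i < j \<and> j < psum (sc_plus (m # \<mu>)) (i + 1))
      \<longleftrightarrow> (0 < j \<and> j < ?m) \<or>
        (\<exists>i<length \<mu>. psum (sc_plus \<mu>) i < j - ?m \<and> j - ?m < psum (sc_plus \<mu>) (i + 1))"
    unfolding length_Cons ex_less_Suc by (simp add: shifted_interval)
  show ?case
    unfolding eq Cons.IH[OF m(3)] using m(1,2)
    by (cases j ?m rule: linorder_cases) (auto simp: Suc_diff_le)
qed simp

lemma ex_in_positive_block_iff:
  "signed_composition n \<mu> \<Longrightarrow>
   (\<exists>i<length \<mu>. \<mu> ! i > 0 \<and> psum (sc_plus \<mu>) i < j \<and> j \<le> psum (sc_plus \<mu>) (i + 1)) \<longleftrightarrow>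
   1 \<le> j \<and> j \<le> n \<and> pos \<mu> j"
proof (induction \<mu> arbitrary: n j)
  case (Cons m \<mu>)
  let ?m = "width m"
  have m: "?m \<ge> 1" "?m \<le> n" "signed_composition (n - ?m) \<mu>"
    using Cons.prems by (simp_all add: signed_composition_Cons width_ge_1_iff del: One_nat_def)
  have eq: "(\<exists>i<length (m # \<mu>). (m # \<mu>) ! i > 0 \<and>
        psum (sc_plus (m # \<mu>)) i < j \<and> j \<le> psum (sc_plus (m # \<mu>)) (i + 1))
      \<longleftrightarrow> (0 < m \<and> 0 < j \<and> j \<le> ?m) \<or>
        (\<exists>i<length \<mu>. \<mu> ! i > 0 \<and> psum (sc_plus \<mu>) i < j - ?m \<and> j - ?m \<le> psum (sc_plus \<mu>) (i + 1))"
    unfolding length_Cons ex_less_Suc by (simp add: shifted_interval)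
  show ?case
    unfolding eq Cons.IH[OF m(3)] using m(1,2) by (cases "j \<le> ?m") auto
qed simp

lemma signed_composition_unique:
  assumes "signed_composition n \<mu>" "signed_composition n \<nu>"
    and "\<And>j. 1 \<le> j \<Longrightarrow> j < n \<Longrightarrow> blk \<mu> j = blk \<mu> (Suc j) \<longleftrightarrow> blk \<nu> j = blk \<nu> (Suc j)"
    and "\<And>j. 1 \<le> j \<Longrightarrow> j \<le> n \<Longrightarrow> pos \<mu> j = pos \<nu> j"
  shows "\<mu> = \<nu>"
  using assms
proof (induction \<mu> arbitrary: \<nu> n)
  case Nil
  then show ?case by (cases \<nu>) (auto simp: signed_composition_Cons)
next
  case (Cons m \<mu>)
  obtain k \<kappa> where \<nu>: "\<nu> = k # \<kappa>"
    using Cons.prems by (cases \<nu>) (auto simp: signed_composition_Cons)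
  let ?m = "width m"
  have m: "?m \<ge> 1" "?m \<le> n" "signed_composition (n - ?m) \<mu>"
    and k: "width k \<ge> 1" "width k \<le> n" "signed_composition (n - width k) \<kappa>"
    using Cons.prems by (simp_all add: signed_composition_Cons width_ge_1_iff \<nu> del: One_nat_def)
  \<comment> \<open>If one first part were shorter, its end would be a block boundary for its own
    composition but an inner point of a block for the other.\<close>
  have no_less: "\<not> width x < width y"
    if "blk (x # \<xi>) (width x) = blk (x # \<xi>) (Suc (width x)) \<longleftrightarrow>
        blk (y # \<eta>) (width x) = blk (y # \<eta>) (Suc (width x))" for x y \<xi> \<eta>
  proof
    assume "width x < width y"
    then have "width x \<le> width y" "Suc (width x) \<le> width y" by linarith+
    then show False using that unfolding blk.simps by simp
  qed
  have "\<not> ?m < width k"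
  proof
    assume "?m < width k"
    moreover from this have "?m < n" using k(2) by linarith
    ultimately show False using no_less Cons.prems(3)[OF m(1)] unfolding \<nu> by blast
  qed
  moreover have "\<not> width k < ?m"
  proof
    assume "width k < ?m"
    moreover from this have "width k < n" using m(2) by linarith
    ultimately show False using no_less Cons.prems(3)[OF k(1), symmetric] unfolding \<nu> by blast
  qed
  ultimately have abs_eq: "?m = width k" by (metis linorder_neqE_nat)
  have sgn_eq: "0 < m \<longleftrightarrow> 0 < k"
  proof -
    have "pos (m # \<mu>) 1 = pos (k # \<kappa>) 1"
      using Cons.prems(4)[of 1] m(1,2) unfolding \<nu> by linarith
    then show ?thesis using m(1) k(1) by (simp only: pos.simps if_True)
  qed
  have mk: "m = k" using abs_eq sgn_eq m(1) k(1) unfolding width_def by linarith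
  have "\<mu> = \<kappa>"
  proof (rule Cons.IH)
    show "signed_composition (n - ?m) \<mu>" "signed_composition (n - ?m) \<kappa>"
      using m k mk by auto
    show "blk \<mu> j = blk \<mu> (Suc j) \<longleftrightarrow> blk \<kappa> j = blk \<kappa> (Suc j)" if "1 \<le> j" "j < n - ?m" for j
      using Cons.prems(3)[of "?m + j"] that by (simp add: \<nu> mk)
    show "pos \<mu> j = pos \<kappa> j" if "1 \<le> j" "j \<le> n - ?m" for j
      using Cons.prems(4)[of "?m + j"] that by (simp add: \<nu> mk)
  qed
  then show ?case by (simp add: \<nu> mk)
qed

text \<open>Used to produce \<mu> \<inter> d\<nu>; only the level sets of the key K matter. The
  first of them is {1..m}: it becomes the first part, signed by Q 1, and the remaining points are
  shifted by m.\<close>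

lemma ex_signed_composition:
  assumes "\<And>i j. 1 \<le> i \<Longrightarrow> i \<le> j \<Longrightarrow> j \<le> n \<Longrightarrow> K i \<le> (K j :: nat)"
    and "\<And>i j. i \<in> {1..n} \<Longrightarrow> j \<in> {1..n} \<Longrightarrow> K i = K j \<Longrightarrow> Q i = Q j"
  shows "\<exists>\<sigma>. signed_composition n \<sigma> \<and> (\<forall>i\<in>{1..n}. pos \<sigma> i = Q i) \<and>
    (\<forall>i\<in>{1..n}. \<forall>j\<in>{1..n}. blk \<sigma> i = blk \<sigma> j \<longleftrightarrow> K i = K j)"
  using assms
proof (induction n arbitrary: K Q rule: less_induct)
  case (less n)
  show ?case
  proof (cases "n = 0")
    case True
    then show ?thesis by (intro exI[of _ "[]"]) auto
  next
    case False
    let ?A = "{i \<in> {1..n}. K i = K 1}"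
    define m where "m = Max ?A"
    have "1 \<in> ?A" using False by simp
    then have mA: "m \<in> ?A" unfolding m_def by (intro Max_in) auto
    then have m: "1 \<le> m" "m \<le> n" "K m = K 1" by auto
    have first: "K i = K 1 \<longleftrightarrow> i \<le> m" if "i \<in> {1..n}" for i
    proof
      show "K i = K 1 \<Longrightarrow> i \<le> m" unfolding m_def using that by (intro Max_ge) auto
      show "i \<le> m \<Longrightarrow> K i = K 1"
        using less.prems(1)[of 1 i] less.prems(1)[of i m] m that by auto
    qed
    have "\<exists>\<sigma>. signed_composition (n - m) \<sigma> \<and> (\<forall>i\<in>{1..n-m}. pos \<sigma> i = Q (m + i)) \<and>
      (\<forall>i\<in>{1..n-m}. \<forall>j\<in>{1..n-m}. blk \<sigma> i = blk \<sigma> j \<longleftrightarrow> K (m + i) = K (m + j))"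
      using m False by (intro less.IH less.prems) auto
    then obtain \<sigma> where \<sigma>: "signed_composition (n - m) \<sigma>"
      "\<And>i. i \<in> {1..n-m} \<Longrightarrow> pos \<sigma> i = Q (m + i)"
      "\<And>i j. i \<in> {1..n-m} \<Longrightarrow> j \<in> {1..n-m} \<Longrightarrow> blk \<sigma> i = blk \<sigma> j \<longleftrightarrow> K (m + i) = K (m + j)"
      by blast
    let ?\<sigma> = "(if Q 1 then int m else - int m) # \<sigma>"
    have nm: "width (if Q 1 then int m else - int m) = m" by simp
    have "signed_composition n ?\<sigma>" using \<sigma>(1) m by (auto simp: signed_composition_Cons)
    moreover have "pos ?\<sigma> i = Q i" if i: "i \<in> {1..n}" for i
    proof (cases "i \<le> m")
      case True
      then have "Q i = Q 1" using first[OF i] less.prems(2)[of i 1] i False by auto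
      then show ?thesis using True m by (simp add: nm)
    next
      case False
      then have "i - m \<in> {1..n - m}" "m + (i - m) = i" using i by auto
      then show ?thesis using False \<sigma>(2)[of "i - m"] by (simp add: nm)
    qed
    moreover have "blk ?\<sigma> i = blk ?\<sigma> j \<longleftrightarrow> K i = K j"
      if i: "i \<in> {1..n}" and j: "j \<in> {1..n}" for i j
    proof (cases "i \<le> m \<or> j \<le> m")
      case True
      then show ?thesis using first[OF i] first[OF j] by (auto simp: nm)
    next
      case False
      then have "i - m \<in> {1..n - m}" "m + (i - m) = i" "j - m \<in> {1..n - m}" "m + (j - m) = j"
        using i j by auto
      then show ?thesis using False \<sigma>(3)[of "i - m" "j - m"] by (simp add: nm)
    qed
    ultimately show ?thesis by blast
  qed
qed

section \<open>Minimal coset representatives\<close>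

text \<open>Used with p the permutation of a factor and q its sorted form, to see that q stays
  minimal on the \<mu> side. For i < j in a block of b, p puts i into a block of b' not later than
  that of j, hence so does q; inside one block of b' the increasing inverse of q decides.\<close>

lemma increasing_transfer:
  assumes b: "mono b'" and p: "p permutes {1..n}" and q: "q permutes {1..n}"
    and same: "\<And>i. i \<in> {1..n} \<Longrightarrow> b' (q i) = b' (p i)"
    and inc: "increasing n b p" "increasing n b' (pinv q)"
  shows "increasing n b q"
  unfolding increasing_def
proof (intro allI impI)
  fix i j assume ij: "1 \<le> i \<and> i < j \<and> j \<le> n \<and> b i = b j"
  then have mem: "i \<in> {1..n}" "j \<in> {1..n}" by simp_all
  have "p i < p j" using inc(1) ij unfolding increasing_def by blast
  then have le: "b' (q i) \<le> b' (q j)" using same mem b by (simp add: monoD)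
  have neq: "q i \<noteq> q j" using permutes_inj[OF q] ij by (metis inj_eq less_irrefl)
  show "q i < q j"
  proof (rule ccontr)
    assume "\<not> q i < q j"
    then have lt: "q j < q i" using neq by simp
    then have "b' (q j) \<le> b' (q i)" using b by (simp add: monoD)
    then have eq: "b' (q j) = b' (q i)" using le by simp
    have "1 \<le> q j" "q i \<le> n" using permutes_in_image[OF q] mem by (meson atLeastAtMost_iff)+
    then have "pinv q (q j) < pinv q (q i)"
      using inc(2) lt eq unfolding increasing_def by blast
    then show False using ij permutes_inverses(2)[OF q] by simp
  qed
qed

lemma mod_add_left_cancel:
  fixes a b r :: nat
  assumes "(a + b) mod r = a" "b < r"
  shows "b = 0"
proof -
  have "a < r" using assms by (metis mod_less_divisor not_less_zero not_gr_zero)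
  then show ?thesis using assms by (cases "a + b < r") (auto simp: mod_if split: if_splits)
qed

context cyclotomic
begin

section \<open>The sets of the statement in terms of permutations and exponents\<close>

lemma saturated_pos: "signed_composition n \<mu> \<Longrightarrow> saturated n (blk \<mu>) (pos \<mu>)"
  using blk_eq_imp_pos_eq unfolding saturated_def by simp

lemma Pi_sc_eq:
  assumes "signed_composition n \<mu>"
  shows "Pi_sc r n \<mu> = block_gens (blk \<mu>) (pos \<mu>)"
proof -
  have "Pi_sc r n \<mu> =
      s ` {j. \<exists>i<length \<mu>. psum (sc_plus \<mu>) i < j \<and> j < psum (sc_plus \<mu>) (i + 1)} \<union>
      t ` {j. \<exists>i<length \<mu>. \<mu> ! i > 0 \<and> psum (sc_plus \<mu>) i < j \<and> j \<le> psum (sc_plus \<mu>) (i + 1)}"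
    unfolding Pi_sc_def by blast
  then show ?thesis
    unfolding ex_adjacent_in_block_iff[OF assms] ex_in_positive_block_iff[OF assms]
      block_gens_def .
qed

lemma G_sc_eq:
  "signed_composition n \<mu> \<Longrightarrow> G_sc r n \<mu> = block_group (blk \<mu>) (pos \<mu>)"
  unfolding G_sc_def by (simp only: Pi_sc_eq generate_block_gens mono_blk saturated_pos)

lemma Young_sub_eq:
  assumes "signed_composition n \<mu>"
  shows "Young_sub r n (sc_plus \<mu>) = block_group (blk \<mu>) (\<lambda>_. False)"
proof -
  have "{s j | i j. i < length (sc_plus \<mu>) \<and>
        psum (sc_plus \<mu>) i < j \<and> j < psum (sc_plus \<mu>) (i + 1)} =
      s ` {j. \<exists>i<length \<mu>. psum (sc_plus \<mu>) i < j \<and> j < psum (sc_plus \<mu>) (i + 1)}"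
    unfolding sc_plus_def length_map by blast
  then have "Young_sub r n (sc_plus \<mu>) = generate G (block_gens (blk \<mu>) (\<lambda>_. False))"
    unfolding Young_sub_def ex_adjacent_in_block_iff[OF assms] block_gens_def by simp
  then show ?thesis
    by (simp add: generate_block_gens mono_blk saturated_def)
qed

lemma E_set_eq:
  assumes "signed_composition n \<mu>"
  shows "E_set r n \<mu> =
    {e \<in> carrier G. increasing n (blk \<mu>) (perm e) \<and> (\<forall>i. pos \<mu> i \<longrightarrow> expo e i = 0)}"
proof -
  have "(\<forall>g\<in>G_sc r n \<mu> #>\<^bsub>G\<^esub> e. ell r n e \<le> ell r n g) \<longleftrightarrow>
      increasing n (blk \<mu>) (perm e) \<and> (\<forall>i. pos \<mu> i \<longrightarrow> expo e i = 0)"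
    if e: "e \<in> carrier G" for e
  proof -
    have "h \<odot> e \<in> carrier G" if "h \<in> block_group (blk \<mu>) (pos \<mu>)" for h
      using that e by (simp add: block_group_def)
    then have "(\<forall>g\<in>G_sc r n \<mu> #>\<^bsub>G\<^esub> e. ell r n e \<le> ell r n g) \<longleftrightarrow>
        (\<forall>h\<in>block_group (blk \<mu>) (pos \<mu>). grn_size e \<le> grn_size (h \<odot> e))"
      using e by (simp add: r_coset_def G_sc_eq[OF assms] ell_eq_size)
    then show ?thesis
      using size_minimal_iff[OF mono_blk saturated_pos[OF assms] e] by simp
  qed
  then show ?thesis unfolding E_set_def by blast
qed

lemma D_set_eq:
  assumes "signed_composition n \<mu>"
  shows "D_set r n (sc_plus \<mu>) =
    {d \<in> carrier G. (\<forall>i. expo d i = 0) \<and> increasing n (blk \<mu>) (perm d)}"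
proof -
  have "(\<forall>w\<in>Young_sub r n (sc_plus \<mu>) #>\<^bsub>G\<^esub> d. coxeter_length r n d \<le> coxeter_length r n w)
      \<longleftrightarrow> increasing n (blk \<mu>) (perm d)"
    if d: "d \<in> carrier G" "\<And>i. expo d i = 0" for d
  proof -
    have "h \<odot> d \<in> carrier G \<and> (\<forall>i. expo (h \<odot> d) i = 0)"
      if "h \<in> block_group (blk \<mu>) (\<lambda>_. False)" for h
      using that d by (simp add: block_group_def expo_mult)
    then have "(\<forall>w\<in>Young_sub r n (sc_plus \<mu>) #>\<^bsub>G\<^esub> d.
          coxeter_length r n d \<le> coxeter_length r n w) \<longleftrightarrow>
        (\<forall>h\<in>block_group (blk \<mu>) (\<lambda>_. False). grn_size d \<le> grn_size (h \<odot> d))"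
      using d by (simp add: r_coset_def Young_sub_eq[OF assms] coxeter_length_eq_size)
    also have "\<dots> \<longleftrightarrow> increasing n (blk \<mu>) (perm d)"
      using size_minimal_iff[of "blk \<mu>" "\<lambda>_. False" d] d(1)
      by (simp add: mono_blk saturated_def)
    finally show ?thesis .
  qed
  then show ?thesis unfolding D_set_def Sym_sub_eq by blast
qed

lemma perm_ginv:
  assumes "g \<in> carrier G"
  shows "perm (ginv g) = pinv (perm g)"
proof (rule HOL.sym, rule inv_unique_comp)
  show "perm g \<circ> perm (ginv g) = id" "perm (ginv g) \<circ> perm g = id"
    using assms perm_mult[of "ginv g" g] perm_mult[of g "ginv g"] by simp_all
qed

lemma expo_ginv:
  assumes "g \<in> carrier G" "\<And>i. expo g i = 0"
  shows "expo (ginv g) i = 0"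
  using expo_mult[of "ginv g" g i] assms expo_less[of "ginv g" i] by simp

lemma D_double_iff:
  assumes "signed_composition n \<mu>" "signed_composition n \<nu>"
  shows "d \<in> D_double r n (sc_plus \<mu>) (sc_plus \<nu>) \<longleftrightarrow>
    d \<in> carrier G \<and> (\<forall>i. expo d i = 0) \<and>
    increasing n (blk \<mu>) (perm d) \<and> increasing n (blk \<nu>) (pinv (perm d))"
    (is "?L \<longleftrightarrow> ?R")
proof
  assume ?L
  then obtain c where c: "d = ginv c" "c \<in> D_set r n (sc_plus \<nu>)" "d \<in> D_set r n (sc_plus \<mu>)"
    unfolding D_double_def by blast
  then have "c \<in> carrier G" "increasing n (blk \<nu>) (perm c)" by (simp_all add: D_set_eq assms)
  moreover from this have "pinv (perm d) = perm c"
    using permutes_inv_inv[OF perm_permutes] by (simp add: c(1) perm_ginv)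
  ultimately show ?R using c(3) by (simp add: D_set_eq assms)
next
  assume R: ?R
  then have "ginv d \<in> D_set r n (sc_plus \<nu>)" "d \<in> D_set r n (sc_plus \<mu>)"
    by (simp_all add: D_set_eq assms perm_ginv expo_ginv)
  moreover have "d = ginv (ginv d)" using R by simp
  ultimately show ?L unfolding D_double_def by blast
qed

lemma finite_carrier: "finite (carrier G)"
proof (rule inj_on_finite[of "\<lambda>g. (perm g, expo g)"])
  show "inj_on (\<lambda>g. (perm g, expo g)) (carrier G)"
    by (rule inj_onI) (simp add: perm_expo_inj)
  show "(\<lambda>g. (perm g, expo g)) ` carrier G \<subseteq>
      {p. p permutes {1..n}} \<times> {f. \<forall>i. (i \<in> {1..n} \<longrightarrow> f i \<in> {..<r}) \<and> (i \<notin> {1..n} \<longrightarrow> f i = 0)}"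
    using perm_permutes expo_less expo_outside by (intro image_subsetI) (simp del: One_nat_def)
  show "finite ({p. p permutes {1..n}} \<times>
      {f. \<forall>i. (i \<in> {1..n} \<longrightarrow> f i \<in> {..<r}) \<and> (i \<notin> {1..n} \<longrightarrow> f i = (0 :: nat))})"
    by (intro finite_cartesian_product finite_permutations finite_set_of_finite_funs) auto
qed

text \<open>The s_j and t_j that belong to the subgroup reveal block boundaries and signs. This
  gives the uniqueness behind the definite description in \<open>sc_meet\<close>.\<close>

lemma G_sc_inj:
  assumes \<sigma>: "signed_composition n \<sigma>" and \<tau>: "signed_composition n \<tau>"
    and eq: "G_sc r n \<sigma> = G_sc r n \<tau>"
  shows "\<sigma> = \<tau>"
proof (rule signed_composition_unique[OF \<sigma> \<tau>])
  have s_iff: "s j \<in> G_sc r n \<mu> \<longleftrightarrow> blk \<mu> j = blk \<mu> (Suc j)"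
    if "1 \<le> j" "j < n" "signed_composition n \<mu>" for j \<mu>
  proof
    assume "s j \<in> G_sc r n \<mu>"
    then have "\<forall>i\<in>{1..n}. blk \<mu> (perm (s j) i) = blk \<mu> i"
      unfolding G_sc_eq[OF that(3)] block_group_def preserves_def by blast
    moreover have "j \<in> {1..n}" "perm (s j) j = Suc j"
      using that by (simp_all add: perm_s adj_def)
    ultimately show "blk \<mu> j = blk \<mu> (Suc j)" by metis
  next
    assume "blk \<mu> j = blk \<mu> (Suc j)"
    then show "s j \<in> G_sc r n \<mu>"
      unfolding G_sc_def Pi_sc_eq[OF that(3)] block_gens_def
      using that by (intro generate.incl) simp
  qed
  have t_iff: "t j \<in> G_sc r n \<mu> \<longleftrightarrow> pos \<mu> j"
    if "1 \<le> j" "j \<le> n" "signed_composition n \<mu>" for j \<mu>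
  proof
    assume "t j \<in> G_sc r n \<mu>"
    then have "\<forall>i. expo (t j) i \<noteq> 0 \<longrightarrow> pos \<mu> i"
      unfolding G_sc_eq[OF that(3)] block_group_def by blast
    then show "pos \<mu> j" using that by (simp add: expo_t)
  next
    assume "pos \<mu> j"
    then show "t j \<in> G_sc r n \<mu>"
      unfolding G_sc_def Pi_sc_eq[OF that(3)] block_gens_def
      using that by (intro generate.incl) simp
  qed
  show "blk \<sigma> j = blk \<sigma> (Suc j) \<longleftrightarrow> blk \<tau> j = blk \<tau> (Suc j)" if "1 \<le> j" "j < n" for j
    using s_iff[OF that \<sigma>] s_iff[OF that \<tau>] eq by simp
  show "pos \<sigma> j = pos \<tau> j" if "1 \<le> j" "j \<le> n" for j
    using t_iff[OF that \<sigma>] t_iff[OF that \<tau>] eq by simp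
qed

lemma conj_coset_iff:
  assumes H: "H \<subseteq> carrier G" and d: "d \<in> carrier G"
  shows "g \<in> d <#\<^bsub>G\<^esub> H #>\<^bsub>G\<^esub> ginv d \<longleftrightarrow> g \<in> carrier G \<and> ginv d \<odot> g \<odot> d \<in> H"
proof
  assume "g \<in> d <#\<^bsub>G\<^esub> H #>\<^bsub>G\<^esub> ginv d"
  then obtain h where h: "h \<in> H" "g = d \<odot> h \<odot> ginv d"
    unfolding r_coset_def l_coset_def by blast
  then have "h \<in> carrier G" using H by blast
  then have "g \<in> carrier G" "ginv d \<odot> g \<odot> d = h"
    using d by (simp_all add: h(2) m_assoc inv_solve_left')
  then show "g \<in> carrier G \<and> ginv d \<odot> g \<odot> d \<in> H" using h(1) by simp
next
  assume g: "g \<in> carrier G \<and> ginv d \<odot> g \<odot> d \<in> H"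
  have "g = d \<odot> (ginv d \<odot> g \<odot> d) \<odot> ginv d"
    using g d by (simp add: m_assoc) (simp add: m_assoc[symmetric])
  then show "g \<in> d <#\<^bsub>G\<^esub> H #>\<^bsub>G\<^esub> ginv d"
    unfolding r_coset_def l_coset_def using g by blast
qed

text \<open>Conjugation by d pulls the blocks and signs of \<nu> back along \<open>perm d\<close>,
  so the intersection belongs to the common refinement, positive where both signs are. The blocks of
  this refinement are intervals because d increases on the blocks of \<mu>.\<close>

lemma sc_meet_props:
  assumes \<mu>: "signed_composition n \<mu>" and \<nu>: "signed_composition n \<nu>"
    and d: "d \<in> carrier G" "\<And>i. expo d i = 0" "increasing n (blk \<mu>) (perm d)"
  defines "\<sigma> \<equiv> sc_meet r n \<mu> d \<nu>"
  shows "signed_composition n \<sigma>"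
    and "\<And>i j. i \<in> {1..n} \<Longrightarrow> j \<in> {1..n} \<Longrightarrow> blk \<sigma> i = blk \<sigma> j \<longleftrightarrow>
      blk \<mu> i = blk \<mu> j \<and> blk \<nu> (perm d i) = blk \<nu> (perm d j)"
    and "\<And>i. i \<in> {1..n} \<Longrightarrow> pos \<sigma> i \<longleftrightarrow> pos \<mu> i \<and> pos \<nu> (perm d i)"
proof -
  let ?p = "perm d"
  note p = perm_permutes[OF d(1)]
  have pn: "?p i \<in> {1..n} \<longleftrightarrow> i \<in> {1..n}" for i by (rule permutes_in_image[OF p])
  \<comment> \<open>M exceeds all block numbers of \<nu> on {1..n}, so K compares pairs of block
    numbers lexicographically and determines both entries.\<close>
  define M where "M = Suc (blk \<nu> n)"
  define K where "K i = blk \<mu> i * M + blk \<nu> (?p i)" for i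
  have bound: "blk \<nu> (?p i) < M" if "i \<in> {1..n}" for i
    using pn[of i] that monoD[OF mono_blk, of "?p i" n \<nu>] by (simp add: M_def less_Suc_eq_le)
  have K_iff: "K i = K j \<longleftrightarrow> blk \<mu> i = blk \<mu> j \<and> blk \<nu> (?p i) = blk \<nu> (?p j)"
    if "i \<in> {1..n}" "j \<in> {1..n}" for i j
  proof
    assume "K i = K j"
    then have "K i div M = K j div M" "K i mod M = K j mod M" by simp_all
    then show "blk \<mu> i = blk \<mu> j \<and> blk \<nu> (?p i) = blk \<nu> (?p j)"
      using bound[OF that(1)] bound[OF that(2)] by (simp add: K_def)
  qed (simp add: K_def)
  have K_mono: "K i \<le> K j" if "1 \<le> i" "i \<le> j" "j \<le> n" for i j
  proof (cases "blk \<mu> i = blk \<mu> j")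
    case True
    have "?p i \<le> ?p j"
      using d(3) that True unfolding increasing_def by (cases "i = j") (simp_all add: less_imp_le)
    then show ?thesis using True by (simp add: K_def monoD[OF mono_blk])
  next
    case False
    then have "Suc (blk \<mu> i) \<le> blk \<mu> j"
      using monoD[OF mono_blk that(2), of \<mu>] by simp
    then have "Suc (blk \<mu> i) * M \<le> blk \<mu> j * M" by (rule mult_le_mono1)
    then show ?thesis using bound[of i] that by (simp add: K_def)
  qed
  obtain \<rho> where \<rho>: "signed_composition n \<rho>"
    "\<forall>i\<in>{1..n}. pos \<rho> i = (pos \<mu> i \<and> pos \<nu> (?p i))"
    "\<forall>i\<in>{1..n}. \<forall>j\<in>{1..n}. blk \<rho> i = blk \<rho> j \<longleftrightarrow> K i = K j"
  proof -
    have "(pos \<mu> i \<and> pos \<nu> (?p i)) = (pos \<mu> j \<and> pos \<nu> (?p j))"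
      if "i \<in> {1..n}" "j \<in> {1..n}" "K i = K j" for i j
    proof -
      have b: "blk \<mu> i = blk \<mu> j" "blk \<nu> (?p i) = blk \<nu> (?p j)"
        using K_iff[OF that(1,2)] that(3) by simp_all
      have "?p i \<le> n" "?p j \<le> n" using pn[of i] pn[of j] that by simp_all
      then have "pos \<mu> i = pos \<mu> j" "pos \<nu> (?p i) = pos \<nu> (?p j)"
        using blk_eq_imp_pos_eq[OF \<mu> _ _ b(1)] blk_eq_imp_pos_eq[OF \<nu> _ _ b(2)] that by simp_all
      then show ?thesis by simp
    qed
    then show thesis
      using ex_signed_composition[of n K "\<lambda>i. pos \<mu> i \<and> pos \<nu> (?p i)"] K_mono that by blast
  qed
  have "G_sc r n \<mu> \<inter> (d <#\<^bsub>G\<^esub> G_sc r n \<nu> #>\<^bsub>G\<^esub> ginv d) = G_sc r n \<rho>"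
  proof (rule Set.set_eqI)
    fix g
    show "g \<in> G_sc r n \<mu> \<inter> (d <#\<^bsub>G\<^esub> G_sc r n \<nu> #>\<^bsub>G\<^esub> ginv d) \<longleftrightarrow> g \<in> G_sc r n \<rho>"
    proof (cases "g \<in> carrier G")
      case False
      then show ?thesis by (simp add: G_sc_eq \<mu> \<nu> \<rho>(1) block_group_def)
    next
      case g: True
      let ?g = "ginv d \<odot> g \<odot> d"
      have gn: "perm g i \<in> {1..n} \<longleftrightarrow> i \<in> {1..n}" for i
        by (rule permutes_in_image[OF perm_permutes[OF g]])
      have g': "perm ?g i = ?p (perm g (pinv ?p i))" "expo ?g i = expo g (pinv ?p i)" for i
        using g d expo_less by (simp_all add: perm_mult expo_mult perm_ginv expo_ginv)
      have "?g \<in> G_sc r n \<nu> \<longleftrightarrow>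
          (\<forall>i\<in>{1..n}. blk \<nu> (?p (perm g (pinv ?p i))) = blk \<nu> i) \<and>
          (\<forall>i. expo g (pinv ?p i) \<noteq> 0 \<longrightarrow> pos \<nu> i)"
        using g d by (simp add: G_sc_eq[OF \<nu>] block_group_def preserves_def g')
      also have "\<dots> \<longleftrightarrow> (\<forall>i\<in>{1..n}. blk \<nu> (?p (perm g i)) = blk \<nu> (?p i)) \<and>
          (\<forall>i. expo g i \<noteq> 0 \<longrightarrow> pos \<nu> (?p i))"
      proof -
        \<comment> \<open>Quantifying over i or over its preimage under the bijection
          \<open>perm d\<close> is the same.\<close>
        have "(\<forall>i. P (pinv ?p i) i) \<longleftrightarrow> (\<forall>i. P i (?p i))" for P
          by (metis permutes_inverses[OF p])
        from this[of "\<lambda>k i. i \<in> {1..n} \<longrightarrow> blk \<nu> (?p (perm g k)) = blk \<nu> i"]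
          this[of "\<lambda>k i. expo g k \<noteq> 0 \<longrightarrow> pos \<nu> i"]
        show ?thesis unfolding Ball_def pn by simp
      qed
      finally have \<nu>_iff: "?g \<in> G_sc r n \<nu> \<longleftrightarrow>
          (\<forall>i\<in>{1..n}. blk \<nu> (?p (perm g i)) = blk \<nu> (?p i)) \<and>
          (\<forall>i. expo g i \<noteq> 0 \<longrightarrow> pos \<nu> (?p i))" .
      have \<nu>_sub: "G_sc r n \<nu> \<subseteq> carrier G" unfolding G_sc_eq[OF \<nu>] block_group_def by blast
      have "g \<in> G_sc r n \<mu> \<inter> (d <#\<^bsub>G\<^esub> G_sc r n \<nu> #>\<^bsub>G\<^esub> ginv d) \<longleftrightarrow>
          (\<forall>i\<in>{1..n}. blk \<mu> (perm g i) = blk \<mu> i \<and> blk \<nu> (?p (perm g i)) = blk \<nu> (?p i)) \<and>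
          (\<forall>i. expo g i \<noteq> 0 \<longrightarrow> pos \<mu> i \<and> pos \<nu> (?p i))"
        unfolding Int_iff conj_coset_iff[OF \<nu>_sub d(1)] \<nu>_iff G_sc_eq[OF \<mu>] block_group_def
          preserves_def mem_Collect_eq using g by blast
      also have "\<dots> \<longleftrightarrow> (\<forall>i\<in>{1..n}. blk \<rho> (perm g i) = blk \<rho> i) \<and>
          (\<forall>i. expo g i \<noteq> 0 \<longrightarrow> pos \<rho> i)"
      proof -
        have "blk \<rho> (perm g i) = blk \<rho> i \<longleftrightarrow>
            blk \<mu> (perm g i) = blk \<mu> i \<and> blk \<nu> (?p (perm g i)) = blk \<nu> (?p i)"
          if "i \<in> {1..n}" for i
          using \<rho>(3) K_iff that gn by blast
        moreover have "pos \<rho> i = (pos \<mu> i \<and> pos \<nu> (?p i))" if "expo g i \<noteq> 0" for i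
          using \<rho>(2) expo_outside[OF g] that by metis
        ultimately show ?thesis by metis
      qed
      also have "\<dots> \<longleftrightarrow> g \<in> G_sc r n \<rho>"
        unfolding G_sc_eq[OF \<rho>(1)] block_group_def preserves_def mem_Collect_eq using g by blast
      finally show ?thesis .
    qed
  qed
  then have "\<sigma> = \<rho>"
    unfolding \<sigma>_def sc_meet_def using \<rho>(1) G_sc_inj by (intro the_equality) blast+
  then show "signed_composition n \<sigma>"
    and "\<And>i j. i \<in> {1..n} \<Longrightarrow> j \<in> {1..n} \<Longrightarrow> blk \<sigma> i = blk \<sigma> j \<longleftrightarrow>
      blk \<mu> i = blk \<mu> j \<and> blk \<nu> (?p i) = blk \<nu> (?p j)"
    and "\<And>i. i \<in> {1..n} \<Longrightarrow> pos \<sigma> i \<longleftrightarrow> pos \<mu> i \<and> pos \<nu> (?p i)"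
    using \<rho> K_iff by blast+
qed

end

section \<open>Sums of basis elements in a group algebra\<close>

context
  fixes R :: "('a, 'k) ring_scheme" and G :: "('g, 'm) monoid_scheme"
  assumes R: "cring R" and G: "group G" and fin: "finite (carrier G)"
begin

interpretation R: cring R by (rule R)
interpretation G: group G by (rule G)

abbreviation (input) RG where "RG \<equiv> group_algebra R G"

definition ga_indicator :: "'g set \<Rightarrow> 'g \<Rightarrow> 'a" where
  "ga_indicator S = (\<lambda>x\<in>carrier G. if x \<in> S then \<one>\<^bsub>R\<^esub> else \<zero>\<^bsub>R\<^esub>)"

lemma group_algebra_carrier: "carrier RG = carrier G \<rightarrow>\<^sub>E carrier R"
  using fin by (auto simp: group_algebra_def)

lemma group_algebra_add: "f \<oplus>\<^bsub>RG\<^esub> h = (\<lambda>x\<in>carrier G. f x \<oplus>\<^bsub>R\<^esub> h x)"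
  by (simp add: group_algebra_def)

lemma group_algebra_zero: "\<zero>\<^bsub>RG\<^esub> = (\<lambda>x\<in>carrier G. \<zero>\<^bsub>R\<^esub>)"
  by (simp add: group_algebra_def)

lemma group_algebra_eqI:
  "f \<in> carrier RG \<Longrightarrow> h \<in> carrier RG \<Longrightarrow> (\<And>x. x \<in> carrier G \<Longrightarrow> f x = h x) \<Longrightarrow> f = h"
  unfolding group_algebra_carrier by (rule PiE_ext)

lemma abelian_monoid_group_algebra: "abelian_monoid RG"
proof (rule abelian_monoidI)
  show "f \<oplus>\<^bsub>RG\<^esub> h \<in> carrier RG" if "f \<in> carrier RG" "h \<in> carrier RG" for f h
    using that unfolding group_algebra_add group_algebra_carrier by (auto simp: PiE_iff)
  show "\<zero>\<^bsub>RG\<^esub> \<in> carrier RG" by (simp add: group_algebra_carrier group_algebra_zero)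
  show "(f \<oplus>\<^bsub>RG\<^esub> h) \<oplus>\<^bsub>RG\<^esub> k = f \<oplus>\<^bsub>RG\<^esub> (h \<oplus>\<^bsub>RG\<^esub> k)"
    if "f \<in> carrier RG" "h \<in> carrier RG" "k \<in> carrier RG" for f h k
    using that unfolding group_algebra_add group_algebra_carrier
    by (auto simp: PiE_iff R.a_assoc intro!: restrict_ext)
  show "\<zero>\<^bsub>RG\<^esub> \<oplus>\<^bsub>RG\<^esub> f = f" if "f \<in> carrier RG" for f
    using that unfolding group_algebra_add group_algebra_zero group_algebra_carrier
    by (auto simp: PiE_iff extensional_def restrict_def fun_eq_iff)
  show "f \<oplus>\<^bsub>RG\<^esub> h = h \<oplus>\<^bsub>RG\<^esub> f" if "f \<in> carrier RG" "h \<in> carrier RG" for f h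
    using that unfolding group_algebra_add group_algebra_carrier
    by (auto simp: PiE_iff R.a_comm intro!: restrict_ext)
qed

interpretation RG: abelian_monoid RG by (rule abelian_monoid_group_algebra)

lemma group_algebra_closed: "f \<in> carrier RG \<Longrightarrow> x \<in> carrier G \<Longrightarrow> f x \<in> carrier R"
  unfolding group_algebra_carrier by auto

lemma finsum_apply:
  assumes x: "x \<in> carrier G"
  shows "finite S \<Longrightarrow> f \<in> S \<rightarrow> carrier RG \<Longrightarrow> (\<Oplus>\<^bsub>RG\<^esub>i\<in>S. f i) x = (\<Oplus>\<^bsub>R\<^esub>i\<in>S. f i x)"
proof (induction S rule: finite_induct)
  case empty
  then show ?case using x by (simp add: group_algebra_zero)
next
  case (insert a S)
  then have "(\<Oplus>\<^bsub>RG\<^esub>i\<in>insert a S. f i) = f a \<oplus>\<^bsub>RG\<^esub> (\<Oplus>\<^bsub>RG\<^esub>i\<in>S. f i)"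
    by (intro RG.finsum_insert) auto
  moreover have "(\<Oplus>\<^bsub>R\<^esub>i\<in>insert a S. f i x) = f a x \<oplus>\<^bsub>R\<^esub> (\<Oplus>\<^bsub>R\<^esub>i\<in>S. f i x)"
    using insert x by (intro R.finsum_insert) (auto intro!: group_algebra_closed)
  ultimately show ?case using insert x by (simp add: group_algebra_add)
qed

lemma add_pow_apply:
  fixes k :: nat
  assumes "f \<in> carrier RG" "x \<in> carrier G"
  shows "([k] \<cdot>\<^bsub>RG\<^esub> f) x = [k] \<cdot>\<^bsub>R\<^esub> (f x)"
proof (induction k)
  case 0
  then show ?case using assms by (simp add: add_pow_def group_algebra_zero)
next
  case (Suc k)
  then show ?case using assms
    by (simp add: add_pow_def group_algebra_add)
qed

lemma add_pow_closed:
  fixes k :: nat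
  shows "f \<in> carrier RG \<Longrightarrow> [k] \<cdot>\<^bsub>RG\<^esub> f \<in> carrier RG"
  by (rule RG.add.nat_pow_closed[folded add_pow_def])

lemma ga_basis_closed: "ga_basis R G g \<in> carrier RG"
  by (auto simp: ga_basis_def group_algebra_carrier)

lemma ga_indicator_closed: "ga_indicator S \<in> carrier RG"
  by (auto simp: ga_indicator_def group_algebra_carrier)

lemma finsum_if_one:
  "finite S \<Longrightarrow> (\<Oplus>\<^bsub>R\<^esub>i\<in>S. if P i then \<one>\<^bsub>R\<^esub> else \<zero>\<^bsub>R\<^esub>) = [card {i \<in> S. P i}] \<cdot>\<^bsub>R\<^esub> \<one>\<^bsub>R\<^esub>"
proof (induction S rule: finite_induct)
  case empty
  then show ?case by (simp add: add_pow_def)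
next
  case (insert a S)
  have eq: "{i \<in> insert a S. P i} = (if P a then insert a {i \<in> S. P i} else {i \<in> S. P i})"
    by auto
  have "(\<Oplus>\<^bsub>R\<^esub>i\<in>insert a S. if P i then \<one>\<^bsub>R\<^esub> else \<zero>\<^bsub>R\<^esub>) =
      (if P a then \<one>\<^bsub>R\<^esub> else \<zero>\<^bsub>R\<^esub>) \<oplus>\<^bsub>R\<^esub> [card {i \<in> S. P i}] \<cdot>\<^bsub>R\<^esub> \<one>\<^bsub>R\<^esub>"
    using insert by (subst R.finsum_insert) auto
  moreover have "[card {i \<in> S. P i}] \<cdot>\<^bsub>R\<^esub> \<one>\<^bsub>R\<^esub> \<in> carrier R"
    by (rule R.add.nat_pow_closed[folded add_pow_def]) simp
  ultimately show ?case
    unfolding eq using insert.hyps by (simp add: R.a_comm)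
qed

lemma finsum_basis:
  assumes "S \<subseteq> carrier G"
  shows "(\<Oplus>\<^bsub>RG\<^esub>g\<in>S. ga_basis R G g) = ga_indicator S"
proof (rule group_algebra_eqI)
  have S: "finite S" using assms fin finite_subset by blast
  show "(\<Oplus>\<^bsub>RG\<^esub>g\<in>S. ga_basis R G g) \<in> carrier RG"
    by (rule RG.finsum_closed) (use ga_basis_closed in auto)
  fix x assume x: "x \<in> carrier G"
  have "(\<Oplus>\<^bsub>RG\<^esub>g\<in>S. ga_basis R G g) x = (\<Oplus>\<^bsub>R\<^esub>g\<in>S. if x = g then \<one>\<^bsub>R\<^esub> else \<zero>\<^bsub>R\<^esub>)"
    using x by (subst finsum_apply[OF x S]) (simp_all add: ga_basis_closed Pi_iff, simp add: ga_basis_def)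
  also have "\<dots> = [card {g \<in> S. x = g}] \<cdot>\<^bsub>R\<^esub> \<one>\<^bsub>R\<^esub>" by (rule finsum_if_one[OF S])
  also have "{g \<in> S. x = g} = (if x \<in> S then {x} else {})" by auto
  finally show "(\<Oplus>\<^bsub>RG\<^esub>g\<in>S. ga_basis R G g) x = ga_indicator S x"
    using x by (simp add: ga_indicator_def add_pow_def)
qed (rule ga_indicator_closed)

lemma indicator_mult:
  assumes "S \<subseteq> carrier G" and x: "x \<in> carrier G"
  shows "(ga_indicator S \<otimes>\<^bsub>RG\<^esub> ga_indicator S') x =
    [card {y \<in> S. inv\<^bsub>G\<^esub> y \<otimes>\<^bsub>G\<^esub> x \<in> S'}] \<cdot>\<^bsub>R\<^esub> \<one>\<^bsub>R\<^esub>"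
proof -
  let ?f = "\<lambda>y. ga_indicator S y \<otimes>\<^bsub>R\<^esub> ga_indicator S' (inv\<^bsub>G\<^esub> y \<otimes>\<^bsub>G\<^esub> x)"
  let ?supp = "{y \<in> carrier G. ga_indicator S y \<noteq> \<zero>\<^bsub>R\<^esub>}"
  have f: "?f y = (if y \<in> S \<and> inv\<^bsub>G\<^esub> y \<otimes>\<^bsub>G\<^esub> x \<in> S' then \<one>\<^bsub>R\<^esub> else \<zero>\<^bsub>R\<^esub>)"
    if "y \<in> carrier G" for y
    using that x by (auto simp: ga_indicator_def)
  have "(ga_indicator S \<otimes>\<^bsub>RG\<^esub> ga_indicator S') x = (\<Oplus>\<^bsub>R\<^esub>y\<in>?supp. ?f y)"
    using x by (simp add: group_algebra_def)
  \<comment> \<open>The support of the indicator is smaller than S if R is the zero ring and S is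
    nonempty; summing over the whole carrier avoids the distinction.\<close>
  also have "\<dots> = (\<Oplus>\<^bsub>R\<^esub>y\<in>carrier G. ?f y)"
  proof (rule R.add.finprod_mono_neutral_cong_left)
    show "?f \<in> carrier G \<rightarrow> carrier R" by (auto simp: f)
    show "\<And>y. y \<in> carrier G - ?supp \<Longrightarrow> ?f y = \<zero>\<^bsub>R\<^esub>"
      using x by (auto simp: ga_indicator_def)
  qed (use fin in auto)
  also have "\<dots> = (\<Oplus>\<^bsub>R\<^esub>y\<in>carrier G.
      if y \<in> S \<and> inv\<^bsub>G\<^esub> y \<otimes>\<^bsub>G\<^esub> x \<in> S' then \<one>\<^bsub>R\<^esub> else \<zero>\<^bsub>R\<^esub>)"
    by (rule R.finsum_cong') (auto simp: f)
  also have "\<dots> = [card {y \<in> carrier G. y \<in> S \<and> inv\<^bsub>G\<^esub> y \<otimes>\<^bsub>G\<^esub> x \<in> S'}] \<cdot>\<^bsub>R\<^esub> \<one>\<^bsub>R\<^esub>"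
    by (rule finsum_if_one[OF fin])
  also have "{y \<in> carrier G. y \<in> S \<and> inv\<^bsub>G\<^esub> y \<otimes>\<^bsub>G\<^esub> x \<in> S'} =
      {y \<in> S. inv\<^bsub>G\<^esub> y \<otimes>\<^bsub>G\<^esub> x \<in> S'}" using assms by auto
  finally show ?thesis .
qed

lemma finsum_multiples:
  fixes k :: "'d \<Rightarrow> nat"
  shows "finite D \<Longrightarrow>
    (\<Oplus>\<^bsub>R\<^esub>d\<in>D. [k d] \<cdot>\<^bsub>R\<^esub> (if P d then \<one>\<^bsub>R\<^esub> else \<zero>\<^bsub>R\<^esub>)) =
    [(\<Sum>d\<in>D. if P d then k d else 0)] \<cdot>\<^bsub>R\<^esub> \<one>\<^bsub>R\<^esub>"
proof (induction D rule: finite_induct)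
  case empty
  then show ?case by (simp add: add_pow_def)
next
  case (insert a D)
  have cl: "[j] \<cdot>\<^bsub>R\<^esub> c \<in> carrier R" if "c \<in> carrier R" for j :: nat and c
    using that by (rule R.add.nat_pow_closed[folded add_pow_def])
  have z: "[j] \<cdot>\<^bsub>R\<^esub> \<zero>\<^bsub>R\<^esub> = \<zero>\<^bsub>R\<^esub>" for j :: nat
    using R.add.nat_pow_one[of j] by (simp add: add_pow_def)
  have "(\<Oplus>\<^bsub>R\<^esub>d\<in>insert a D. [k d] \<cdot>\<^bsub>R\<^esub> (if P d then \<one>\<^bsub>R\<^esub> else \<zero>\<^bsub>R\<^esub>)) =
    [k a] \<cdot>\<^bsub>R\<^esub> (if P a then \<one>\<^bsub>R\<^esub> else \<zero>\<^bsub>R\<^esub>) \<oplus>\<^bsub>R\<^esub>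
      [(\<Sum>d\<in>D. if P d then k d else 0)] \<cdot>\<^bsub>R\<^esub> \<one>\<^bsub>R\<^esub>"
    using insert by (subst R.finsum_insert) (auto intro!: cl)
  then show ?case
    using insert.hyps
    by (simp add: z cl R.add.nat_pow_mult[folded add_pow_def, simplified])
qed

text \<open>Reduces the identity to a count in the naturals for each x, whatever the characteristic
  of R. The sets B d may overlap, so the coefficients of all d with x in B d add up.\<close>

lemma product_of_basis_sums:
  fixes k :: "'d \<Rightarrow> nat"
  assumes S: "S \<subseteq> carrier G" "S' \<subseteq> carrier G" and D: "finite D" "\<And>d. d \<in> D \<Longrightarrow> B d \<subseteq> carrier G"
    and count: "\<And>x. x \<in> carrier G \<Longrightarrow>
      card {y \<in> S. inv\<^bsub>G\<^esub> y \<otimes>\<^bsub>G\<^esub> x \<in> S'} = (\<Sum>d\<in>D. if x \<in> B d then k d else 0)"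
  shows "(\<Oplus>\<^bsub>RG\<^esub>g\<in>S. ga_basis R G g) \<otimes>\<^bsub>RG\<^esub> (\<Oplus>\<^bsub>RG\<^esub>g\<in>S'. ga_basis R G g) =
    (\<Oplus>\<^bsub>RG\<^esub>d\<in>D. [k d] \<cdot>\<^bsub>RG\<^esub> (\<Oplus>\<^bsub>RG\<^esub>g\<in>B d. ga_basis R G g))"
proof -
  have cl: "(\<lambda>d. [k d] \<cdot>\<^bsub>RG\<^esub> ga_indicator (B d)) \<in> D \<rightarrow> carrier RG"
    by (auto intro: add_pow_closed ga_indicator_closed)
  have "ga_indicator S \<otimes>\<^bsub>RG\<^esub> ga_indicator S' = (\<Oplus>\<^bsub>RG\<^esub>d\<in>D. [k d] \<cdot>\<^bsub>RG\<^esub> ga_indicator (B d))"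
  proof (rule group_algebra_eqI)
    have "[j] \<cdot>\<^bsub>R\<^esub> \<one>\<^bsub>R\<^esub> \<in> carrier R" for j :: nat
      by (rule R.add.nat_pow_closed[folded add_pow_def]) simp
    moreover have "ga_indicator S \<otimes>\<^bsub>RG\<^esub> ga_indicator S' \<in> extensional (carrier G)"
      by (simp add: group_algebra_def)
    ultimately show "ga_indicator S \<otimes>\<^bsub>RG\<^esub> ga_indicator S' \<in> carrier RG"
      unfolding group_algebra_carrier PiE_iff by (simp add: indicator_mult[OF S(1)])
    show "(\<Oplus>\<^bsub>RG\<^esub>d\<in>D. [k d] \<cdot>\<^bsub>RG\<^esub> ga_indicator (B d)) \<in> carrier RG"
      using cl by (rule RG.finsum_closed)
    fix x assume x: "x \<in> carrier G"
    have "(\<Oplus>\<^bsub>RG\<^esub>d\<in>D. [k d] \<cdot>\<^bsub>RG\<^esub> ga_indicator (B d)) x =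
        (\<Oplus>\<^bsub>R\<^esub>d\<in>D. [k d] \<cdot>\<^bsub>R\<^esub> (if x \<in> B d then \<one>\<^bsub>R\<^esub> else \<zero>\<^bsub>R\<^esub>))"
      using x by (simp add: finsum_apply[OF x D(1) cl] add_pow_apply ga_indicator_closed)
        (simp add: ga_indicator_def)
    also have "\<dots> = [(\<Sum>d\<in>D. if x \<in> B d then k d else 0)] \<cdot>\<^bsub>R\<^esub> \<one>\<^bsub>R\<^esub>"
      by (rule finsum_multiples[OF D(1)])
    finally show "(ga_indicator S \<otimes>\<^bsub>RG\<^esub> ga_indicator S') x =
        (\<Oplus>\<^bsub>RG\<^esub>d\<in>D. [k d] \<cdot>\<^bsub>RG\<^esub> ga_indicator (B d)) x"
      by (simp only: indicator_mult[OF S(1) x] count[OF x])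
  qed
  moreover have "(\<Oplus>\<^bsub>RG\<^esub>d\<in>D. [k d] \<cdot>\<^bsub>RG\<^esub> (\<Oplus>\<^bsub>RG\<^esub>g\<in>B d. ga_basis R G g)) =
      (\<Oplus>\<^bsub>RG\<^esub>d\<in>D. [k d] \<cdot>\<^bsub>RG\<^esub> ga_indicator (B d))"
    using cl by (intro RG.finsum_cong') (auto simp: finsum_basis D(2))
  ultimately show ?thesis by (simp add: finsum_basis S)
qed

end

section \<open>Counting factorisations\<close>

context cyclotomic
begin

lemma T_sc_eq:
  assumes "signed_composition n \<mu>"
  shows "T_sc r n \<mu> = {\<tau> \<in> carrier G. perm \<tau> = id \<and> (\<forall>i. expo \<tau> i \<noteq> 0 \<longrightarrow> pos \<mu> i)}"
  unfolding T_sc_def G_sc_eq[OF assms] T_sub_eq block_group_def preserves_def by auto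

context
  fixes \<mu> \<nu> :: "int list" and x :: "nat word set"
  assumes \<mu>: "signed_composition n \<mu>" and \<nu>: "signed_composition n \<nu>" and x: "x \<in> carrier G"
begin

definition factors :: "nat word set set" where
  "factors = {y \<in> E_set r n \<mu>. ginv y \<odot> x \<in> E_set r n \<nu>}"

text \<open>Equal \<nu>-blocks mean that the permutation of y lies in the left coset of d by the
  Young subgroup of \<nu>. For y increasing on the blocks of \<mu>, this captures the double coset
  of d.\<close>

definition same_double_coset where
  "same_double_coset d y \<longleftrightarrow> (\<forall>i\<in>{1..n}. blk \<nu> (perm d i) = blk \<nu> (perm y i))"

lemma factors_iff:
  "y \<in> factors \<longleftrightarrow> y \<in> carrier G \<and> increasing n (blk \<mu>) (perm y) \<and>
    (\<forall>i. pos \<mu> i \<longrightarrow> expo y i = 0) \<and>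
    increasing n (blk \<nu>) (perm (ginv y \<odot> x)) \<and> (\<forall>i. pos \<nu> i \<longrightarrow> expo (ginv y \<odot> x) i = 0)"
  unfolding factors_def E_set_eq[OF \<mu>] E_set_eq[OF \<nu>] using x by blast

lemma perm_factor: "y \<in> carrier G \<Longrightarrow> perm (ginv y \<odot> x) \<circ> perm y = perm x"
  using perm_mult[of y "ginv y \<odot> x"] x by (simp flip: m_assoc)

lemma expo_factor:
  "y \<in> carrier G \<Longrightarrow> expo x i = (expo y i + expo (ginv y \<odot> x) (perm y i)) mod r"
  using expo_mult[of y "ginv y \<odot> x" i] x by (simp flip: m_assoc)

lemma expo_factor_pos:
  assumes "y \<in> factors" "pos \<nu> (perm y i)"
  shows "expo y i = expo x i"
  using assms expo_factor[of y i] expo_less[of y i] by (simp add: factors_iff)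

lemma same_double_coset_pos:
  assumes "d \<in> carrier G" "y \<in> carrier G" "same_double_coset d y" "i \<in> {1..n}"
  shows "pos \<nu> (perm d i) = pos \<nu> (perm y i)"
proof -
  have "perm d i \<in> {1..n}" "perm y i \<in> {1..n}"
    using permutes_in_image[OF perm_permutes] assms by blast+
  then show ?thesis
    using blk_eq_imp_pos_eq[OF \<nu>] assms(3,4) unfolding same_double_coset_def by simp
qed

text \<open>Two permutations inducing the same distribution of \<open>{1..n}\<close> over the blocks of \<open>\<nu>\<close> differ
  by a permutation \<open>u\<close> preserving these blocks, and sorting along blocks is unique.\<close>

lemma perm_eq_of_same_blocks:
  assumes p: "p permutes {1..n}" and p': "p' permutes {1..n}"
    and blk: "\<And>i. i \<in> {1..n} \<Longrightarrow> blk \<nu> (p i) = blk \<nu> (p' i)"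
    and q: "increasing n (blk \<nu>) q" "increasing n (blk \<nu>) q'" "q \<circ> p = q' \<circ> p'"
  shows "p = p'"
proof -
  let ?u = "p' \<circ> pinv p"
  have u: "?u permutes {1..n}" by (rule permutes_compose[OF permutes_inv[OF p] p'])
  have "preserves n (blk \<nu>) ?u"
    unfolding preserves_def
  proof
    fix i assume "i \<in> {1..n}"
    then have "pinv p i \<in> {1..n}" using permutes_in_image[OF permutes_inv[OF p]] by blast
    from blk[OF this] show "blk \<nu> (?u i) = blk \<nu> i"
      using permutes_inverses(1)[OF p] by simp
  qed
  moreover have "q' \<circ> ?u = q"
  proof
    fix i
    have "q' (p' (pinv p i)) = q (p (pinv p i))" using q(3) by (metis comp_apply)
    then show "(q' \<circ> ?u) i = q i" using permutes_inverses(1)[OF p] by simp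
  qed
  ultimately have "?u = id"
    using q(1) by (intro sort_blocks_unique[OF mono_blk u _ q(2)]) simp_all
  then have "p' (pinv p (p i)) = p i" for i by (metis comp_apply id_apply)
  then show ?thesis using permutes_inverses(2)[OF p] by (simp add: fun_eq_iff)
qed

lemma factors_double_coset:
  assumes "y \<in> factors"
  shows "\<exists>d\<in>D_double r n (sc_plus \<mu>) (sc_plus \<nu>). same_double_coset d y"
proof -
  have y: "y \<in> carrier G" "increasing n (blk \<mu>) (perm y)" using assms by (simp_all add: factors_iff)
  note p = perm_permutes[OF y(1)]
  \<comment> \<open>The inverse is what gets sorted, because minimality on the \<nu> side concerns
    the inverse of d.\<close>
  obtain u where u: "u permutes {1..n}" "preserves n (blk \<nu>) u"
    "increasing n (blk \<nu>) (pinv (perm y) \<circ> u)"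
    using sort_blocks[OF mono_blk permutes_inv[OF p]] by blast
  let ?q = "pinv u \<circ> perm y"
  have q: "?q permutes {1..n}" by (rule permutes_compose[OF p permutes_inv[OF u(1)]])
  obtain d where d: "d \<in> carrier G" "perm d = ?q" "expo d = (\<lambda>_. 0)"
    using ex_perm_expo[OF q, of "\<lambda>_. 0"] r_gt_1 by auto
  have same: "blk \<nu> (?q i) = blk \<nu> (perm y i)" if "i \<in> {1..n}" for i
  proof -
    have "perm y i \<in> {1..n}" using permutes_in_image[OF p] that by blast
    then show ?thesis using preserves_inv[OF u(1,2)] unfolding preserves_def by simp
  qed
  have "pinv ?q = pinv (perm y) \<circ> u"
    using permutes_bij[OF p] permutes_bij[OF permutes_inv[OF u(1)]] permutes_inv_inv[OF u(1)]
    by (simp add: o_inv_distrib)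
  then have inc: "increasing n (blk \<nu>) (pinv ?q)" using u(3) by simp
  have "increasing n (blk \<mu>) ?q"
    by (rule increasing_transfer[OF mono_blk p q same y(2) inc])
  then have "d \<in> D_double r n (sc_plus \<mu>) (sc_plus \<nu>)"
    using d inc by (simp add: D_double_iff[OF \<mu> \<nu>])
  moreover have "same_double_coset d y" using same by (simp add: same_double_coset_def d(2))
  ultimately show ?thesis by blast
qed

text \<open>Both inverses increase on the blocks of \<nu>, so \<open>perm_eq_of_same_blocks\<close>
  applies to the two ways of composing to the identity.\<close>

lemma double_coset_unique:
  assumes "d \<in> D_double r n (sc_plus \<mu>) (sc_plus \<nu>)" "d' \<in> D_double r n (sc_plus \<mu>) (sc_plus \<nu>)"
    and "same_double_coset d y" "same_double_coset d' y"
  shows "d = d'"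
proof -
  have d: "d \<in> carrier G" "d' \<in> carrier G" "\<And>i. expo d i = 0" "\<And>i. expo d' i = 0"
    "increasing n (blk \<nu>) (pinv (perm d))" "increasing n (blk \<nu>) (pinv (perm d'))"
    using assms(1,2) by (simp_all add: D_double_iff[OF \<mu> \<nu>])
  have "perm d = perm d'"
  proof (rule perm_eq_of_same_blocks[OF _ _ _ d(5,6)])
    show "blk \<nu> (perm d i) = blk \<nu> (perm d' i)" if "i \<in> {1..n}" for i
      using assms(3,4) that unfolding same_double_coset_def by simp
    show "pinv (perm d) \<circ> perm d = pinv (perm d') \<circ> perm d'"
      using permutes_inv_o(2)[OF perm_permutes] d by simp
  qed (use d perm_permutes in blast)+
  then show ?thesis using d by (intro perm_expo_inj) simp_all
qed

context
  fixes d \<sigma> \<sigma>'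
  assumes d: "d \<in> D_double r n (sc_plus \<mu>) (sc_plus \<nu>)"
    and \<sigma>_eq: "\<sigma> = sc_meet r n \<mu> d \<nu>"
    and \<sigma>'_eq: "\<sigma>' = sc_meet r n (sc_neg \<mu>) d (sc_neg \<nu>)"
begin

lemma d_props:
  "d \<in> carrier G" "\<And>i. expo d i = 0" "increasing n (blk \<mu>) (perm d)"
  "increasing n (blk \<nu>) (pinv (perm d))"
  using d by (simp_all add: D_double_iff[OF \<mu> \<nu>])

lemma d_in_range: "i \<in> {1..n} \<Longrightarrow> perm d i \<in> {1..n}"
  using permutes_in_image[OF perm_permutes[OF d_props(1)]] by blast

lemmas meet = sc_meet_props[OF \<mu> \<nu> d_props(1-3), folded \<sigma>_eq]

text \<open>Negation keeps the blocks and swaps the signs. The points found here are those where a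
  factor y may choose its exponent freely.\<close>

lemma meet_neg:
  "signed_composition n \<sigma>'"
  "i \<in> {1..n} \<Longrightarrow> pos \<sigma>' i \<longleftrightarrow> \<not> pos \<mu> i \<and> \<not> pos \<nu> (perm d i)"
proof -
  note props = sc_meet_props[OF signed_composition_neg[OF \<mu>] signed_composition_neg[OF \<nu>]
      d_props(1,2), unfolded blk_neg, OF d_props(3), folded \<sigma>'_eq]
  show "signed_composition n \<sigma>'" by (rule props)
  show "i \<in> {1..n} \<Longrightarrow> pos \<sigma>' i \<longleftrightarrow> \<not> pos \<mu> i \<and> \<not> pos \<nu> (perm d i)"
    using props(3)[of i] pos_neg[OF \<mu>, of i] pos_neg[OF \<nu>, of "perm d i"] d_in_range[of i] by simp
qed

text \<open>On a block of \<sigma>, y keeps the order and lands in one block of \<nu>, where the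
  second factor keeps it as well. At a positive point of \<sigma> both factors contribute exponent
  0.\<close>

lemma fibre_imp_E_set:
  assumes "y \<in> factors" "same_double_coset d y"
  shows "x \<in> E_set r n \<sigma>"
proof -
  define z where "z = ginv y \<odot> x"
  have y: "y \<in> carrier G" "increasing n (blk \<mu>) (perm y)" "\<And>i. pos \<mu> i \<Longrightarrow> expo y i = 0"
    and z: "increasing n (blk \<nu>) (perm z)" "\<And>i. pos \<nu> i \<Longrightarrow> expo z i = 0"
    using assms(1) by (simp_all add: factors_iff z_def)
  have px: "perm x i = perm z (perm y i)" for i
    using perm_factor[OF y(1)] unfolding z_def by (metis comp_apply)
  have "increasing n (blk \<sigma>) (perm x)"
    unfolding increasing_def
  proof (intro allI impI)
    fix i j assume ij: "1 \<le> i \<and> i < j \<and> j \<le> n \<and> blk \<sigma> i = blk \<sigma> j"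
    then have mem: "i \<in> {1..n}" "j \<in> {1..n}" by simp_all
    then have b: "blk \<mu> i = blk \<mu> j" "blk \<nu> (perm d i) = blk \<nu> (perm d j)"
      using meet(2)[OF mem] ij by simp_all
    have "perm y i < perm y j" using y(2) b(1) ij unfolding increasing_def by blast
    moreover have "blk \<nu> (perm y i) = blk \<nu> (perm y j)"
      using assms(2) b(2) mem unfolding same_double_coset_def by simp
    moreover have "1 \<le> perm y i" "perm y j \<le> n"
      using permutes_in_image[OF perm_permutes[OF y(1)]] mem by (meson atLeastAtMost_iff)+
    ultimately show "perm x i < perm x j" using z(1) unfolding increasing_def px by blast
  qed
  moreover have "expo x i = 0" if "pos \<sigma> i" for i
  proof (cases "i \<in> {1..n}")
    case True
    then have "pos \<mu> i" "pos \<nu> (perm d i)" using meet(3) that by simp_all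
    moreover from this have "pos \<nu> (perm y i)"
      using same_double_coset_pos[OF d_props(1) y(1) assms(2) True] by simp
    ultimately show ?thesis using expo_factor[OF y(1), of i] y(3) z(2) by (simp add: z_def)
  qed (use expo_outside[OF x] in blast)
  ultimately show ?thesis using x by (simp add: E_set_eq[OF meet(1)])
qed

text \<open>The permutation of y has to be \<open>perm d\<close> corrected within blocks of \<nu>.
  Sorting the permutation of d^{-1} x along these blocks yields the correction u and leaves the
  permutation z of the second factor.\<close>

lemma E_set_imp_fibre:
  assumes "x \<in> E_set r n \<sigma>"
  shows "\<exists>y\<in>factors. same_double_coset d y"
proof -
  have incx: "increasing n (blk \<sigma>) (perm x)" and ex: "\<And>i. pos \<sigma> i \<Longrightarrow> expo x i = 0"
    using assms by (simp_all add: E_set_eq[OF meet(1)])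
  note pd = perm_permutes[OF d_props(1)] and px = perm_permutes[OF x]
  have "perm x \<circ> pinv (perm d) permutes {1..n}"
    by (rule permutes_compose[OF permutes_inv[OF pd] px])
  then obtain u where u: "u permutes {1..n}" "preserves n (blk \<nu>) u"
    "increasing n (blk \<nu>) (perm x \<circ> pinv (perm d) \<circ> u)"
    using sort_blocks[OF mono_blk] by blast
  define z where "z = perm x \<circ> pinv (perm d) \<circ> u"
  define p where "p = pinv u \<circ> perm d"
  have p: "p permutes {1..n}"
    unfolding p_def by (rule permutes_compose[OF pd permutes_inv[OF u(1)]])
  have zp: "z (p i) = perm x i" for i
    using permutes_inverses[OF u(1)] permutes_inverses[OF pd] by (simp add: z_def p_def)
  have blk_p: "blk \<nu> (perm d i) = blk \<nu> (p i)" if "i \<in> {1..n}" for i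
    using preserves_inv[OF u(1,2)] d_in_range[OF that] unfolding preserves_def p_def by simp
  \<comment> \<open>Since d keeps i < j in order, p can reverse them only inside one block of \<nu>.
    Then they share a block of \<sigma>, and z increasing contradicts x increasing.\<close>
  have incp: "increasing n (blk \<mu>) p"
    unfolding increasing_def
  proof (intro allI impI)
    fix i j assume ij: "1 \<le> i \<and> i < j \<and> j \<le> n \<and> blk \<mu> i = blk \<mu> j"
    then have mem: "i \<in> {1..n}" "j \<in> {1..n}" by simp_all
    have lt: "perm d i < perm d j" using d_props(3) ij unfolding increasing_def by blast
    have neq: "p i \<noteq> p j" using permutes_inj[OF p] ij by (metis inj_eq less_irrefl)
    show "p i < p j"
    proof (rule ccontr)
      assume "\<not> p i < p j"
      then have gt: "p j < p i" using neq by simp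
      have "blk \<nu> (p j) \<le> blk \<nu> (p i)" using gt by (simp add: monoD[OF mono_blk])
      moreover have "blk \<nu> (p i) \<le> blk \<nu> (p j)"
        using lt blk_p[OF mem(1)] blk_p[OF mem(2)] monoD[OF mono_blk, of "perm d i" "perm d j" \<nu>]
        by simp
      ultimately have eq: "blk \<nu> (p j) = blk \<nu> (p i)" by simp
      have "1 \<le> p j" "p i \<le> n"
        using permutes_in_image[OF p] mem by (meson atLeastAtMost_iff)+
      then have "z (p j) < z (p i)"
        using u(3)[folded z_def] gt eq unfolding increasing_def by blast
      moreover have "blk \<sigma> i = blk \<sigma> j"
        using meet(2)[OF mem] ij eq blk_p[OF mem(1)] blk_p[OF mem(2)] by simp
      then have "perm x i < perm x j" using incx ij unfolding increasing_def by blast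
      ultimately show False by (simp add: zp)
    qed
  qed
  \<comment> \<open>The factor y takes over the exponent of x wherever \<mu> allows it, leaving 0
    for the second factor.\<close>
  have "(if pos \<mu> i then 0 else expo x i) < r" for i
    using expo_less r_gt_1 by simp
  moreover have "(if pos \<mu> i then 0 else expo x i) = 0" if "i \<notin> {1..n}" for i
    using expo_outside[OF x that] by simp
  ultimately obtain y where y: "y \<in> carrier G" "perm y = p"
    "expo y = (\<lambda>i. if pos \<mu> i then 0 else expo x i)"
    using ex_perm_expo[OF p, of "\<lambda>i. if pos \<mu> i then 0 else expo x i"] by blast
  have "perm (ginv y \<odot> x) = z"
  proof
    fix k
    have "perm (ginv y \<odot> x) (p (pinv p k)) = z (p (pinv p k))"
      using perm_factor[OF y(1)] unfolding y(2) zp by (metis comp_apply)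
    then show "perm (ginv y \<odot> x) k = z k" using permutes_inverses(1)[OF p] by simp
  qed
  moreover have "expo (ginv y \<odot> x) k = 0" if k: "pos \<nu> k" for k
  proof (cases "k \<in> {1..n}")
    case True
    define i where "i = pinv p k"
    have i: "i \<in> {1..n}" "p i = k"
      unfolding i_def using True permutes_in_image[OF permutes_inv[OF p]] permutes_inverses(1)[OF p]
      by simp_all
    have "same_double_coset d y" using blk_p by (simp add: same_double_coset_def y(2))
    then have "pos \<nu> (perm d i)"
      using same_double_coset_pos[OF d_props(1) y(1) _ i(1)] k i(2) y(2) by simp
    \<comment> \<open>If \<mu> is positive at i, so is \<sigma>, and then \<open>expo x i\<close> is
      0 as well.\<close>
    then have "expo y i = expo x i" using ex meet(3)[OF i(1)] by (simp add: y(3))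
    then have "(expo y i + expo (ginv y \<odot> x) k) mod r = expo y i"
      using expo_factor[OF y(1), of i] by (simp add: y(2) i(2))
    then show ?thesis using mod_add_left_cancel expo_less by blast
  qed (use expo_outside x y(1) in simp)
  ultimately have "y \<in> factors"
    using y incp u(3)[folded z_def] by (simp add: factors_iff)
  moreover have "same_double_coset d y" using blk_p by (simp add: same_double_coset_def y(2))
  ultimately show ?thesis by blast
qed

text \<open>Factors with the same d have the same permutation. Their exponents agree where \<mu> is
  positive (both are 0) and where \<nu> is positive at the image (both are those of x). So they
  differ by an element of T supported on the positive points of \<sigma>', and such an element
  disturbs none of the conditions.\<close>

lemma fibre_eq_coset:
  assumes y0: "y0 \<in> factors" "same_double_coset d y0"
  shows "{y \<in> factors. same_double_coset d y} = (\<lambda>\<tau>. \<tau> \<odot> y0) ` T_sc r n \<sigma>'"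
proof (rule Set.set_eqI, rule iffI)
  have c0: "y0 \<in> carrier G" using y0(1) by (simp add: factors_iff)
  note p0 = perm_permutes[OF c0]
  have pos0: "pos \<nu> (perm d i) = pos \<nu> (perm y0 i)" if "i \<in> {1..n}" for i
    using same_double_coset_pos[OF d_props(1) c0 y0(2) that] .
  {
    fix y assume "y \<in> {y \<in> factors. same_double_coset d y}"
    then have y: "y \<in> factors" "same_double_coset d y" by simp_all
    have c: "y \<in> carrier G" using y(1) by (simp add: factors_iff)
    have perm_eq: "perm y = perm y0"
    proof (rule perm_eq_of_same_blocks)
      show "blk \<nu> (perm y i) = blk \<nu> (perm y0 i)" if "i \<in> {1..n}" for i
        using y(2) y0(2) that unfolding same_double_coset_def by simp
      show "perm (ginv y \<odot> x) \<circ> perm y = perm (ginv y0 \<odot> x) \<circ> perm y0"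
        by (simp only: perm_factor c c0)
    qed (use y(1) y0(1) c c0 perm_permutes in \<open>simp_all add: factors_iff\<close>)
    define \<tau> where "\<tau> = y \<odot> ginv y0"
    have \<tau>: "\<tau> \<in> carrier G" "y = \<tau> \<odot> y0" using c c0 by (simp_all add: \<tau>_def m_assoc)
    have "perm y0 (perm \<tau> i) = perm y0 i" for i
      using perm_mult[OF \<tau>(1) c0] perm_eq \<tau>(2) by (metis comp_apply)
    then have id: "perm \<tau> = id" using permutes_inj[OF p0] by (simp add: fun_eq_iff inj_eq)
    have "expo \<tau> i = 0" if "expo y i = expo y0 i" for i
    proof -
      have "(expo y0 i + expo \<tau> i) mod r = expo y0 i"
        using that expo_mult[OF \<tau>(1) c0, of i] id \<tau>(2) by (simp add: add.commute)
      then show ?thesis using mod_add_left_cancel expo_less by blast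
    qed
    moreover have "expo y i = expo y0 i" if "pos \<mu> i" for i
      using y(1) y0(1) that by (simp add: factors_iff)
    moreover have "expo y i = expo y0 i" if "pos \<nu> (perm d i)" "i \<in> {1..n}" for i
      using expo_factor_pos[OF y(1), of i] expo_factor_pos[OF y0(1), of i] pos0 that perm_eq by simp
    ultimately have "expo \<tau> i \<noteq> 0 \<longrightarrow> pos \<sigma>' i" for i
      using meet_neg(2) expo_outside[OF \<tau>(1)] by metis
    then have "\<tau> \<in> T_sc r n \<sigma>'" using \<tau>(1) id by (simp add: T_sc_eq[OF meet_neg(1)])
    then show "y \<in> (\<lambda>\<tau>. \<tau> \<odot> y0) ` T_sc r n \<sigma>'" using \<tau>(2) by blast
  next
    fix y assume "y \<in> (\<lambda>\<tau>. \<tau> \<odot> y0) ` T_sc r n \<sigma>'"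
    then obtain \<tau> where \<tau>: "\<tau> \<in> carrier G" "perm \<tau> = id" "\<And>i. expo \<tau> i \<noteq> 0 \<Longrightarrow> pos \<sigma>' i"
      and y: "y = \<tau> \<odot> y0"
      unfolding T_sc_eq[OF meet_neg(1)] by blast
    have c: "y \<in> carrier G" and py: "perm y = perm y0" using \<tau> c0 by (simp_all add: y perm_mult)
    have ey: "expo y i = expo y0 i" if "expo \<tau> i = 0" for i
      using \<tau> c0 that expo_less by (simp add: y expo_mult)
    have ez: "perm (ginv y \<odot> x) = perm (ginv y0 \<odot> x)"
    proof
      fix k
      have "perm (ginv y \<odot> x) (perm y0 (pinv (perm y0) k)) =
          perm (ginv y0 \<odot> x) (perm y0 (pinv (perm y0) k))"
        using perm_factor[OF c] perm_factor[OF c0] py by (metis comp_apply)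
      then show "perm (ginv y \<odot> x) k = perm (ginv y0 \<odot> x) k"
        using permutes_inverses(1)[OF p0] by simp
    qed
    have "expo y i = 0" if "pos \<mu> i" for i
    proof (cases "i \<in> {1..n}")
      case True
      then have "expo \<tau> i = 0" using \<tau>(3)[of i] meet_neg(2)[OF True] that by blast
      then show ?thesis using ey y0(1) that by (simp add: factors_iff)
    qed (use expo_outside[OF c] in blast)
    moreover have "expo (ginv y \<odot> x) k = 0" if k: "pos \<nu> k" for k
    proof (cases "k \<in> {1..n}")
      case True
      define i where "i = pinv (perm y0) k"
      have i: "i \<in> {1..n}" "perm y0 i = k"
        unfolding i_def
        using True permutes_in_image[OF permutes_inv[OF p0]] permutes_inverses(1)[OF p0]
        by simp_all
      have "expo \<tau> i = 0" using \<tau>(3)[of i] meet_neg(2)[OF i(1)] pos0[OF i(1)] k i(2) by blast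
      then have "expo y i = expo x i" using ey expo_factor_pos[OF y0(1), of i] k i(2) by simp
      then have "(expo y i + expo (ginv y \<odot> x) k) mod r = expo y i"
        using expo_factor[OF c, of i] by (simp add: py i(2))
      then show ?thesis using mod_add_left_cancel expo_less by blast
    qed (use expo_outside x c in simp)
    ultimately have "y \<in> factors" using c py ez y0(1) by (simp add: factors_iff)
    moreover have "same_double_coset d y" using y0(2) by (simp add: same_double_coset_def py)
    ultimately show "y \<in> {y \<in> factors. same_double_coset d y}" by simp
  }
qed

lemma card_fibre:
  "card {y \<in> factors. same_double_coset d y} =
    (if x \<in> E_set r n \<sigma> then card (T_sc r n \<sigma>') else 0)"
proof (cases "x \<in> E_set r n \<sigma>")
  case True
  then obtain y0 where y0: "y0 \<in> factors" "same_double_coset d y0"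
    using E_set_imp_fibre by blast
  have "inj_on (\<lambda>\<tau>. \<tau> \<odot> y0) (T_sc r n \<sigma>')"
    using y0(1) by (intro inj_onI) (simp add: T_sc_eq[OF meet_neg(1)] factors_iff)
  then show ?thesis using True by (simp add: fibre_eq_coset[OF y0] card_image)
next
  case False
  then have "{y \<in> factors. same_double_coset d y} = {}" using fibre_imp_E_set by blast
  then show ?thesis by (simp only: False if_False card.empty)
qed

end

text \<open>The fibres over the representatives d cover all factors by
  \<open>factors_double_coset\<close> and are disjoint by
  \<open>double_coset_unique\<close>.\<close>

lemma card_factors:
  "card {y \<in> E_set r n \<mu>. ginv y \<odot> x \<in> E_set r n \<nu>} =
    (\<Sum>d\<in>D_double r n (sc_plus \<mu>) (sc_plus \<nu>).
      if x \<in> E_set r n (sc_meet r n \<mu> d \<nu>)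
      then card (T_sc r n (sc_meet r n (sc_neg \<mu>) d (sc_neg \<nu>))) else 0)"
proof -
  let ?D = "D_double r n (sc_plus \<mu>) (sc_plus \<nu>)"
  have "factors \<subseteq> carrier G" by (auto simp: factors_iff)
  then have fin: "finite factors" using finite_carrier finite_subset by blast
  have "?D \<subseteq> carrier G" by (auto simp: D_double_iff[OF \<mu> \<nu>])
  then have finD: "finite ?D" using finite_carrier finite_subset by blast
  have "factors = (\<Union>d\<in>?D. {y \<in> factors. same_double_coset d y})"
    using factors_double_coset by blast
  then have "card factors = card (\<Union>d\<in>?D. {y \<in> factors. same_double_coset d y})" by simp
  also have "\<dots> = (\<Sum>d\<in>?D. card {y \<in> factors. same_double_coset d y})"
    using fin finD double_coset_unique by (intro card_UN_disjoint) auto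
  also have "\<dots> = (\<Sum>d\<in>?D. if x \<in> E_set r n (sc_meet r n \<mu> d \<nu>)
      then card (T_sc r n (sc_meet r n (sc_neg \<mu>) d (sc_neg \<nu>))) else 0)"
    by (rule sum.cong) (simp_all add: card_fibre)
  finally show ?thesis unfolding factors_def .
qed

end

end

theorem theorem6p7:
  fixes R :: "('a, 'k) ring_scheme" and r n :: nat and \<mu> \<nu> :: "int list"
  assumes "cring R" and "r > 1" and "n \<ge> 1"
    and "signed_composition n \<mu>" and "signed_composition n \<nu>"
  shows "E_sc R r n \<mu> \<otimes>\<^bsub>group_algebra R (Grn r n)\<^esub> E_sc R r n \<nu> =
    (\<Oplus>\<^bsub>group_algebra R (Grn r n)\<^esub>d \<in> D_double r n (sc_plus \<mu>) (sc_plus \<nu>).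
      [card (T_sc r n (sc_meet r n (sc_neg \<mu>) d (sc_neg \<nu>)))] \<cdot>\<^bsub>group_algebra R (Grn r n)\<^esub>
        E_sc R r n (sc_meet r n \<mu> d \<nu>))"
proof -
  interpret cyclotomic r n by unfold_locales (rule assms(2))
  have sub: "E_set r n \<sigma> \<subseteq> carrier (Grn r n)" for \<sigma>
    unfolding E_set_def by blast
  have "D_double r n (sc_plus \<mu>) (sc_plus \<nu>) \<subseteq> carrier (Grn r n)"
    using D_double_iff[OF assms(4,5)] by blast
  then have "finite (D_double r n (sc_plus \<mu>) (sc_plus \<nu>))"
    using finite_carrier finite_subset by blast
  then show ?thesis
    unfolding E_sc_def
    by (rule product_of_basis_sums[OF assms(1) is_group finite_carrier sub sub _ sub])
      (rule card_factors[OF assms(4,5)])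
qed

end
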